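(* Let $\mathcal{H}$ be a nonzero complex Hilbert space and $n\geq2$. Let $f\in OM_{1}$ be non-constant. Then for all $\mathbb{T}=(T_{1},\dots,T_{n})\in B(\mathcal{H})_{sa}^{n}$ the following are equivalent: (1) $\sum_{i=1}^{n}\frac1n T_{i}\leq 0$; (2) $\mathfrak{L}(\Lambda)(f(\lambda T_{1}+I),\dots,f(\lambda T_{n}+I))\leq I$ for all sufficiently small $\lambda\geq 0$.
   Context: $B(\mathcal{H})$ is the algebra of bounded linear operators on $\mathcal{H}$, $I$ is the identity, $B(\mathcal{H})_{sa}$ is the set of self-adjoint operators, and $B(\mathcal{H})_{+}$ is the set of positive definite (positive and invertible) operators. For self-adjoint $A,B$, $A\leq B$ means $B-A$ is positive semi-definite. $\Delta_{n}$ is the set of $\omega=(w_1,\dots,w_n)\in(0,1)^n$ with $\sum_k w_k=1$. A real-valued function $f$ on an interval $J$ is operator monotone if $A\leq B$ implies $f(A)\leq f(B)$ for all self-adjoint $A,B$ (on any complex Hilbert space) with spectra in $J$; $OM_{1}$ is the set of operator monotone functions $f:(0,\infty)\to(0,\infty)$ with $f(1)=1$. "For all sufficiently small $\lambda\ge0$" means: there is $\lambda_0>0$ such that for all $\lambda\in[0,\lambda_0]$ the operators $\lambda T_i+I$ have spectra in $(0,\infty)$ and the inequality holds. Karcher mean: for $A,B\in B(\mathcal{H})_+$ and $t\in[0,1]$ let $A\sharp_tB=A^{1/2}(A^{-1/2}BA^{-1/2})^tA^{1/2}$. For $\mathbb{A}=(A_1,\dots,A_n)\in B(\mathcal{H})_+^n$,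 $\omega\in\Delta_n$ and $t\in(0,1]$, the power mean $P_t(\omega;\mathbb{A})$ is the unique positive definite solution $X$ of $X=\sum_{k=1}^nw_k\,X\sharp_tA_k$; for $t\in[-1,0)$, $P_t(\omega;\mathbb{A})=P_{-t}(\omega;A_1^{-1},\dots,A_n^{-1})^{-1}$. The Karcher mean $\Lambda(\omega;\mathbb{A})$ is the strong limit of $P_t(\omega;\mathbb{A})$ as $t\to0$ (known to exist). Logarithmic mean: $\mathfrak{L}(\Lambda)(\mathbb{A})=(n-1)!\int_{\Delta_n}\Lambda(\omega;\mathbb{A})\,d\omega$, where $d\omega$ is Lebesgue measure on $\Delta_n$ in the coordinates $(w_1,\dots,w_{n-1})$, so $(n-1)!\,d\omega$ is the uniform probability measure on $\Delta_n$; the integral is a $B(\mathcal{H})$-valued (Bochner) integral, which exists because $\Lambda(\omega;\mathbb{A})$ is continuous in $\omega$ in the Thompson metric $d(A,B)=\max\{\log M(A/B),\log M(B/A)\}$, $M(A/B)=\inf\{\alpha>0:B\le\alpha A\}$. *)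

theory Defs
  imports "HOL-Analysis.Analysis" "HOL-Computational_Algebra.Polynomial"
begin

text \<open>The inner product is conjugate-linear in its first argument. Positivity and
  definiteness are contained in the last axiom.\<close>

class complex_inner = real_normed_vector +
  fixes scaleC :: "complex \<Rightarrow> 'a \<Rightarrow> 'a"  (infixr \<open>*\<^sub>C\<close> 75)
    and cinner :: "'a \<Rightarrow> 'a \<Rightarrow> complex"
  assumes scaleC_add_right: "c *\<^sub>C (x + y) = c *\<^sub>C x + c *\<^sub>C y"
    and scaleC_add_left: "(c + d) *\<^sub>C x = c *\<^sub>C x + d *\<^sub>C x"
    and scaleC_scaleC: "c *\<^sub>C d *\<^sub>C x = (c * d) *\<^sub>C x"
    and scaleC_of_real: "complex_of_real r *\<^sub>C x = scaleR r x"
    and cinner_commute: "cinner x y = cnj (cinner y x)"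
    and cinner_add_right: "cinner x (y + z) = cinner x y + cinner x z"
    and cinner_scaleC_right: "cinner x (c *\<^sub>C y) = c * cinner x y"
    and cinner_self: "cinner x x = complex_of_real ((norm x)\<^sup>2)"

class chilbert_space = complex_inner + complete_space
begin
subclass banach ..
end

lemma norm_scaleC: "norm (c *\<^sub>C x) = cmod c * norm (x :: 'a::complex_inner)"
proof -
  have "complex_of_real ((norm (c *\<^sub>C x))\<^sup>2) = c * cnj (cinner x (c *\<^sub>C x))"
    by (metis cinner_commute cinner_scaleC_right cinner_self)
  also have "\<dots> = complex_of_real ((cmod c * norm x)\<^sup>2)"
    by (simp add: cinner_scaleC_right cinner_self complex_norm_square power_mult_distrib
        flip: mult.assoc del: of_real_power)
  finally have "(norm (c *\<^sub>C x))\<^sup>2 = (cmod c * norm x)\<^sup>2"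
    by (metis of_real_eq_iff)
  then show ?thesis by simp
qed

lemma bounded_linear_scaleC: "bounded_linear (\<lambda>x :: 'a::complex_inner. c *\<^sub>C x)"
proof (rule bounded_linear_intro[where K = "cmod c"])
  show "c *\<^sub>C (r *\<^sub>R x) = r *\<^sub>R (c *\<^sub>C x)" for r and x :: 'a
    by (simp add: scaleC_scaleC mult.commute flip: scaleC_of_real)
qed (simp_all add: scaleC_add_right norm_scaleC mult.commute)

typedef ell2 = "{x :: nat \<Rightarrow> complex. summable (\<lambda>i. (cmod (x i))\<^sup>2)}"
  by (rule exI[of _ "\<lambda>_. 0"]) simp

setup_lifting type_definition_ell2

lemma summable_sq_add:
  fixes x y :: "nat \<Rightarrow> complex"
  assumes "summable (\<lambda>i. (cmod (x i))\<^sup>2)" "summable (\<lambda>i. (cmod (y i))\<^sup>2)"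
  shows "summable (\<lambda>i. (cmod (x i + y i))\<^sup>2)"
proof (rule summable_comparison_test')
  show "summable (\<lambda>i. 2 * (cmod (x i))\<^sup>2 + 2 * (cmod (y i))\<^sup>2)"
    by (intro summable_add summable_mult assms)
  fix i
  have "(cmod (x i + y i))\<^sup>2 \<le> (cmod (x i) + cmod (y i))\<^sup>2"
    by (intro power_mono norm_triangle_ineq) auto
  also have "\<dots> \<le> 2 * (cmod (x i))\<^sup>2 + 2 * (cmod (y i))\<^sup>2"
    using sum_squares_ge_zero[of "cmod (x i) - cmod (y i)" 0]
    by (simp add: power2_eq_square algebra_simps)
  finally show "norm ((cmod (x i + y i))\<^sup>2) \<le> 2 * (cmod (x i))\<^sup>2 + 2 * (cmod (y i))\<^sup>2"
    by simp
qed

lemma summable_sq_scale: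
  fixes x :: "nat \<Rightarrow> complex"
  assumes "summable (\<lambda>i. (cmod (x i))\<^sup>2)"
  shows "summable (\<lambda>i. (cmod (c * x i))\<^sup>2)"
  using summable_mult[OF assms, of "(cmod c)\<^sup>2"] by (simp add: norm_mult power_mult_distrib)

lemma summable_cinner:
  fixes x y :: "nat \<Rightarrow> complex"
  assumes "summable (\<lambda>i. (cmod (x i))\<^sup>2)" "summable (\<lambda>i. (cmod (y i))\<^sup>2)"
  shows "summable (\<lambda>i. cnj (x i) * y i)"
proof (rule summable_comparison_test')
  show "summable (\<lambda>i. (cmod (x i))\<^sup>2 + (cmod (y i))\<^sup>2)"
    by (intro summable_add assms)
  fix i
  have "2 * (cmod (x i) * cmod (y i)) \<le> (cmod (x i))\<^sup>2 + (cmod (y i))\<^sup>2"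
    using sum_squares_bound[of "cmod (x i)" "cmod (y i)"] by simp
  moreover have "0 \<le> cmod (x i) * cmod (y i)"
    by simp
  ultimately show "norm (cnj (x i) * y i) \<le> (cmod (x i))\<^sup>2 + (cmod (y i))\<^sup>2"
    unfolding norm_mult complex_mod_cnj by linarith
qed

lemma L2_set_le_sqrt_suminf:
  fixes x :: "nat \<Rightarrow> complex"
  assumes "summable (\<lambda>i. (cmod (x i))\<^sup>2)"
  shows "L2_set (\<lambda>i. cmod (x i)) {..<m} \<le> sqrt (\<Sum>i. (cmod (x i))\<^sup>2)"
  unfolding L2_set_def using sum_le_suminf[OF assms] by simp

lemma sqrt_suminf_le:
  fixes x :: "nat \<Rightarrow> complex"
  assumes "\<And>m. L2_set (\<lambda>i. cmod (x i)) {..<m} \<le> b"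
  shows "summable (\<lambda>i. (cmod (x i))\<^sup>2)" and "sqrt (\<Sum>i. (cmod (x i))\<^sup>2) \<le> b"
proof -
  have b: "0 \<le> b"
    using order_trans[OF L2_set_nonneg assms] .
  have le: "(\<Sum>i<m. (cmod (x i))\<^sup>2) \<le> b\<^sup>2" for m
    using assms[of m] b unfolding L2_set_def
    by (metis real_le_lsqrt real_sqrt_le_iff real_sqrt_unique sqrt_le_D)
  show s: "summable (\<lambda>i. (cmod (x i))\<^sup>2)"
    by (rule summableI_nonneg_bounded[of _ "b\<^sup>2"]) (auto intro: le)
  show "sqrt (\<Sum>i. (cmod (x i))\<^sup>2) \<le> b"
    using suminf_le_const[OF s le] b by (simp add: real_le_lsqrt)
qed

instantiation ell2 :: real_normed_vector
begin

lift_definition zero_ell2 :: ell2 is "\<lambda>_. 0" by simp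
lift_definition plus_ell2 :: "ell2 \<Rightarrow> ell2 \<Rightarrow> ell2" is "\<lambda>x y i. x i + y i"
  by (rule summable_sq_add)
lift_definition uminus_ell2 :: "ell2 \<Rightarrow> ell2" is "\<lambda>x i. - x i" by simp
lift_definition minus_ell2 :: "ell2 \<Rightarrow> ell2 \<Rightarrow> ell2" is "\<lambda>x y i. x i - y i"
  subgoal for x y using summable_sq_add[of x "\<lambda>i. - y i"] by simp
  done
lift_definition scaleR_ell2 :: "real \<Rightarrow> ell2 \<Rightarrow> ell2" is "\<lambda>r x i. complex_of_real r * x i"
  by (rule summable_sq_scale)
lift_definition norm_ell2 :: "ell2 \<Rightarrow> real" is "\<lambda>x. sqrt (\<Sum>i. (cmod (x i))\<^sup>2)" .
definition dist_ell2 :: "ell2 \<Rightarrow> ell2 \<Rightarrow> real" where "dist_ell2 x y = norm (x - y)"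
definition sgn_ell2 :: "ell2 \<Rightarrow> ell2" where "sgn_ell2 x = inverse (norm x) *\<^sub>R x"
definition uniformity_ell2 :: "(ell2 \<times> ell2) filter"
  where "uniformity_ell2 = (INF e\<in>{0 <..}. principal {(x, y). dist x y < e})"
definition open_ell2 :: "ell2 set \<Rightarrow> bool"
  where "open_ell2 S = (\<forall>x\<in>S. \<forall>\<^sub>F (x', y) in uniformity. x' = x \<longrightarrow> y \<in> S)"

instance
proof
  fix x y z :: ell2 and r s :: real
  show "x + y + z = x + (y + z)" by transfer (simp add: add.assoc)
  show "x + y = y + x" by transfer (simp add: add.commute)
  show "0 + x = x" by transfer simp
  show "- x + x = 0" by transfer simp
  show "x - y = x + - y" by transfer simp
  show "r *\<^sub>R (x + y) = r *\<^sub>R x + r *\<^sub>R y" by transfer (simp add: algebra_simps)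
  show "(r + s) *\<^sub>R x = r *\<^sub>R x + s *\<^sub>R x" by transfer (simp add: algebra_simps)
  show "r *\<^sub>R s *\<^sub>R x = (r * s) *\<^sub>R x" by transfer (simp add: algebra_simps)
  show "1 *\<^sub>R x = x" by transfer simp
  show "sgn x = inverse (norm x) *\<^sub>R x" by (simp add: sgn_ell2_def)
  show "dist x y = norm (x - y)" by (simp add: dist_ell2_def)
  show "norm x = 0 \<longleftrightarrow> x = 0"
  proof transfer
    fix x :: "nat \<Rightarrow> complex"
    assume "summable (\<lambda>i. (cmod (x i))\<^sup>2)"
    then have "(\<Sum>i. (cmod (x i))\<^sup>2) = 0 \<longleftrightarrow> (\<forall>i. (cmod (x i))\<^sup>2 = 0)"
      by (rule suminf_eq_zero_iff) simp
    then show "sqrt (\<Sum>i. (cmod (x i))\<^sup>2) = 0 \<longleftrightarrow> x = (\<lambda>_. 0)"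
      by (auto simp: fun_eq_iff)
  qed
  show "norm (x + y) \<le> norm x + norm y"
  proof transfer
    fix x y :: "nat \<Rightarrow> complex"
    assume x: "summable (\<lambda>i. (cmod (x i))\<^sup>2)" and y: "summable (\<lambda>i. (cmod (y i))\<^sup>2)"
    show "sqrt (\<Sum>i. (cmod (x i + y i))\<^sup>2)
        \<le> sqrt (\<Sum>i. (cmod (x i))\<^sup>2) + sqrt (\<Sum>i. (cmod (y i))\<^sup>2)"
    proof (rule sqrt_suminf_le(2))
      fix m
      have "L2_set (\<lambda>i. cmod (x i + y i)) {..<m} \<le> L2_set (\<lambda>i. cmod (x i) + cmod (y i)) {..<m}"
        by (intro L2_set_mono norm_triangle_ineq) auto
      also have "\<dots> \<le> L2_set (\<lambda>i. cmod (x i)) {..<m} + L2_set (\<lambda>i. cmod (y i)) {..<m}"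
        by (rule L2_set_triangle_ineq)
      also have "\<dots> \<le> sqrt (\<Sum>i. (cmod (x i))\<^sup>2) + sqrt (\<Sum>i. (cmod (y i))\<^sup>2)"
        by (intro add_mono L2_set_le_sqrt_suminf x y)
      finally show "L2_set (\<lambda>i. cmod (x i + y i)) {..<m} \<le> \<dots>" .
    qed
  qed
  show "norm (r *\<^sub>R x) = \<bar>r\<bar> * norm x"
    by transfer (simp add: norm_mult power_mult_distrib suminf_mult real_sqrt_mult)
qed (simp_all add: uniformity_ell2_def open_ell2_def)

end

instantiation ell2 :: complex_inner
begin

lift_definition scaleC_ell2 :: "complex \<Rightarrow> ell2 \<Rightarrow> ell2" is "\<lambda>c x i. c * x i"
  by (rule summable_sq_scale)
lift_definition cinner_ell2 :: "ell2 \<Rightarrow> ell2 \<Rightarrow> complex" is "\<lambda>x y. \<Sum>i. cnj (x i) * y i" .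

instance
proof
  fix x y z :: ell2 and c d :: complex and r :: real
  show "c *\<^sub>C (x + y) = c *\<^sub>C x + c *\<^sub>C y" by transfer (simp add: algebra_simps)
  show "(c + d) *\<^sub>C x = c *\<^sub>C x + d *\<^sub>C x" by transfer (simp add: algebra_simps)
  show "c *\<^sub>C d *\<^sub>C x = (c * d) *\<^sub>C x" by transfer (simp add: algebra_simps)
  show "complex_of_real r *\<^sub>C x = r *\<^sub>R x" by transfer simp
  show "cinner x y = cnj (cinner y x)"
  proof transfer
    fix x y :: "nat \<Rightarrow> complex"
    assume "summable (\<lambda>i. (cmod (x i))\<^sup>2)" "summable (\<lambda>i. (cmod (y i))\<^sup>2)"
    then have "(\<lambda>i. cnj (y i) * x i) sums (\<Sum>i. cnj (y i) * x i)"
      by (intro summable_sums summable_cinner)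
    then have "(\<lambda>i. cnj (cnj (y i) * x i)) sums cnj (\<Sum>i. cnj (y i) * x i)"
      by (simp only: sums_cnj)
    then show "(\<Sum>i. cnj (x i) * y i) = cnj (\<Sum>i. cnj (y i) * x i)"
      by (simp add: sums_iff mult.commute)
  qed
  show "cinner x (y + z) = cinner x y + cinner x z"
    by transfer (simp add: distrib_left summable_cinner flip: suminf_add)
  show "cinner x (c *\<^sub>C y) = c * cinner x y"
    by transfer (simp add: mult.left_commute suminf_mult summable_cinner)
  show "cinner x x = complex_of_real ((norm x)\<^sup>2)"
  proof transfer
    fix x :: "nat \<Rightarrow> complex"
    assume x: "summable (\<lambda>i. (cmod (x i))\<^sup>2)"
    have "(\<lambda>i. complex_of_real ((cmod (x i))\<^sup>2)) sums complex_of_real (\<Sum>i. (cmod (x i))\<^sup>2)"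
      using x by (intro sums_of_real summable_sums)
    then have "(\<Sum>i. cnj (x i) * x i) = complex_of_real (\<Sum>i. (cmod (x i))\<^sup>2)"
      by (simp only: sums_iff complex_norm_square mult.commute)
    then show "(\<Sum>i. cnj (x i) * x i) = complex_of_real ((sqrt (\<Sum>i. (cmod (x i))\<^sup>2))\<^sup>2)"
      using suminf_nonneg[OF x] by simp
  qed
qed

end

lemma L2_set_le_norm_ell2: "L2_set (\<lambda>i. cmod (Rep_ell2 x i)) {..<m} \<le> norm x"
  by transfer (rule L2_set_le_sqrt_suminf)

lemma cmod_le_norm_ell2: "cmod (Rep_ell2 x i) \<le> norm x"
  using member_le_L2_set[of "{..<Suc i}" i "\<lambda>i. cmod (Rep_ell2 x i)"]
    L2_set_le_norm_ell2[of x "Suc i"] by simp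

instance ell2 :: chilbert_space
proof
  fix X :: "nat \<Rightarrow> ell2"
  assume X: "Cauchy X"
  define x where "x i = lim (\<lambda>k. Rep_ell2 (X k) i)" for i
  have "Cauchy (\<lambda>k. Rep_ell2 (X k) i)" for i
  proof (rule metric_CauchyI)
    fix e :: real
    assume "0 < e"
    then obtain N where N: "\<And>k l. k \<ge> N \<Longrightarrow> l \<ge> N \<Longrightarrow> norm (X k - X l) < e"
      using X by (metis CauchyD)
    show "\<exists>N. \<forall>k\<ge>N. \<forall>l\<ge>N. dist (Rep_ell2 (X k) i) (Rep_ell2 (X l) i) < e"
      using le_less_trans[OF cmod_le_norm_ell2 N]
      by (auto simp: dist_norm minus_ell2.rep_eq intro!: exI[of _ N])
  qed
  then have x: "(\<lambda>k. Rep_ell2 (X k) i) \<longlonglongrightarrow> x i" for i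
    unfolding x_def by (simp add: Cauchy_convergent_iff convergent_LIMSEQ_iff)
  have tail: "\<exists>N. \<forall>k\<ge>N. \<forall>m. L2_set (\<lambda>i. cmod (Rep_ell2 (X k) i - x i)) {..<m} \<le> e"
    if "0 < e" for e
  proof -
    obtain N where N: "\<And>k l. k \<ge> N \<Longrightarrow> l \<ge> N \<Longrightarrow> norm (X k - X l) < e"
      using X \<open>0 < e\<close> by (metis CauchyD)
    have "L2_set (\<lambda>i. cmod (Rep_ell2 (X k) i - x i)) {..<m} \<le> e" if "k \<ge> N" for k m
    proof (rule tendsto_upperbound)
      show "(\<lambda>l. L2_set (\<lambda>i. cmod (Rep_ell2 (X k) i - Rep_ell2 (X l) i)) {..<m})
          \<longlonglongrightarrow> L2_set (\<lambda>i. cmod (Rep_ell2 (X k) i - x i)) {..<m}"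
        unfolding L2_set_def by (intro tendsto_intros x)
      show "\<forall>\<^sub>F l in sequentially.
          L2_set (\<lambda>i. cmod (Rep_ell2 (X k) i - Rep_ell2 (X l) i)) {..<m} \<le> e"
        unfolding eventually_sequentially
      proof (intro exI allI impI)
        fix l assume "N \<le> l"
        then show "L2_set (\<lambda>i. cmod (Rep_ell2 (X k) i - Rep_ell2 (X l) i)) {..<m} \<le> e"
          using L2_set_le_norm_ell2[of "X k - X l" m] N[OF \<open>k \<ge> N\<close>, of l]
          by (simp add: minus_ell2.rep_eq)
      qed
    qed simp
    then show ?thesis by blast
  qed
  obtain k where k: "\<And>m. L2_set (\<lambda>i. cmod (Rep_ell2 (X k) i - x i)) {..<m} \<le> 1"
    using tail[of 1] by auto
  have "summable (\<lambda>i. (cmod (Rep_ell2 (X k) i + - (Rep_ell2 (X k) i - x i)))\<^sup>2)"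
  proof (rule summable_sq_add)
    show "summable (\<lambda>i. (cmod (Rep_ell2 (X k) i))\<^sup>2)"
      using Rep_ell2[of "X k"] by simp
    show "summable (\<lambda>i. (cmod (- (Rep_ell2 (X k) i - x i)))\<^sup>2)"
      unfolding norm_minus_cancel by (rule sqrt_suminf_le(1)[OF k])
  qed
  then have Rep: "Rep_ell2 (Abs_ell2 x) = x"
    by (intro Abs_ell2_inverse) simp
  have "X \<longlonglongrightarrow> Abs_ell2 x"
  proof (rule LIMSEQ_I)
    fix e :: real
    assume "0 < e"
    then obtain N where
      N: "\<And>k m. k \<ge> N \<Longrightarrow> L2_set (\<lambda>i. cmod (Rep_ell2 (X k) i - x i)) {..<m} \<le> e / 2"
      using tail[of "e / 2"] by auto
    have "norm (X k - Abs_ell2 x) \<le> e / 2" if "k \<ge> N" for k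
      using sqrt_suminf_le(2)[OF N[OF that]] by (simp add: norm_ell2.rep_eq minus_ell2.rep_eq Rep)
    then show "\<exists>N. \<forall>k\<ge>N. norm (X k - Abs_ell2 x) < e"
      using \<open>0 < e\<close> by (intro exI[of _ N]) (force intro: le_less_trans[of _ "e / 2"])
  qed
  then show "convergent X"
    by (rule convergentI)
qed

text \<open>The library type of bounded linear maps only knows real linearity, so the algebra
  of bounded complex-linear operators is a subset of it; it inherits the operator norm.\<close>

definition bounded_ops :: "('a::complex_inner \<Rightarrow>\<^sub>L 'a) set" where
  "bounded_ops = {A :: 'a \<Rightarrow>\<^sub>L 'a. \<forall>c x. A (c *\<^sub>C x) = c *\<^sub>C A x}"

lift_definition scalar_op :: "complex \<Rightarrow> 'a::complex_inner \<Rightarrow>\<^sub>L 'a" is "\<lambda>z x. z *\<^sub>C x"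
  by (rule bounded_linear_scaleC)

definition is_inverse :: "('a::complex_inner \<Rightarrow>\<^sub>L 'a) \<Rightarrow> ('a \<Rightarrow>\<^sub>L 'a) \<Rightarrow> bool" where
  "is_inverse A B \<longleftrightarrow> B \<in> bounded_ops \<and> A o\<^sub>L B = id_blinfun \<and> B o\<^sub>L A = id_blinfun"

definition inv_op :: "('a::complex_inner \<Rightarrow>\<^sub>L 'a) \<Rightarrow> 'a \<Rightarrow>\<^sub>L 'a" where
  "inv_op A = (THE B. is_inverse A B)"

definition spectrum :: "('a::complex_inner \<Rightarrow>\<^sub>L 'a) \<Rightarrow> complex set" where
  "spectrum A = {z. \<nexists>B. is_inverse (A - scalar_op z) B}"

definition self_adjoint_ops :: "('a::complex_inner \<Rightarrow>\<^sub>L 'a) set" where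
  "self_adjoint_ops = {A \<in> bounded_ops. \<forall>x y. cinner (A x) y = cinner x (A y)}"

definition pos_semidef :: "('a::complex_inner \<Rightarrow>\<^sub>L 'a) \<Rightarrow> bool" where
  "pos_semidef A \<longleftrightarrow> A \<in> self_adjoint_ops \<and> (\<forall>x. 0 \<le> Re (cinner x (A x)))"

definition pos_def_ops :: "('a::complex_inner \<Rightarrow>\<^sub>L 'a) set" where
  "pos_def_ops = {A. pos_semidef A \<and> (\<exists>B. is_inverse A B)}"

definition op_le :: "('a::complex_inner \<Rightarrow>\<^sub>L 'a) \<Rightarrow> ('a \<Rightarrow>\<^sub>L 'a) \<Rightarrow> bool"  (infix \<open>\<preceq>\<close> 50) where
  "A \<preceq> B \<longleftrightarrow> pos_semidef (B - A)"

definition poly_op :: "real poly \<Rightarrow> ('a::complex_inner \<Rightarrow>\<^sub>L 'a) \<Rightarrow> 'a \<Rightarrow>\<^sub>L 'a" where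
  "poly_op p A = (\<Sum>i\<le>degree p. coeff p i *\<^sub>R ((\<lambda>B. A o\<^sub>L B) ^^ i) id_blinfun)"

text \<open>For self-adjoint \<open>A\<close> and \<open>f\<close> continuous on the spectrum of \<open>A\<close>, the operator \<open>f(A)\<close>
  is the norm limit of \<open>p\<^sub>k(A)\<close> for any real polynomials \<open>p\<^sub>k\<close> converging to \<open>f\<close> uniformly on the
  spectrum; since the norm of \<open>p(A)\<close> is the supremum of \<open>\<bar>p\<bar>\<close> over the spectrum, it does not
  depend on the choice of the \<open>p\<^sub>k\<close>.\<close>

definition fun_op :: "(real \<Rightarrow> real) \<Rightarrow> ('a::complex_inner \<Rightarrow>\<^sub>L 'a) \<Rightarrow> 'a \<Rightarrow>\<^sub>L 'a" where
  "fun_op f A = (THE B. \<exists>p. uniform_limit {s. complex_of_real s \<in> spectrum A}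
      (\<lambda>k. poly (p k)) f sequentially \<and> (\<lambda>k. poly_op (p k) A) \<longlonglongrightarrow> B)"

definition operator_monotone_on :: "'a::chilbert_space itself \<Rightarrow> real set \<Rightarrow> (real \<Rightarrow> real) \<Rightarrow> bool"
  where "operator_monotone_on _ J f \<longleftrightarrow>
    (\<forall>A \<in> self_adjoint_ops. \<forall>B \<in> (self_adjoint_ops :: ('a \<Rightarrow>\<^sub>L 'a) set).
       spectrum A \<subseteq> complex_of_real ` J \<longrightarrow> spectrum B \<subseteq> complex_of_real ` J \<longrightarrow>
       A \<preceq> B \<longrightarrow> fun_op f A \<preceq> fun_op f B)"

text \<open>A formula of HOL cannot quantify over all Hilbert spaces, hence the infinite-dimensional
  separable one is used. This loses nothing: given \<open>A\<close>, \<open>B\<close> and a vector \<open>x\<close> in any Hilbert space,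
  the inequality at \<open>x\<close> only involves the separable subspace generated by \<open>x\<close> under \<open>A\<close> and \<open>B\<close>,
  which reduces both and embeds isometrically into \<^typ>\<open>ell2\<close> (complete both operators by the same
  scalar of \<open>J\<close> on the complement of the image).

  Continuity is not imposed. For \<open>f\<close> discontinuous on the spectrum, \<^const>\<open>fun_op\<close> is
  unspecified, but operators with finite spectrum are never affected by this, and the condition
  for those already forces \<open>f\<close> to be continuous if \<open>J\<close> is an open interval.\<close>

definition operator_monotone :: "real set \<Rightarrow> (real \<Rightarrow> real) \<Rightarrow> bool" where
  "operator_monotone J f \<longleftrightarrow> operator_monotone_on TYPE(ell2) J f"

text \<open>Functions on \<open>(0,\<infinity>)\<close> are total functions whose values outside \<open>(0,\<infinity>)\<close> are irrelevant.\<close>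

definition OM1 :: "(real \<Rightarrow> real) set" where
  "OM1 = {f. (\<forall>s>0. 0 < f s) \<and> operator_monotone {0<..} f \<and> f 1 = 1}"

definition geo_mean :: "real \<Rightarrow> ('a::complex_inner \<Rightarrow>\<^sub>L 'a) \<Rightarrow> ('a \<Rightarrow>\<^sub>L 'a) \<Rightarrow> 'a \<Rightarrow>\<^sub>L 'a" where
  "geo_mean t A B =
    (let R = fun_op (\<lambda>s. s powr (1/2)) A; S = fun_op (\<lambda>s. s powr (-1/2)) A
     in R o\<^sub>L fun_op (\<lambda>s. s powr t) (S o\<^sub>L B o\<^sub>L S) o\<^sub>L R)"

text \<open>Tuples are functions on \<open>nat\<close> of which only the values at \<open>1,\<dots>,n\<close> matter.\<close>

definition power_mean_pos ::
  "nat \<Rightarrow> real \<Rightarrow> (nat \<Rightarrow> real) \<Rightarrow> (nat \<Rightarrow> 'a::complex_inner \<Rightarrow>\<^sub>L 'a) \<Rightarrow> 'a \<Rightarrow>\<^sub>L 'a" where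
  "power_mean_pos n t w A =
    (THE X. X \<in> pos_def_ops \<and> X = (\<Sum>k=1..n. w k *\<^sub>R geo_mean t X (A k)))"

definition power_mean ::
  "nat \<Rightarrow> real \<Rightarrow> (nat \<Rightarrow> real) \<Rightarrow> (nat \<Rightarrow> 'a::complex_inner \<Rightarrow>\<^sub>L 'a) \<Rightarrow> 'a \<Rightarrow>\<^sub>L 'a" where
  "power_mean n t w A =
    (if 0 < t then power_mean_pos n t w A
     else inv_op (power_mean_pos n (- t) w (\<lambda>k. inv_op (A k))))"

definition karcher_mean ::
  "nat \<Rightarrow> (nat \<Rightarrow> real) \<Rightarrow> (nat \<Rightarrow> 'a::complex_inner \<Rightarrow>\<^sub>L 'a) \<Rightarrow> 'a \<Rightarrow>\<^sub>L 'a" where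
  "karcher_mean n w A =
    (THE L :: 'a \<Rightarrow>\<^sub>L 'a. \<forall>x. ((\<lambda>t. power_mean n t w A x) \<longlongrightarrow> L x) (at 0 within {-1..1}))"

text \<open>The library's \<^const>\<open>has_bochner_integral\<close> is restricted to second countable spaces, which
  operator algebras are not. The definition below is the same, except that strong measurability
  (pointwise approximation by simple functions almost everywhere) replaces Borel measurability,
  to which it is equivalent in the second countable case up to null sets.\<close>

definition has_Bochner_integral ::
  "'a measure \<Rightarrow> ('a \<Rightarrow> 'b::real_normed_vector) \<Rightarrow> 'b \<Rightarrow> bool" where
  "has_Bochner_integral M f y \<longleftrightarrow>
    (\<exists>s. (\<forall>i. Bochner_Integration.simple_bochner_integrable M (s i)) \<and>
         (AE x in M. (\<lambda>i. s i x) \<longlonglongrightarrow> f x) \<and>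
         (\<lambda>i. \<integral>\<^sup>+x. ennreal (norm (f x - s i x)) \<partial>M) \<longlonglongrightarrow> 0 \<and>
         (\<lambda>i. Bochner_Integration.simple_bochner_integral M (s i)) \<longlonglongrightarrow> y)"

definition Bochner_integral :: "'a measure \<Rightarrow> ('a \<Rightarrow> 'b::real_normed_vector) \<Rightarrow> 'b" where
  "Bochner_integral M f = (THE y. has_Bochner_integral M f y)"

definition weight_simplex :: "nat \<Rightarrow> (nat \<Rightarrow> real) set" where
  "weight_simplex n = {w. (\<forall>k\<in>{1..n}. 0 < w k \<and> w k < 1) \<and> (\<Sum>k=1..n. w k) = 1}"

text \<open>The point of the simplex with first coordinates \<open>v\<^sub>1,\<dots>,v\<^sub>n\<^sub>-\<^sub>1\<close>, and the measure
  \<open>d\<omega>\<close> in these coordinates.\<close>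

definition complete_weights :: "nat \<Rightarrow> (nat \<Rightarrow> real) \<Rightarrow> nat \<Rightarrow> real" where
  "complete_weights n v = v(n := 1 - (\<Sum>k\<in>{1..<n}. v k))"

definition simplex_measure :: "nat \<Rightarrow> (nat \<Rightarrow> real) measure" where
  "simplex_measure n = restrict_space (\<Pi>\<^sub>M k\<in>{1..<n}. lborel)
     {v. complete_weights n v \<in> weight_simplex n}"

definition log_mean :: "nat \<Rightarrow> (nat \<Rightarrow> 'a::complex_inner \<Rightarrow>\<^sub>L 'a) \<Rightarrow> 'a \<Rightarrow>\<^sub>L 'a" where
  "log_mean n A = (fact (n - 1) :: real) *\<^sub>R
     Bochner_integral (simplex_measure n) (\<lambda>v. karcher_mean n (complete_weights n v) A)"

end

(*
Since f is concave with derivative d > 0 at 1, f(I + lT_k) lies below I + l d T_k, and its inverse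
below I - l d T_k + o(l). The Karcher mean lies between 2I - sum w_k A_k^(-1) and sum w_k A_k. On
integrating over the simplex, where every weight has mean 1/n, both bounds of the logarithmic mean
become I + l d (T_1 + ... + T_n)/n up to o(l), the upper one with no error term.

The Karcher mean is obtained as a norm limit from Thompson contractivity alone. A power mean X
satisfies sum w_k B_k^s = I for B_k = X^(-1/2) A_k X^(-1/2). As (b^t - 1)/t and (b^s - 1)/s differ by
O(|s| + |t|), a scalar multiple of X by a factor exp(O(|s| + |t|)) is a super- or subsolution of the
equation with exponent t > 0, so all power means are within that distance of each other.

The properties of f come from two-by-two matrices, realized in the first two coordinates of ell2.
*)
theory Submission
  imports Defs "HOL-Computational_Algebra.Fundamental_Theorem_Algebra"
begin

section \<open>Operators and quadratic forms\<close>

text \<open>Most objects of the statement (\<open>fun_op\<close>, \<open>inv_op\<close>,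
  \<open>power_mean_pos\<close>, \<open>karcher_mean\<close>, \<open>Bochner_integral\<close>) are
  definite descriptions, so nothing can be said about them before existence and uniqueness are
  shown; this accounts for much of the length. Existence comes from completeness in operator norm.

  The order compares quadratic forms only. Both implications are therefore argued at a fixed vector,
  where the operator integral becomes a real one and bounds affine in the weights integrate by the
  mean weight alone.

  The delicate point about f is differentiability at 1. The spectra of l T_k + I may lie on both
  sides of 1, so the bounds for f and for 1/f match to first order only if the one-sided derivatives
  at 1 agree. Concavity alone permits a kink there, and it permits f to be constant from 1 on, where
  d would vanish. One explicit pair of two-by-two matrices excludes both, in place of Loewner's
  integral representation.\<close>

type_synonym 'a op = "'a \<Rightarrow>\<^sub>L 'a"

text \<open>Library operators are only real linear, so order and symmetry are handled with the real
  part of the inner product. Nothing is lost: \<open>cinner\<close> is recovered by rotating one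
  argument by the imaginary unit, see \<open>cinner_eq_rinner\<close>.\<close>

definition rinner :: "'a::complex_inner \<Rightarrow> 'a \<Rightarrow> real" where
  "rinner x y = Re (cinner x y)"

lemma cinner_add_left: "cinner (x + y) z = cinner x z + cinner (y :: 'a::complex_inner) z"
  by (metis cinner_add_right cinner_commute complex_cnj_add)

lemma cinner_scaleC_left: "cinner (c *\<^sub>C x) y = cnj c * cinner (x :: 'a::complex_inner) y"
  by (metis cinner_scaleC_right cinner_commute complex_cnj_mult)

lemma rinner_commute: "rinner x y = rinner y x"
  unfolding rinner_def by (subst cinner_commute) simp

lemma rinner_self: "rinner x x = (norm x)\<^sup>2"
  by (simp add: rinner_def cinner_self)

lemma rinner_add_right: "rinner x (y + z) = rinner x y + rinner x z"
  by (simp add: rinner_def cinner_add_right)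

lemma rinner_add_left: "rinner (x + y) z = rinner x z + rinner y z"
  by (simp add: rinner_def cinner_add_left)

lemma rinner_scaleR_right: "rinner x (r *\<^sub>R y) = r * rinner x y"
  unfolding rinner_def scaleC_of_real[symmetric] cinner_scaleC_right by simp

lemma rinner_scaleR_left: "rinner (r *\<^sub>R x) y = r * rinner x y"
  by (metis rinner_commute rinner_scaleR_right)

lemma rinner_Cauchy_Schwarz: "\<bar>rinner x y\<bar> \<le> norm x * norm y"
proof -
  have q: "(norm (a *\<^sub>R x + b *\<^sub>R y))\<^sup>2 = a\<^sup>2 * (norm x)\<^sup>2 + 2 * a * b * rinner x y + b\<^sup>2 * (norm y)\<^sup>2" for a b
    unfolding rinner_self[symmetric]
    by (simp add: rinner_add_left rinner_add_right rinner_scaleR_left rinner_scaleR_right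
        rinner_commute[of y x] algebra_simps power2_eq_square)
  \<comment> \<open>Half the squared norm of \<open>norm y * x + s * norm x * y\<close>. Division by
    \<open>norm x * norm y\<close> for both signs s gives both sides of the absolute value
    bound.\<close>
  have *: "0 \<le> norm x * norm y * (norm x * norm y + s * rinner x y)" if "s = 1 \<or> s = -1" for s
    using zero_le_power2[of "norm (norm y *\<^sub>R x + (s * norm x) *\<^sub>R y)"] that
    unfolding q by (auto simp: algebra_simps power2_eq_square)
  show ?thesis
  proof (cases "x = 0 \<or> y = 0")
    case True
    then show ?thesis
      using rinner_scaleR_left[of 0 x y] rinner_scaleR_right[of x 0 y] by auto
  next
    case False
    then have "0 < norm x * norm y" by simp
    then show ?thesis
      using *[of 1] *[of "-1"] by (simp add: zero_le_mult_iff abs_le_iff)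
  qed
qed

lemma bounded_bilinear_rinner: "bounded_bilinear (rinner :: 'a::complex_inner \<Rightarrow> 'a \<Rightarrow> real)"
proof
  show "\<exists>K. \<forall>a b :: 'a. norm (rinner a b) \<le> norm a * norm b * K"
    using rinner_Cauchy_Schwarz by (intro exI[of _ 1]) auto
qed (simp_all add: rinner_add_left rinner_add_right rinner_scaleR_left rinner_scaleR_right)

interpretation rinner: bounded_bilinear "rinner :: 'a::complex_inner \<Rightarrow> 'a \<Rightarrow> real"
  by (rule bounded_bilinear_rinner)

lemma rinner_eq_zero: "(\<And>y. rinner y x = 0) \<Longrightarrow> x = 0"
  by (metis rinner_self norm_eq_zero power_eq_0_iff)

lemma cinner_eq_rinner: "cinner x y = Complex (rinner x y) (rinner (\<i> *\<^sub>C x) y)"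
  by (simp add: complex_eq_iff rinner_def cinner_scaleC_left)

lemma scaleC_zero_right [simp]: "c *\<^sub>C (0 :: 'a::complex_inner) = 0"
  using norm_scaleC[of c "0::'a"] by simp

lemma scaleC_zero_left [simp]: "0 *\<^sub>C (x :: 'a::complex_inner) = 0"
  using norm_scaleC[of 0 x] by simp

lemma scaleC_minus_right: "c *\<^sub>C (- x) = - (c *\<^sub>C (x :: 'a::complex_inner))"
  by (metis add.inverse_unique add.right_inverse scaleC_add_right scaleC_zero_right)

lemma scaleC_diff_right: "c *\<^sub>C (x - y) = c *\<^sub>C x - c *\<^sub>C (y :: 'a::complex_inner)"
  unfolding diff_conv_add_uminus scaleC_add_right scaleC_minus_right ..

lemma scaleC_scaleR: "c *\<^sub>C (r *\<^sub>R x) = r *\<^sub>R (c *\<^sub>C (x :: 'a::complex_inner))"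
  by (metis scaleC_of_real scaleC_scaleC mult.commute)

subsection \<open>The algebra of bounded operators\<close>

lemma bounded_ops_zero [simp]: "0 \<in> bounded_ops"
  and bounded_ops_id [simp]: "id_blinfun \<in> bounded_ops"
  and bounded_ops_add: "A \<in> bounded_ops \<Longrightarrow> B \<in> bounded_ops \<Longrightarrow> A + B \<in> bounded_ops"
  and bounded_ops_diff: "A \<in> bounded_ops \<Longrightarrow> B \<in> bounded_ops \<Longrightarrow> A - B \<in> bounded_ops"
  and bounded_ops_scaleR: "A \<in> bounded_ops \<Longrightarrow> r *\<^sub>R A \<in> bounded_ops"
  and bounded_ops_compose: "A \<in> bounded_ops \<Longrightarrow> B \<in> bounded_ops \<Longrightarrow> A o\<^sub>L B \<in> bounded_ops"
  and bounded_ops_scalar_op: "scalar_op z \<in> bounded_ops"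
  by (auto simp: bounded_ops_def blinfun.bilinear_simps scaleC_add_right scaleC_diff_right scaleC_scaleR
      scalar_op.rep_eq scaleC_scaleC mult.commute)

lemma bounded_ops_sum: "(\<And>i. i \<in> I \<Longrightarrow> A i \<in> bounded_ops) \<Longrightarrow> sum A I \<in> bounded_ops"
  by (induction I rule: infinite_finite_induct) (auto intro: bounded_ops_add)

lemma tendsto_blinfun_apply:
  "(A \<longlongrightarrow> L) F \<Longrightarrow> ((\<lambda>k. blinfun_apply (A k) x) \<longlongrightarrow> L x) F"
  by (intro tendsto_intros)

lemma bounded_ops_LIMSEQ:
  assumes "A \<longlonglongrightarrow> L" "\<And>k. A k \<in> bounded_ops"
  shows "L \<in> bounded_ops"
proof -
  have "L (c *\<^sub>C x) = c *\<^sub>C L x" for c x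
  proof (rule LIMSEQ_unique)
    show "(\<lambda>k. A k (c *\<^sub>C x)) \<longlonglongrightarrow> L (c *\<^sub>C x)"
      by (rule tendsto_blinfun_apply[OF assms(1)])
    have "(\<lambda>k. c *\<^sub>C A k x) \<longlonglongrightarrow> c *\<^sub>C L x"
      by (intro bounded_linear.tendsto[OF bounded_linear_scaleC] tendsto_blinfun_apply assms(1))
    then show "(\<lambda>k. A k (c *\<^sub>C x)) \<longlonglongrightarrow> c *\<^sub>C L x"
      using assms(2) by (simp add: bounded_ops_def)
  qed
  then show ?thesis by (simp add: bounded_ops_def)
qed

lemma compose_assoc: "(A o\<^sub>L B) o\<^sub>L C = A o\<^sub>L (B o\<^sub>L C)"
  and compose_id_left [simp]: "id_blinfun o\<^sub>L A = A"
  and compose_id_right [simp]: "A o\<^sub>L id_blinfun = A"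
  by (rule blinfun_eqI; simp)+

lemmas compose_simps =
  bounded_bilinear.add_left[OF bounded_bilinear_blinfun_compose]
  bounded_bilinear.add_right[OF bounded_bilinear_blinfun_compose]
  bounded_bilinear.diff_left[OF bounded_bilinear_blinfun_compose]
  bounded_bilinear.diff_right[OF bounded_bilinear_blinfun_compose]
  bounded_bilinear.scaleR_left[OF bounded_bilinear_blinfun_compose]
  bounded_bilinear.scaleR_right[OF bounded_bilinear_blinfun_compose]

lemma is_inverse_unique: "is_inverse A B \<Longrightarrow> is_inverse A C \<Longrightarrow> B = C"
  unfolding is_inverse_def by (metis compose_assoc compose_id_left compose_id_right)

lemma inv_op_eq: "is_inverse A B \<Longrightarrow> inv_op A = B"
  unfolding inv_op_def using is_inverse_unique by blast

lemma is_inverse_compose: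
  "is_inverse A B \<Longrightarrow> is_inverse C D \<Longrightarrow> is_inverse (A o\<^sub>L C) (D o\<^sub>L B)"
  unfolding is_inverse_def by (metis bounded_ops_compose compose_assoc compose_id_left)

text \<open>Real symmetry implies complex symmetry because a complex-linear operator commutes with
  the imaginary unit, and the imaginary part of \<open>cinner\<close> is \<open>rinner\<close> with
  a rotated first argument.\<close>

lemma self_adjoint_iff:
  "A \<in> self_adjoint_ops \<longleftrightarrow> A \<in> bounded_ops \<and> (\<forall>x y. rinner (A x) y = rinner x (A y))"
proof -
  have "cinner (A x) y = cinner x (A y)"
    if A: "A \<in> bounded_ops" and r: "\<And>x y. rinner (A x) y = rinner x (A y)" for x y
  proof -
    have "\<i> *\<^sub>C A x = A (\<i> *\<^sub>C x)" using A by (simp add: bounded_ops_def)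
    then show ?thesis by (simp add: cinner_eq_rinner r)
  qed
  then show ?thesis
    by (auto simp: self_adjoint_ops_def rinner_def)
qed

lemma self_adjointI:
  "A \<in> bounded_ops \<Longrightarrow> (\<And>x y. rinner (A x) y = rinner x (A y)) \<Longrightarrow> A \<in> self_adjoint_ops"
  by (simp add: self_adjoint_iff)

lemma self_adjoint_bounded: "A \<in> self_adjoint_ops \<Longrightarrow> A \<in> bounded_ops"
  by (simp add: self_adjoint_iff)

lemma self_adjoint_rinner: "A \<in> self_adjoint_ops \<Longrightarrow> rinner (A x) y = rinner x (A y)"
  by (simp add: self_adjoint_iff)

lemma self_adjoint_zero [simp]: "0 \<in> self_adjoint_ops"
  and self_adjoint_id [simp]: "id_blinfun \<in> self_adjoint_ops"
  and self_adjoint_add: "A \<in> self_adjoint_ops \<Longrightarrow> B \<in> self_adjoint_ops \<Longrightarrow> A + B \<in> self_adjoint_ops"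
  and self_adjoint_diff: "A \<in> self_adjoint_ops \<Longrightarrow> B \<in> self_adjoint_ops \<Longrightarrow> A - B \<in> self_adjoint_ops"
  and self_adjoint_scaleR: "A \<in> self_adjoint_ops \<Longrightarrow> r *\<^sub>R A \<in> self_adjoint_ops"
  by (auto simp: self_adjoint_iff blinfun.bilinear_simps rinner.add_left rinner.add_right
      rinner.diff_left rinner.diff_right rinner.scaleR_left rinner.scaleR_right rinner.zero_left
      rinner.zero_right intro: bounded_ops_add bounded_ops_diff bounded_ops_scaleR)

lemma self_adjoint_sum: "(\<And>i. i \<in> I \<Longrightarrow> A i \<in> self_adjoint_ops) \<Longrightarrow> sum A I \<in> self_adjoint_ops"
  by (induction I rule: infinite_finite_induct) (auto intro: self_adjoint_add)

lemma self_adjoint_sandwich: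
  "A \<in> self_adjoint_ops \<Longrightarrow> S \<in> self_adjoint_ops \<Longrightarrow> S o\<^sub>L A o\<^sub>L S \<in> self_adjoint_ops"
  by (auto simp: self_adjoint_iff intro: bounded_ops_compose)

lemma self_adjoint_compose:
  "A \<in> self_adjoint_ops \<Longrightarrow> B \<in> self_adjoint_ops \<Longrightarrow> A o\<^sub>L B = B o\<^sub>L A \<Longrightarrow> A o\<^sub>L B \<in> self_adjoint_ops"
  unfolding self_adjoint_iff
  by (metis blinfun_apply_blinfun_compose bounded_ops_compose)

lemma self_adjoint_LIMSEQ:
  assumes "A \<longlonglongrightarrow> L" "\<And>k. A k \<in> self_adjoint_ops"
  shows "L \<in> self_adjoint_ops"
proof (rule self_adjointI)
  show "L \<in> bounded_ops"
    using bounded_ops_LIMSEQ[OF assms(1)] assms(2) by (simp add: self_adjoint_iff)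
  show "rinner (L x) y = rinner x (L y)" for x y
  proof (rule LIMSEQ_unique)
    show "(\<lambda>k. rinner (A k x) y) \<longlonglongrightarrow> rinner (L x) y"
      by (intro rinner.tendsto tendsto_blinfun_apply assms tendsto_const)
    have "(\<lambda>k. rinner x (A k y)) \<longlonglongrightarrow> rinner x (L y)"
      by (intro rinner.tendsto tendsto_blinfun_apply assms tendsto_const)
    then show "(\<lambda>k. rinner (A k x) y) \<longlonglongrightarrow> rinner x (L y)"
      using assms(2) by (simp add: self_adjoint_rinner)
  qed
qed

subsection \<open>The positive semidefinite order\<close>

lemma pos_semidef_iff:
  "pos_semidef A \<longleftrightarrow> A \<in> self_adjoint_ops \<and> (\<forall>x. 0 \<le> rinner x (A x))"
  by (simp add: pos_semidef_def rinner_def)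

lemma op_leI:
  assumes "A \<in> self_adjoint_ops" "B \<in> self_adjoint_ops" "\<And>x. rinner x (A x) \<le> rinner x (B x)"
  shows "A \<preceq> B"
  using assms
  by (auto simp: op_le_def pos_semidef_iff self_adjoint_diff blinfun.diff_left rinner.diff_right)

lemma op_leD: "A \<preceq> B \<Longrightarrow> rinner x (A x) \<le> rinner x (B x)"
  by (auto simp: op_le_def pos_semidef_iff blinfun.diff_left rinner.diff_right)

lemma op_le_refl [simp]: "A \<preceq> A"
  by (simp add: op_le_def pos_semidef_iff rinner.zero_right)

lemma op_le_trans [trans]: "A \<preceq> B \<Longrightarrow> B \<preceq> C \<Longrightarrow> A \<preceq> C"
  using self_adjoint_add[of "B - A" "C - B"]
  by (fastforce simp: op_le_def pos_semidef_iff blinfun.diff_left rinner.diff_right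
      intro: order_trans)

lemma op_le_add: "A \<preceq> B \<Longrightarrow> C \<preceq> D \<Longrightarrow> A + C \<preceq> B + D"
  using self_adjoint_add[of "B - A" "D - C"]
  by (auto simp: op_le_def pos_semidef_iff blinfun.bilinear_simps rinner.diff_right
      rinner.add_right add_diff_add add_mono)

lemma op_le_sum: "(\<And>i. i \<in> I \<Longrightarrow> A i \<preceq> B i) \<Longrightarrow> sum A I \<preceq> sum B I"
  by (induction I rule: infinite_finite_induct) (auto intro: op_le_add)

lemma op_le_scaleR: "A \<preceq> B \<Longrightarrow> 0 \<le> r \<Longrightarrow> r *\<^sub>R A \<preceq> r *\<^sub>R B"
  using self_adjoint_scaleR[of "B - A" r]
  by (auto simp: op_le_def pos_semidef_iff blinfun.bilinear_simps rinner.scaleR_right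
      rinner.diff_right scaleR_diff_right mult_left_mono)

lemma op_le_sandwich:
  assumes "A \<preceq> B" "S \<in> self_adjoint_ops"
  shows "S o\<^sub>L A o\<^sub>L S \<preceq> S o\<^sub>L B o\<^sub>L S"
proof -
  have "(S o\<^sub>L B o\<^sub>L S) - (S o\<^sub>L A o\<^sub>L S) = S o\<^sub>L (B - A) o\<^sub>L S"
    by (simp add: compose_simps)
  moreover have "rinner x (S ((B - A) (S x))) = rinner (S x) ((B - A) (S x))" for x
    using assms(2) by (simp add: self_adjoint_rinner)
  ultimately show ?thesis
    using assms by (auto simp: op_le_def pos_semidef_iff intro: self_adjoint_sandwich)
qed

lemma op_le_LIMSEQ:
  assumes "A \<longlonglongrightarrow> L" "B \<longlonglongrightarrow> M" "\<And>k. A k \<preceq> B k"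
  shows "L \<preceq> M"
proof -
  have lim: "(\<lambda>k. B k - A k) \<longlonglongrightarrow> M - L"
    by (intro tendsto_diff assms)
  have "0 \<le> rinner x ((M - L) x)" for x
  proof (rule LIMSEQ_le_const)
    show "(\<lambda>k. rinner x ((B k - A k) x)) \<longlonglongrightarrow> rinner x ((M - L) x)"
      by (intro rinner.tendsto tendsto_blinfun_apply lim tendsto_const)
    show "\<exists>N. \<forall>k\<ge>N. 0 \<le> rinner x ((B k - A k) x)"
      using assms(3) by (auto simp: op_le_def pos_semidef_iff)
  qed
  moreover have "M - L \<in> self_adjoint_ops"
    using self_adjoint_LIMSEQ[OF lim] assms(3) by (auto simp: op_le_def pos_semidef_iff)
  ultimately show ?thesis by (simp add: op_le_def pos_semidef_iff)
qed

text \<open>Scalar bounds a I <= A <= b I in form language. They serve as the domain condition of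
  the functional calculus on \<open>{a..b}\<close> and, for \<open>0 < a\<close>, as a quantitative
  version of positive definiteness.\<close>

definition op_interval :: "real \<Rightarrow> real \<Rightarrow> 'a::complex_inner op set" where
  "op_interval a b = {A \<in> self_adjoint_ops.
     \<forall>x. a * (norm x)\<^sup>2 \<le> rinner x (A x) \<and> rinner x (A x) \<le> b * (norm x)\<^sup>2}"

lemma op_interval_sa: "A \<in> op_interval a b \<Longrightarrow> A \<in> self_adjoint_ops"
  by (simp add: op_interval_def)

lemma op_interval_bounded: "A \<in> op_interval a b \<Longrightarrow> A \<in> bounded_ops"
  by (simp add: op_interval_def self_adjoint_iff)

lemma op_interval_lower: "A \<in> op_interval a b \<Longrightarrow> a * (norm x)\<^sup>2 \<le> rinner x (A x)"
  and op_interval_upper: "A \<in> op_interval a b \<Longrightarrow> rinner x (A x) \<le> b * (norm x)\<^sup>2"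
  by (auto simp: op_interval_def)

lemma op_interval_iff:
  "A \<in> op_interval a b \<longleftrightarrow> a *\<^sub>R id_blinfun \<preceq> A \<and> A \<preceq> b *\<^sub>R id_blinfun"
proof
  assume "A \<in> op_interval a b"
  then show "a *\<^sub>R id_blinfun \<preceq> A \<and> A \<preceq> b *\<^sub>R id_blinfun"
    by (auto simp: op_interval_def blinfun.bilinear_simps rinner.scaleR_right rinner_self
        intro!: op_leI self_adjoint_scaleR)
next
  assume r: "a *\<^sub>R id_blinfun \<preceq> A \<and> A \<preceq> b *\<^sub>R id_blinfun"
  then have "A - a *\<^sub>R id_blinfun \<in> self_adjoint_ops"
    by (simp add: op_le_def pos_semidef_iff)
  then have "A - a *\<^sub>R id_blinfun + a *\<^sub>R id_blinfun \<in> self_adjoint_ops"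
    by (intro self_adjoint_add self_adjoint_scaleR) auto
  then show "A \<in> op_interval a b"
    using r op_leD[of "a *\<^sub>R id_blinfun" A] op_leD[of A "b *\<^sub>R id_blinfun"]
    by (simp add: op_interval_def blinfun.bilinear_simps rinner.scaleR_right rinner_self)
qed

lemma op_interval_mono: "A \<in> op_interval a b \<Longrightarrow> a' \<le> a \<Longrightarrow> b \<le> b' \<Longrightarrow> A \<in> op_interval a' b'"
proof -
  assume A: "A \<in> op_interval a b" and ab: "a' \<le> a" "b \<le> b'"
  have "a' * (norm x)\<^sup>2 \<le> rinner x (A x)" "rinner x (A x) \<le> b' * (norm x)\<^sup>2" for x
    using mult_right_mono[OF ab(1), of "(norm x)\<^sup>2"] mult_right_mono[OF ab(2), of "(norm x)\<^sup>2"]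
      op_interval_lower[OF A, of x] op_interval_upper[OF A, of x] by simp_all
  then show ?thesis using op_interval_sa[OF A] by (simp add: op_interval_def)
qed

lemma self_adjoint_op_interval: "A \<in> self_adjoint_ops \<Longrightarrow> A \<in> op_interval (- norm A) (norm A)"
proof -
  assume A: "A \<in> self_adjoint_ops"
  have "\<bar>rinner x (A x)\<bar> \<le> norm A * (norm x)\<^sup>2" for x
  proof -
    have "\<bar>rinner x (A x)\<bar> \<le> norm x * norm (A x)" by (rule rinner_Cauchy_Schwarz)
    also have "\<dots> \<le> norm x * (norm A * norm x)"
      by (intro mult_left_mono norm_blinfun) auto
    finally show ?thesis by (simp add: power2_eq_square mult_ac)
  qed
  then show ?thesis
    using A by (simp add: op_interval_def abs_le_iff minus_le_iff)
qed

text \<open>Polarization: the form at u + v and u - v bounds \<open>rinner u (A v)\<close> through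
  the parallelogram law. Taking for u the vector \<open>A x\<close> rescaled to the length of x
  extracts \<open>norm (A x)\<close>.\<close>

lemma norm_le_op_interval:
  assumes A: "A \<in> op_interval (- e) e" and "0 \<le> e"
  shows "norm A \<le> e"
proof (rule norm_blinfun_bound[OF \<open>0 \<le> e\<close>])
  fix x
  have bil: "4 * rinner u (A v) \<le> 2 * e * ((norm u)\<^sup>2 + (norm v)\<^sup>2)" for u v
  proof -
    have s: "rinner v (A u) = rinner u (A v)"
      by (metis self_adjoint_rinner[OF op_interval_sa[OF A]] rinner_commute)
    have "4 * rinner u (A v) = rinner (u + v) (A (u + v)) - rinner (u - v) (A (u - v))"
      using s by (simp add: blinfun.bilinear_simps rinner_add_left rinner_add_right rinner.diff_left
          rinner.diff_right)
    also have "\<dots> \<le> e * (norm (u + v))\<^sup>2 + e * (norm (u - v))\<^sup>2"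
      using op_interval_upper[OF A, of "u + v"] op_interval_lower[OF A, of "u - v"] by linarith
    also have "\<dots> = 2 * e * ((norm u)\<^sup>2 + (norm v)\<^sup>2)"
      unfolding rinner_self[symmetric]
      by (simp add: rinner_add_left rinner_add_right rinner.diff_left rinner.diff_right
          rinner_commute[of v u] algebra_simps)
    finally show ?thesis .
  qed
  show "norm (A x) \<le> e * norm x"
  proof (cases "A x = 0 \<or> x = 0")
    case True
    then show ?thesis using \<open>0 \<le> e\<close> by auto
  next
    case False
    define u where "u = (norm x / norm (A x)) *\<^sub>R A x"
    have "norm u = norm x" "rinner u (A x) = norm x * norm (A x)"
      using False by (auto simp: u_def rinner.scaleR_left rinner_self power2_eq_square)
    then have "norm x * norm (A x) \<le> norm x * (e * norm x)"
      using bil[of u x] by (simp add: power2_eq_square mult.left_commute)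
    then show ?thesis using False by simp
  qed
qed

lemma norm_diff_le_op_le:
  assumes "A - B \<preceq> e *\<^sub>R id_blinfun" "B - A \<preceq> e *\<^sub>R id_blinfun" "0 \<le> e"
  shows "norm (A - B) \<le> e"
proof (rule norm_le_op_interval)
  have "- e *\<^sub>R id_blinfun \<preceq> A - B"
    using assms(2) by (simp add: op_le_def algebra_simps)
  then show "A - B \<in> op_interval (- e) e"
    using assms(1) by (simp add: op_interval_iff)
qed (rule assms)

lemma op_le_antisym: "A \<preceq> B \<Longrightarrow> B \<preceq> A \<Longrightarrow> A = B"
  using norm_diff_le_op_le[of A B 0] by (simp add: op_le_def)

lemma op_interval_id: "a \<le> 1 \<Longrightarrow> 1 \<le> b \<Longrightarrow> id_blinfun \<in> op_interval a b"
  by (auto simp: op_interval_def rinner_self mult_le_cancel_right1 mult_le_cancel_right2)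

lemma op_interval_scaleR: "A \<in> op_interval a b \<Longrightarrow> 0 \<le> r \<Longrightarrow> r *\<^sub>R A \<in> op_interval (r * a) (r * b)"
  using op_le_scaleR[of _ _ r] by (fastforce simp: op_interval_iff)

lemma op_interval_LIMSEQ:
  "A \<longlonglongrightarrow> L \<Longrightarrow> (\<And>k. A k \<in> op_interval a b) \<Longrightarrow> L \<in> op_interval a b"
  unfolding op_interval_iff by (auto intro: op_le_LIMSEQ tendsto_const)

subsection \<open>Invertibility\<close>

lemma ex_inverse_Neumann:
  fixes K :: "'a::chilbert_space op"
  assumes K: "norm K < 1" "K \<in> bounded_ops"
  shows "\<exists>B. is_inverse (id_blinfun - K) B"
proof -
  define N where "N j = ((\<lambda>B. K o\<^sub>L B) ^^ j) id_blinfun" for j :: nat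
  have N0: "N 0 = id_blinfun" and NS: "N (Suc j) = K o\<^sub>L N j" for j
    by (simp_all add: N_def)
  have comm: "K o\<^sub>L N j = N j o\<^sub>L K" for j
    by (induction j) (simp_all add: N0 NS flip: compose_assoc)
  have Nb: "N j \<in> bounded_ops" for j
    by (induction j) (simp_all add: N0 NS bounded_ops_compose K)
  have Nn: "norm (N j) \<le> norm K ^ j" for j
  proof (induction j)
    case 0 then show ?case by (simp add: N0 norm_blinfun_id_le)
  next
    case (Suc j)
    have "norm (N (Suc j)) \<le> norm K * norm (N j)"
      unfolding NS by (rule norm_blinfun_compose)
    also have "\<dots> \<le> norm K * norm K ^ j" by (intro mult_left_mono Suc) auto
    finally show ?case by simp
  qed
  have s: "summable N"
    by (rule summable_comparison_test'[of "\<lambda>j. norm K ^ j"]) (use K Nn in \<open>auto intro: summable_geometric\<close>)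
  define B where "B = suminf N"
  have shift: "(\<Sum>j. N (Suc j)) = B - id_blinfun"
    using suminf_split_head[OF s] by (simp add: B_def N0)
  have "K o\<^sub>L B = (\<Sum>j. K o\<^sub>L N j)"
    unfolding B_def
    by (rule bounded_linear.suminf[OF bounded_bilinear.bounded_linear_right[OF bounded_bilinear_blinfun_compose] s])
  then have KB: "K o\<^sub>L B = B - id_blinfun" by (simp add: shift flip: NS)
  have "B o\<^sub>L K = (\<Sum>j. N j o\<^sub>L K)"
    unfolding B_def
    by (rule bounded_linear.suminf[OF bounded_bilinear.bounded_linear_left[OF bounded_bilinear_blinfun_compose] s])
  then have BK: "B o\<^sub>L K = B - id_blinfun" by (simp add: shift flip: NS comm)
  have "B \<in> bounded_ops"
    using summable_LIMSEQ[OF s] unfolding B_def[symmetric]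
    by (rule bounded_ops_LIMSEQ) (simp add: bounded_ops_sum Nb)
  then have "is_inverse (id_blinfun - K) B"
    by (simp add: is_inverse_def compose_simps KB BK)
  then show ?thesis by blast
qed

lemma is_inverse_scaleR:
  "is_inverse A B \<Longrightarrow> r \<noteq> 0 \<Longrightarrow> is_inverse (r *\<^sub>R A) (inverse r *\<^sub>R B)"
  by (simp add: is_inverse_def compose_simps bounded_ops_scaleR)

text \<open>After division by a large M the operator is I - K with 0 <= K <= 1 - c/M, so the Neumann
  series applies.\<close>

lemma ex_inverse_op_interval:
  fixes A :: "'a::chilbert_space op"
  assumes A: "A \<in> op_interval c b" and "0 < c"
  shows "\<exists>B. is_inverse A B"
proof -
  \<comment> \<open>The interval may have \<open>b < c\<close>; the maximum with
    \<open>c + 1\<close> keeps 1 - c/M positive in that case too.\<close>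
  define M where "M = max b (c + 1)"
  have M: "M > 0" "c < M" "b \<le> M" using \<open>0 < c\<close> by (auto simp: M_def)
  define K where "K = id_blinfun - inverse M *\<^sub>R A"
  have Ki: "K \<in> op_interval 0 (1 - c / M)"
  proof -
    have "rinner x (K x) = (norm x)\<^sup>2 - rinner x (A x) / M" for x
      by (simp add: K_def blinfun.bilinear_simps rinner.diff_right rinner.scaleR_right rinner_self
          divide_inverse mult.commute)
    moreover have "rinner x (A x) / M \<le> (norm x)\<^sup>2" for x
    proof -
      have "rinner x (A x) \<le> M * (norm x)\<^sup>2"
        using op_interval_upper[OF A, of x] mult_right_mono[OF M(3), of "(norm x)\<^sup>2"] by simp
      then show ?thesis using M by (simp add: field_simps)
    qed
    moreover have "c / M * (norm x)\<^sup>2 \<le> rinner x (A x) / M" for x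
      using op_interval_lower[OF A, of x] M by (simp add: divide_right_mono)
    moreover have "K \<in> self_adjoint_ops"
      unfolding K_def using op_interval_sa[OF A] by (intro self_adjoint_diff self_adjoint_scaleR) auto
    ultimately show ?thesis by (auto simp: op_interval_def left_diff_distrib)
  qed
  have "norm K \<le> 1 - c / M"
    using M by (intro norm_le_op_interval op_interval_mono[OF Ki]) (auto simp: field_simps)
  also have "\<dots> < 1" using M \<open>0 < c\<close> by simp
  finally obtain B where "is_inverse (id_blinfun - K) B"
    using ex_inverse_Neumann op_interval_bounded[OF Ki] by blast
  from is_inverse_scaleR[OF this, of M] show ?thesis
    using M by (auto simp: K_def)
qed

text \<open>With A - z and its adjoint as factors, this turns invertibility of a positive product
  into invertibility of a factor that is not self-adjoint.\<close>

lemma ex_inverse_of_commuting: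
  assumes "is_inverse (A o\<^sub>L B) C" "A o\<^sub>L B = B o\<^sub>L A" "A \<in> bounded_ops" "B \<in> bounded_ops"
  shows "\<exists>D. is_inverse A D"
proof -
  have "A o\<^sub>L (B o\<^sub>L C) = id_blinfun" "(C o\<^sub>L B) o\<^sub>L A = id_blinfun"
    using assms(1) unfolding is_inverse_def by (metis compose_assoc, metis assms(2) compose_assoc)
  moreover from this have "C o\<^sub>L B = B o\<^sub>L C"
    by (metis compose_assoc compose_id_left compose_id_right)
  ultimately show ?thesis
    using assms by (intro exI[of _ "B o\<^sub>L C"]) (auto simp: is_inverse_def bounded_ops_compose)
qed

text \<open>The backward direction is order theory. Forward, an inverse B gives |x| <= |B| |A x|,
  and |A x|^2 is at most N times the form of A at x; together they bound the form below by a
  multiple of |x|^2.\<close>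

lemma pos_def_ops_iff:
  fixes A :: "'a::chilbert_space op"
  shows "A \<in> pos_def_ops \<longleftrightarrow> (\<exists>a b. 0 < a \<and> a \<le> b \<and> A \<in> op_interval a b)"
proof
  assume "\<exists>a b. 0 < a \<and> a \<le> b \<and> A \<in> op_interval a b"
  then obtain a b where ab: "0 < a" "A \<in> op_interval a b" by blast
  have "0 \<le> rinner x (A x)" for x
    using op_interval_lower[OF ab(2), of x] ab(1)
    by (meson less_imp_le order_trans mult_nonneg_nonneg zero_le_power2)
  then show "A \<in> pos_def_ops"
    using ex_inverse_op_interval[OF ab(2,1)] op_interval_sa[OF ab(2)]
    by (auto simp: pos_def_ops_def pos_semidef_iff)
next
  assume "A \<in> pos_def_ops"
  then obtain B where A: "A \<in> self_adjoint_ops" "\<And>x. 0 \<le> rinner x (A x)" and B: "is_inverse A B"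
    by (auto simp: pos_def_ops_def pos_semidef_iff)
  define N where "N = norm A + 1"
  have N: "N > 0" "norm A \<le> N" by (auto simp: N_def add_nonneg_pos)
  define c where "c = 1 / (N * (norm B + 1)\<^sup>2)"
  have B1: "norm B + 1 \<noteq> 0" using norm_ge_zero[of B] by linarith
  have c: "c > 0" using N B1 by (simp add: c_def zero_less_mult_iff)
  \<comment> \<open>Positivity of A at x - A x / N; the term with three factors A is bounded by A <=
    N.\<close>
  have sq: "(norm (A x))\<^sup>2 \<le> N * rinner x (A x)" for x
  proof -
    have s: "rinner x (A (A x)) = norm (A x) * norm (A x)" "rinner (A x) (A x) = norm (A x) * norm (A x)"
      by (simp_all add: rinner_self power2_eq_square flip: self_adjoint_rinner[OF A(1)])
    have "0 \<le> rinner (x - (1 / N) *\<^sub>R A x) (A (x - (1 / N) *\<^sub>R A x))" by (rule A)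
    also have "\<dots> = rinner x (A x) - 2 / N * (norm (A x))\<^sup>2 + rinner (A x) (A (A x)) / N\<^sup>2"
      using s by (simp add: blinfun.bilinear_simps rinner.diff_left rinner.diff_right
          rinner_scaleR_left rinner_scaleR_right power2_eq_square diff_divide_distrib)
    also have "rinner (A x) (A (A x)) / N\<^sup>2 \<le> N * (norm (A x))\<^sup>2 / N\<^sup>2"
      using op_interval_upper[OF self_adjoint_op_interval[OF A(1)], of "A x"]
        mult_right_mono[OF N(2), of "(norm (A x))\<^sup>2"]
      by (intro divide_right_mono) auto
    also have "N * (norm (A x))\<^sup>2 / N\<^sup>2 = (norm (A x))\<^sup>2 / N" using N by (simp add: power2_eq_square)
    finally have "0 \<le> rinner x (A x) - (norm (A x))\<^sup>2 / N" by simp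
    then show ?thesis using N by (simp add: field_simps)
  qed
  have "c * (norm x)\<^sup>2 \<le> rinner x (A x)" for x
  proof -
    have "x = B (A x)"
      using B by (metis is_inverse_def blinfun_apply_blinfun_compose blinfun_apply_id_blinfun)
    then have "norm x \<le> (norm B + 1) * norm (A x)"
      using norm_blinfun[of B "A x"] by (smt (verit) mult_right_mono norm_ge_zero)
    then have "(norm x)\<^sup>2 \<le> (norm B + 1)\<^sup>2 * (norm (A x))\<^sup>2"
      by (metis norm_ge_zero power_mono power_mult_distrib)
    also have "\<dots> \<le> (norm B + 1)\<^sup>2 * (N * rinner x (A x))"
      by (intro mult_left_mono sq) auto
    finally show ?thesis
      using N B1 pos_divide_le_eq[of "N * (norm B + 1)\<^sup>2" "(norm x)\<^sup>2" "rinner x (A x)"]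
      by (simp add: c_def mult_ac zero_less_mult_iff)
  qed
  then have "A \<in> op_interval c (max c (norm A))"
    using op_interval_mono[OF self_adjoint_op_interval[OF A(1)] order_refl, of "max c (norm A)"]
    by (simp add: op_interval_def)
  then show "\<exists>a b. 0 < a \<and> a \<le> b \<and> A \<in> op_interval a b"
    using c by (intro exI[of _ c] exI[of _ "max c (norm A)"]) auto
qed

text \<open>For non-real z the product of A - z and A - cnj z is (A - Re z)^2 + (Im z)^2, which is
  bounded below by (Im z)^2 and hence invertible. For real r outside the interval, A - r or r - A
  has a positive lower bound.\<close>

lemma spectrum_op_interval:
  fixes A :: "'a::chilbert_space op"
  assumes A: "A \<in> op_interval a b"
  shows "spectrum A \<subseteq> complex_of_real ` {a..b}"
proof
  fix z assume z: "z \<in> spectrum A"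
  note sa = op_interval_sa[OF A]
  have scal: "scalar_op (complex_of_real r) = r *\<^sub>R (id_blinfun :: 'a op)" for r
    by (rule blinfun_eqI) (simp add: scalar_op.rep_eq blinfun.bilinear_simps scaleC_of_real)
  have im: "Im z = 0"
  proof (rule ccontr)
    assume nz: "Im z \<noteq> 0"
    have b: "A - scalar_op w \<in> bounded_ops" for w
      by (intro bounded_ops_diff bounded_ops_scalar_op op_interval_bounded[OF A])
    define D where "D = A - Re z *\<^sub>R id_blinfun"
    have D: "D \<in> self_adjoint_ops" unfolding D_def by (intro self_adjoint_diff self_adjoint_scaleR sa) auto
    have lin: "A (w *\<^sub>C x) = w *\<^sub>C A x" for w x
      using op_interval_bounded[OF A] by (simp add: bounded_ops_def)
    have split: "w *\<^sub>C x = Re w *\<^sub>R x + Im w *\<^sub>R (\<i> *\<^sub>C x)" for w and x :: 'a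
      by (metis complex_eq mult.commute scaleC_add_left scaleC_of_real scaleC_scaleC)
    have prod: "(A - scalar_op z) o\<^sub>L (A - scalar_op (cnj z)) = (D o\<^sub>L D) + (Im z)\<^sup>2 *\<^sub>R id_blinfun"
         "(A - scalar_op (cnj z)) o\<^sub>L (A - scalar_op z) = (D o\<^sub>L D) + (Im z)\<^sup>2 *\<^sub>R id_blinfun"
      by (rule blinfun_eqI;
         simp add: D_def scalar_op.rep_eq blinfun.bilinear_simps split[of z] split[of "cnj z"] lin
           scaleC_add_right scaleC_diff_right scaleC_scaleR scaleC_scaleC algebra_simps power2_eq_square;
         simp add: scaleC_of_real[of "-1", simplified])+
    have "rinner x (((D o\<^sub>L D) + (Im z)\<^sup>2 *\<^sub>R id_blinfun) x) = (norm (D x))\<^sup>2 + (Im z)\<^sup>2 * (norm x)\<^sup>2" for x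
      using self_adjoint_rinner[OF D, of x "D x"]
      by (simp add: blinfun.bilinear_simps rinner.add_right rinner.scaleR_right rinner_self)
    moreover have "(D o\<^sub>L D) + (Im z)\<^sup>2 *\<^sub>R id_blinfun \<in> self_adjoint_ops"
      using D by (intro self_adjoint_add self_adjoint_compose self_adjoint_scaleR) auto
    ultimately have "(D o\<^sub>L D) + (Im z)\<^sup>2 *\<^sub>R id_blinfun
        \<in> op_interval ((Im z)\<^sup>2) (norm ((D o\<^sub>L D) + (Im z)\<^sup>2 *\<^sub>R id_blinfun))"
      using self_adjoint_op_interval[of "(D o\<^sub>L D) + (Im z)\<^sup>2 *\<^sub>R id_blinfun"]
      by (simp add: op_interval_def)
    then obtain C where "is_inverse ((D o\<^sub>L D) + (Im z)\<^sup>2 *\<^sub>R id_blinfun) C"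
      using ex_inverse_op_interval nz by (metis zero_less_power2)
    then have "\<exists>E. is_inverse (A - scalar_op z) E"
      by (intro ex_inverse_of_commuting[of _ "A - scalar_op (cnj z)"]) (auto simp: prod b)
    then show False using z by (simp add: spectrum_def)
  qed
  define r where "r = Re z"
  have zr: "z = complex_of_real r" using im by (simp add: r_def complex_eq_iff)
  have form: "rinner x ((A - r *\<^sub>R id_blinfun) x) = rinner x (A x) - r * (norm x)\<^sup>2" for x
    by (simp add: blinfun.bilinear_simps rinner.diff_right rinner.scaleR_right rinner_self)
  have sar: "A - r *\<^sub>R id_blinfun \<in> self_adjoint_ops"
    by (intro self_adjoint_diff self_adjoint_scaleR sa) auto
  have no: "\<nexists>B. is_inverse (A - r *\<^sub>R id_blinfun) B"
    using z by (simp add: spectrum_def zr scal)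
  have "a \<le> r"
  proof (rule ccontr)
    assume "\<not> a \<le> r"
    moreover have "A - r *\<^sub>R id_blinfun \<in> op_interval (a - r) (b - r)"
      using sar op_interval_lower[OF A] op_interval_upper[OF A]
      by (simp add: op_interval_def form left_diff_distrib)
    ultimately show False using no ex_inverse_op_interval by (metis diff_gt_0_iff_gt not_le)
  qed
  moreover have "r \<le> b"
  proof (rule ccontr)
    assume "\<not> r \<le> b"
    moreover have "rinner x (((-1) *\<^sub>R (A - r *\<^sub>R id_blinfun)) x) = r * (norm x)\<^sup>2 - rinner x (A x)" for x
      using form[of x] by (simp only: blinfun.scaleR_left rinner_scaleR_right) simp
    then have "(-1) *\<^sub>R (A - r *\<^sub>R id_blinfun) \<in> op_interval (r - b) (r - a)"
      using self_adjoint_scaleR[OF sar, of "-1"] op_interval_lower[OF A] op_interval_upper[OF A]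
      by (simp only: op_interval_def left_diff_distrib mem_Collect_eq) auto
    ultimately obtain B where "is_inverse ((-1) *\<^sub>R (A - r *\<^sub>R id_blinfun)) B"
      using ex_inverse_op_interval by (metis diff_gt_0_iff_gt not_le)
    from is_inverse_scaleR[OF this, of "-1"] show False using no by auto
  qed
  ultimately show "z \<in> complex_of_real ` {a..b}" by (auto simp: zr)
qed

section \<open>Functional calculus\<close>

subsection \<open>Polynomials of an operator\<close>

lemma poly_op_eq_sum:
  assumes "degree p \<le> n"
  shows "poly_op p A = (\<Sum>i\<le>n. coeff p i *\<^sub>R ((\<lambda>B. A o\<^sub>L B) ^^ i) id_blinfun)"
  unfolding poly_op_def using assms
  by (intro sum.mono_neutral_left) (auto simp: coeff_eq_0)

lemma poly_op_0 [simp]: "poly_op 0 A = 0"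
  by (simp add: poly_op_def)

lemma poly_op_pCons: "poly_op (pCons c p) A = c *\<^sub>R id_blinfun + (A o\<^sub>L poly_op p A)"
proof -
  have "poly_op (pCons c p) A
      = (\<Sum>i\<le>Suc (degree p). coeff (pCons c p) i *\<^sub>R ((\<lambda>B. A o\<^sub>L B) ^^ i) id_blinfun)"
    by (rule poly_op_eq_sum) (rule degree_pCons_le)
  also have "\<dots> = c *\<^sub>R id_blinfun
      + (\<Sum>i\<le>degree p. coeff p i *\<^sub>R (A o\<^sub>L ((\<lambda>B. A o\<^sub>L B) ^^ i) id_blinfun))"
    by (subst sum.atMost_Suc_shift) simp
  also have "(\<Sum>i\<le>degree p. coeff p i *\<^sub>R (A o\<^sub>L ((\<lambda>B. A o\<^sub>L B) ^^ i) id_blinfun)) = (A o\<^sub>L poly_op p A)"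
    unfolding poly_op_def
    by (simp add: bounded_bilinear.sum_right[OF bounded_bilinear_blinfun_compose] compose_simps)
  finally show ?thesis .
qed

lemma poly_op_add: "poly_op (p + q) A = poly_op p A + poly_op q A"
proof (induction p arbitrary: q)
  case (pCons c p)
  show ?case
    by (cases q) (simp add: poly_op_pCons pCons.IH compose_simps scaleR_add_left)
qed simp

lemma poly_op_smult: "poly_op (smult c p) A = c *\<^sub>R poly_op p A"
  by (induction p) (simp_all add: poly_op_pCons compose_simps scaleR_add_right)

lemma poly_op_diff: "poly_op (p - q) A = poly_op p A - poly_op q A"
  using poly_op_add[of p "smult (-1) q" A] poly_op_smult[of "-1" q A] by simp

lemma poly_op_mult: "poly_op (p * q) A = poly_op p A o\<^sub>L poly_op q A"
  by (induction p) (simp_all add: poly_op_pCons poly_op_add poly_op_smult compose_simps compose_assoc)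

lemma poly_op_const: "poly_op [:c:] A = c *\<^sub>R id_blinfun"
  by (simp add: poly_op_pCons)

lemma poly_op_X: "poly_op [:0, 1:] A = A"
  by (simp add: poly_op_pCons)

lemma poly_op_self_adjoint: "A \<in> self_adjoint_ops \<Longrightarrow> poly_op p A \<in> self_adjoint_ops"
proof (induction p)
  case (pCons c p)
  have "A o\<^sub>L poly_op p A = poly_op p A o\<^sub>L A"
    using poly_op_mult[of "[:0, 1:]" p A] poly_op_mult[of p "[:0, 1:]" A]
    by (simp add: poly_op_X mult.commute del: mult_pCons_left mult_pCons_right)
  then show ?case
    unfolding poly_op_pCons using pCons
    by (intro self_adjoint_add self_adjoint_scaleR self_adjoint_compose) auto
qed simp

text \<open>Complex polynomials are needed to factor \<open>p - \<mu>\<close> into linear factors.\<close>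

definition cpoly_op :: "complex poly \<Rightarrow> 'a::complex_inner op \<Rightarrow> 'a op" where
  "cpoly_op q A = fold_coeffs (\<lambda>c B. scalar_op c + (A o\<^sub>L B)) q 0"

lemma scalar_op_0 [simp]: "scalar_op 0 = 0"
  by (rule blinfun_eqI) (simp add: scalar_op.rep_eq)

lemma scalar_op_of_real: "scalar_op (complex_of_real r) = r *\<^sub>R id_blinfun"
  by (rule blinfun_eqI) (simp add: scalar_op.rep_eq blinfun.bilinear_simps scaleC_of_real)

lemma scalar_op_add: "scalar_op (c + d) = scalar_op c + scalar_op d"
  by (rule blinfun_eqI) (simp add: scalar_op.rep_eq blinfun.bilinear_simps scaleC_add_left)

lemma scalar_op_mult: "scalar_op (c * d) = scalar_op c o\<^sub>L scalar_op d"
  by (rule blinfun_eqI) (simp add: scalar_op.rep_eq scaleC_scaleC)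

lemma scalar_op_commute: "A \<in> bounded_ops \<Longrightarrow> A o\<^sub>L scalar_op c = scalar_op c o\<^sub>L A"
  by (rule blinfun_eqI) (simp add: scalar_op.rep_eq bounded_ops_def)

lemma scalar_op_minus: "scalar_op (- c) = - scalar_op c"
  using scalar_op_add[of c "- c"] by (simp add: eq_neg_iff_add_eq_0 add.commute)

lemma is_inverse_scalar_op: "c \<noteq> 0 \<Longrightarrow> is_inverse (scalar_op c) (scalar_op (inverse c))"
  using scalar_op_of_real[of 1]
  by (simp add: is_inverse_def bounded_ops_scalar_op flip: scalar_op_mult)

lemma cpoly_op_0 [simp]: "cpoly_op 0 A = 0"
  by (simp add: cpoly_op_def)

lemma cpoly_op_pCons: "cpoly_op (pCons c q) A = scalar_op c + (A o\<^sub>L cpoly_op q A)"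
  by (cases "c = 0 \<and> q = 0") (auto simp: cpoly_op_def)

lemma cpoly_op_add: "cpoly_op (p + q) A = cpoly_op p A + cpoly_op q A"
proof (induction p arbitrary: q)
  case (pCons c p)
  show ?case
    by (cases q) (simp add: cpoly_op_pCons pCons.IH compose_simps scalar_op_add)
qed simp

lemma cpoly_op_smult:
  "A \<in> bounded_ops \<Longrightarrow> cpoly_op (smult c q) A = scalar_op c o\<^sub>L cpoly_op q A"
  by (induction q)
    (simp_all add: cpoly_op_pCons compose_simps scalar_op_mult scalar_op_commute flip: compose_assoc)

lemma cpoly_op_of_real: "cpoly_op (map_poly complex_of_real p) A = poly_op p A"
  by (induction p) (simp_all add: cpoly_op_pCons poly_op_pCons map_poly_pCons scalar_op_of_real)

text \<open>The half of the spectral mapping theorem that is used: if q(A) is singular, then q has a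
  root in the spectrum. Linear factors are split off one at a time.\<close>

lemma ex_inverse_cpoly_op:
  assumes A: "A \<in> bounded_ops" and "q \<noteq> 0"
    and "\<And>z. poly q z = 0 \<Longrightarrow> \<exists>B. is_inverse (A - scalar_op z) B"
  shows "\<exists>B. is_inverse (cpoly_op q A) B"
  using assms(2,3)
proof (induction "degree q" arbitrary: q)
  case 0
  then obtain c where "q = [:c:]" "c \<noteq> 0" by (metis degree_eq_zeroE pCons_0_0)
  then show ?case using is_inverse_scalar_op[of c] by (auto simp: cpoly_op_pCons)
next
  case (Suc n)
  then have "\<not> constant (poly q)" by (simp add: constant_degree)
  then obtain z where z: "poly q z = 0" using fundamental_theorem_of_algebra by blast
  then obtain r where r: "q = [:- z, 1:] * r" by (metis poly_eq_0_iff_dvd dvdE)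
  have "r \<noteq> 0" using r Suc.prems by auto
  have "degree q = Suc (degree r)"
    unfolding r using \<open>r \<noteq> 0\<close> by (subst degree_mult_eq) auto
  then have "n = degree r" using Suc by simp
  moreover have "\<exists>B. is_inverse (A - scalar_op w) B" if "poly r w = 0" for w
    using Suc.prems(2)[of w] that by (simp add: r)
  ultimately obtain C where C: "is_inverse (cpoly_op r A) C"
    using Suc.hyps(1) \<open>r \<noteq> 0\<close> by blast
  obtain B where B: "is_inverse (A - scalar_op z) B" using Suc.prems(2) z by blast
  have "cpoly_op q A = (A - scalar_op z) o\<^sub>L cpoly_op r A"
    unfolding r
    by (simp add: cpoly_op_add cpoly_op_smult[OF A] cpoly_op_pCons compose_simps scalar_op_minus
        bounded_bilinear.minus_left[OF bounded_bilinear_blinfun_compose] del: smult_minus_left)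
  then show ?case using is_inverse_compose[OF B C] by auto
qed

subsection \<open>The norm of a polynomial of a self-adjoint operator\<close>

lemma norm_diff_scaleR_sq:
  "(norm (u - r *\<^sub>R v))\<^sup>2 = (norm u)\<^sup>2 - 2 * r * rinner u v + r\<^sup>2 * (norm v)\<^sup>2"
  unfolding rinner_self[symmetric]
  by (simp add: rinner.diff_left rinner.diff_right rinner_scaleR_left rinner_scaleR_right
      rinner_commute[of v u] algebra_simps power2_eq_square)

text \<open>If both N and -N were outside the spectrum, D = C^2 - N^2 would be boundedly invertible.
  But |D x|^2 <= N^2 (N^2 |x|^2 - |C x|^2), so |C x| would stay below N |x| by a fixed factor,
  contradicting that N is the operator norm.\<close>

lemma norm_mem_spectrum:
  fixes C :: "'a::chilbert_space op"
  assumes C: "C \<in> self_adjoint_ops" and "C \<noteq> 0"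
  shows "complex_of_real (norm C) \<in> spectrum C \<or> complex_of_real (- norm C) \<in> spectrum C"
proof (rule ccontr)
  define N where "N = norm C"
  have N: "N > 0" using \<open>C \<noteq> 0\<close> by (simp add: N_def)
  assume "\<not> ?thesis"
  then obtain P Q where PQ: "is_inverse (C - N *\<^sub>R id_blinfun) P" "is_inverse (C + N *\<^sub>R id_blinfun) Q"
    unfolding N_def by (auto simp: spectrum_def scalar_op_of_real scalar_op_minus)
  define D where "D = (C - N *\<^sub>R id_blinfun) o\<^sub>L (C + N *\<^sub>R id_blinfun)"
  define E where "E = Q o\<^sub>L P"
  have E: "is_inverse D E" unfolding D_def E_def by (rule is_inverse_compose[OF PQ])
  \<comment> \<open>The added 1 keeps 1/k defined and positive whatever the norm of E is; the later
    \<open>max 0\<close> guards the square root against a negative N^2 - 1/k.\<close>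
  define k where "k = (norm E)\<^sup>2 * N\<^sup>2 + 1"
  have k: "k > 0" by (simp add: k_def add_nonneg_pos)
  have bound: "norm (C x) \<le> sqrt (max 0 (N\<^sup>2 - 1 / k)) * norm x" for x
  proof -
    have cc: "rinner (C (C x)) x = (norm (C x))\<^sup>2"
      by (metis self_adjoint_rinner[OF C] rinner_self)
    have Dx: "D x = C (C x) - N\<^sup>2 *\<^sub>R x"
      by (simp add: D_def blinfun.bilinear_simps power2_eq_square algebra_simps)
    have "(norm (D x))\<^sup>2 = (norm (C (C x)))\<^sup>2 - 2 * N\<^sup>2 * (norm (C x))\<^sup>2 + N^4 * (norm x)\<^sup>2"
      unfolding Dx norm_diff_scaleR_sq cc by simp
    also have "(norm (C (C x)))\<^sup>2 \<le> N\<^sup>2 * (norm (C x))\<^sup>2"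
      unfolding power_mult_distrib[symmetric] N_def by (intro power_mono norm_blinfun) simp
    also have "N\<^sup>2 * (norm (C x))\<^sup>2 - 2 * N\<^sup>2 * (norm (C x))\<^sup>2 + N^4 * (norm x)\<^sup>2
        = N\<^sup>2 * (N\<^sup>2 * (norm x)\<^sup>2 - (norm (C x))\<^sup>2)"
      by (simp add: algebra_simps flip: power_add)
    finally have D: "(norm (D x))\<^sup>2 \<le> N\<^sup>2 * (N\<^sup>2 * (norm x)\<^sup>2 - (norm (C x))\<^sup>2)" by simp
    have "x = E (D x)"
      using E by (metis is_inverse_def blinfun_apply_blinfun_compose blinfun_apply_id_blinfun)
    then have "(norm x)\<^sup>2 \<le> (norm E)\<^sup>2 * (norm (D x))\<^sup>2"
      unfolding power_mult_distrib[symmetric] using norm_blinfun[of E "D x"] by (intro power_mono) auto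
    also have "\<dots> \<le> (norm E)\<^sup>2 * (N\<^sup>2 * (N\<^sup>2 * (norm x)\<^sup>2 - (norm (C x))\<^sup>2))"
      by (intro mult_left_mono D) auto
    also have "\<dots> \<le> k * (N\<^sup>2 * (norm x)\<^sup>2 - (norm (C x))\<^sup>2)"
    proof -
      have "(norm (C x))\<^sup>2 \<le> N\<^sup>2 * (norm x)\<^sup>2"
        unfolding power_mult_distrib[symmetric] N_def by (intro power_mono norm_blinfun) simp
      then show ?thesis by (simp add: k_def algebra_simps)
    qed
    finally have "(norm (C x))\<^sup>2 \<le> (N\<^sup>2 - 1 / k) * (norm x)\<^sup>2"
      using k by (simp add: field_simps)
    also have "\<dots> \<le> max 0 (N\<^sup>2 - 1 / k) * (norm x)\<^sup>2"
      by (intro mult_right_mono) auto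
    finally show ?thesis
      by (metis real_sqrt_le_iff real_sqrt_mult real_sqrt_abs abs_norm_cancel)
  qed
  have "N \<le> sqrt (max 0 (N\<^sup>2 - 1 / k))"
    unfolding N_def[of] by (rule norm_blinfun_bound) (use bound in \<open>auto simp: N_def\<close>)
  then have "N\<^sup>2 \<le> max 0 (N\<^sup>2 - 1 / k)"
    using N by (metis less_eq_real_def max.cobounded1 power_mono real_sqrt_pow2)
  then show False using N k by (auto simp: max_def split: if_splits)
qed

lemma spectrum_self_adjoint_real:
  fixes A :: "'a::chilbert_space op"
  assumes "A \<in> self_adjoint_ops" "z \<in> spectrum A"
  obtains s where "z = complex_of_real s" "\<bar>s\<bar> \<le> norm A"
  using spectrum_op_interval[OF self_adjoint_op_interval[OF assms(1)]] assms(2) by force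

text \<open>As C = p(A) is self-adjoint, its norm is up to sign a spectral value m of C, and the
  spectral mapping lemma finds a spectral point s of A with p(s) = m.\<close>

lemma norm_poly_op_le:
  fixes A :: "'a::chilbert_space op"
  assumes A: "A \<in> self_adjoint_ops" and "0 \<le> e"
    and p: "\<And>s. complex_of_real s \<in> spectrum A \<Longrightarrow> \<bar>poly p s\<bar> \<le> e"
  shows "norm (poly_op p A) \<le> e"
proof (rule ccontr)
  define C where "C = poly_op p A"
  assume "\<not> norm (poly_op p A) \<le> e"
  then have gt: "norm C > e" by (simp add: C_def)
  then have "C \<noteq> 0" using \<open>0 \<le> e\<close> by auto
  then obtain m where m: "complex_of_real m \<in> spectrum C" "\<bar>m\<bar> = norm C"
    using norm_mem_spectrum[of C] poly_op_self_adjoint[OF A] unfolding C_def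
    by (metis abs_minus abs_norm_cancel)
  define q where "q = map_poly complex_of_real (p - [:m:])"
  have "cpoly_op q A = C - scalar_op (complex_of_real m)"
    unfolding q_def cpoly_op_of_real by (simp add: poly_op_diff poly_op_const C_def scalar_op_of_real)
  then have no: "\<nexists>B. is_inverse (cpoly_op q A) B" using m(1) by (simp add: spectrum_def)
  \<comment> \<open>If p is the constant m, then q = 0 and every spectral point is a root, so one
    has to exist. It does because \<open>C \<noteq> 0\<close> excludes the zero space.\<close>
  have nonempty: "\<exists>z. z \<in> spectrum A"
  proof (cases "A = 0")
    case True
    have "\<exists>x. C x \<noteq> 0" using \<open>C \<noteq> 0\<close> by (auto intro!: blinfun_eqI)
    then have "\<exists>x::'a. x \<noteq> 0" by blast
    then have "id_blinfun \<noteq> (0 :: 'a op)" by (metis blinfun_apply_id_blinfun blinfun.zero_left)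
    then show ?thesis using True by (intro exI[of _ 0]) (auto simp: spectrum_def is_inverse_def)
  next
    case False
    then show ?thesis using norm_mem_spectrum[OF A] by blast
  qed
  have "\<exists>z. z \<in> spectrum A \<and> poly q z = 0"
  proof (cases "q = 0")
    case False
    then show ?thesis
      using ex_inverse_cpoly_op[OF self_adjoint_bounded[OF A] False] no by (auto simp: spectrum_def)
  qed (use nonempty in auto)
  then obtain z where z: "z \<in> spectrum A" "poly q z = 0" by blast
  then obtain s where s: "z = complex_of_real s" using spectrum_self_adjoint_real[OF A] by blast
  have "poly (map_poly complex_of_real r) (complex_of_real s) = complex_of_real (poly r s)" for r
    by (induction r) (simp_all add: map_poly_pCons)
  then have "poly q z = complex_of_real (poly p s - m)"
    unfolding q_def s by simp
  then have "poly p s = m" using z by simp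
  then show False using p[of s] z(1) s m(2) gt by simp
qed

subsection \<open>Continuous functions\<close>

text \<open>Uniqueness in the definite description of \<open>fun_op\<close>: two approximating
  sequences differ by polynomials that are small on the spectrum, hence by operators of small
  norm.\<close>

lemma fun_op_eqI:
  fixes A :: "'a::chilbert_space op"
  assumes A: "A \<in> self_adjoint_ops"
    and f: "uniform_limit {s. complex_of_real s \<in> spectrum A} (\<lambda>k. poly (p k)) f sequentially"
    and B: "(\<lambda>k. poly_op (p k) A) \<longlonglongrightarrow> B"
  shows "fun_op f A = B"
  unfolding fun_op_def
proof (rule the_equality)
  show "\<exists>p. uniform_limit {s. complex_of_real s \<in> spectrum A} (\<lambda>k. poly (p k)) f sequentially
      \<and> (\<lambda>k. poly_op (p k) A) \<longlonglongrightarrow> B"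
    using f B by blast
next
  fix B'
  assume "\<exists>p. uniform_limit {s. complex_of_real s \<in> spectrum A} (\<lambda>k. poly (p k)) f sequentially
      \<and> (\<lambda>k. poly_op (p k) A) \<longlonglongrightarrow> B'"
  then obtain q where q: "uniform_limit {s. complex_of_real s \<in> spectrum A} (\<lambda>k. poly (q k)) f sequentially"
    and B': "(\<lambda>k. poly_op (q k) A) \<longlonglongrightarrow> B'" by blast
  have "(\<lambda>k. poly_op (q k) A - poly_op (p k) A) \<longlonglongrightarrow> 0"
  proof (rule tendstoI)
    fix e :: real assume "e > 0"
    then have "\<forall>\<^sub>F k in sequentially. \<forall>s\<in>{s. complex_of_real s \<in> spectrum A}. dist (poly (p k) s) (f s) < e / 4"
      "\<forall>\<^sub>F k in sequentially. \<forall>s\<in>{s. complex_of_real s \<in> spectrum A}. dist (poly (q k) s) (f s) < e / 4"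
      using uniform_limitD[OF f, of "e / 4"] uniform_limitD[OF q, of "e / 4"] by auto
    then show "\<forall>\<^sub>F k in sequentially. dist (poly_op (q k) A - poly_op (p k) A) 0 < e"
    proof eventually_elim
      case (elim k)
      have "\<bar>poly (q k - p k) s\<bar> \<le> e / 2" if "complex_of_real s \<in> spectrum A" for s
      proof -
        have "dist (poly (p k) s) (f s) < e / 4" "dist (poly (q k) s) (f s) < e / 4"
          using elim that by auto
        then show ?thesis unfolding dist_real_def poly_diff abs_less_iff abs_le_iff by linarith
      qed
      then have "norm (poly_op (q k - p k) A) \<le> e / 2"
        using \<open>e > 0\<close> by (intro norm_poly_op_le[OF A]) auto
      then show ?case using \<open>e > 0\<close> by (simp add: poly_op_diff)
    qed
  qed
  moreover have "(\<lambda>k. poly_op (q k) A - poly_op (p k) A) \<longlonglongrightarrow> B' - B"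
    by (intro tendsto_diff B B')
  ultimately show "B' = B" using LIMSEQ_unique by fastforce
qed

lemma fun_op_interval_eqI:
  fixes A :: "'a::chilbert_space op"
  assumes A: "A \<in> op_interval a b"
    and f: "uniform_limit {a..b} (\<lambda>k. poly (p k)) f sequentially"
    and B: "(\<lambda>k. poly_op (p k) A) \<longlonglongrightarrow> B"
  shows "fun_op f A = B"
  using spectrum_op_interval[OF A]
  by (intro fun_op_eqI[OF op_interval_sa[OF A] uniform_limit_on_subset[OF f] B]) auto

lemma fun_op_poly:
  fixes A :: "'a::chilbert_space op"
  assumes A: "A \<in> self_adjoint_ops"
    and "\<And>s. complex_of_real s \<in> spectrum A \<Longrightarrow> f s = poly p s"
  shows "fun_op f A = poly_op p A"
proof (rule fun_op_eqI[OF A, where p = "\<lambda>_. p"])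
  show "uniform_limit {s. complex_of_real s \<in> spectrum A} (\<lambda>k. poly p) f sequentially"
    using assms(2) by (auto intro!: uniform_limitI)
qed simp

lemma norm_poly_op_interval_le:
  fixes A :: "'a::chilbert_space op"
  assumes A: "A \<in> op_interval a b" and "0 \<le> e" "\<And>s. s \<in> {a..b} \<Longrightarrow> \<bar>poly p s\<bar> \<le> e"
  shows "norm (poly_op p A) \<le> e"
  using spectrum_op_interval[OF A] assms
  by (intro norm_poly_op_le[OF op_interval_sa[OF A]]) (auto dest!: subsetD)

lemma Weierstrass_poly_LIMSEQ:
  fixes f :: "real \<Rightarrow> real"
  assumes "continuous_on {a..b} f"
  obtains p where "uniform_limit {a..b} (\<lambda>k. poly (p k)) f sequentially"
proof -
  have "\<exists>p. \<forall>x\<in>{a..b}. \<bar>f x - poly p x\<bar> < 1 / real (Suc k)" for k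
  proof -
    obtain g where g: "real_polynomial_function g" "\<And>x. x \<in> {a..b} \<Longrightarrow> \<bar>f x - g x\<bar> < 1 / real (Suc k)"
      using Stone_Weierstrass_real_polynomial_function[of "{a..b}" f "1 / real (Suc k)"] assms by auto
    then obtain c n where c: "g = (\<lambda>x. \<Sum>i\<le>n. c i * x ^ i)"
      using real_polynomial_function_iff_sum by blast
    have "g x = poly (\<Sum>i\<le>n. monom (c i) i) x" for x
      by (simp add: c poly_sum poly_monom)
    then show ?thesis using g(2) by metis
  qed
  then obtain p where p: "\<And>k x. x \<in> {a..b} \<Longrightarrow> \<bar>f x - poly (p k) x\<bar> < 1 / real (Suc k)" by metis
  show thesis
  proof (rule that[of p], rule uniform_limitI)
    fix e :: real assume "e > 0"
    then obtain K where K: "1 / real (Suc K) < e" by (metis nat_approx_posE)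
    show "\<forall>\<^sub>F k in sequentially. \<forall>x\<in>{a..b}. dist (poly (p k) x) (f x) < e"
    proof (rule eventually_sequentiallyI[of K], rule ballI)
      fix k x assume "K \<le> k" "x \<in> {a..b}"
      then have "dist (poly (p k) x) (f x) < 1 / real (Suc k)"
        using p by (simp add: dist_real_def abs_minus_commute)
      also have "\<dots> \<le> 1 / real (Suc K)" using \<open>K \<le> k\<close> by (simp add: field_simps)
      finally show "dist (poly (p k) x) (f x) < e" using K by simp
    qed
  qed
qed

text \<open>Existence for the definite description: uniformly convergent polynomials are uniformly
  Cauchy on the interval, and the norm bound transports this to the operators.\<close>

lemma fun_op_LIMSEQ:
  fixes A :: "'a::chilbert_space op"
  assumes A: "A \<in> op_interval a b"
    and f: "uniform_limit {a..b} (\<lambda>k. poly (p k)) f sequentially"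
  shows "(\<lambda>k. poly_op (p k) A) \<longlonglongrightarrow> fun_op f A"
proof -
  have "Cauchy (\<lambda>k. poly_op (p k) A)"
  proof (rule metric_CauchyI)
    fix e :: real assume "e > 0"
    then have "\<exists>K. \<forall>k\<ge>K. \<forall>s\<in>{a..b}. dist (poly (p k) s) (f s) < e / 4"
      using uniform_limitD[OF f, of "e / 4"] unfolding eventually_sequentially
      by (simp del: atLeastAtMost_iff)
    then obtain K where K: "\<And>k s. k \<ge> K \<Longrightarrow> s \<in> {a..b} \<Longrightarrow> dist (poly (p k) s) (f s) < e / 4"
      by blast
    have "dist (poly_op (p k) A) (poly_op (p l) A) < e" if kl: "k \<ge> K" "l \<ge> K" for k l
    proof -
      have "\<bar>poly (p k - p l) s\<bar> \<le> e / 2" if "s \<in> {a..b}" for s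
        using K[OF kl(1) that] K[OF kl(2) that]
        unfolding dist_real_def poly_diff abs_less_iff abs_le_iff by linarith
      then have "norm (poly_op (p k - p l) A) \<le> e / 2"
        using \<open>e > 0\<close> by (intro norm_poly_op_interval_le[OF A]) auto
      then show ?thesis using \<open>e > 0\<close> by (simp add: poly_op_diff dist_norm)
    qed
    then show "\<exists>M. \<forall>m\<ge>M. \<forall>n\<ge>M. dist (poly_op (p m) A) (poly_op (p n) A) < e" by blast
  qed
  then obtain B where B: "(\<lambda>k. poly_op (p k) A) \<longlonglongrightarrow> B"
    using Cauchy_convergent convergent_def by blast
  with fun_op_interval_eqI[OF A f] show ?thesis by simp
qed

section \<open>Rules of the calculus for functions continuous on an interval bounding the form of
  A\<close>

context
  fixes A :: "'a::chilbert_space op" and a b :: real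
  assumes A: "A \<in> op_interval a b"
begin

lemma fun_op_self_adjoint:
  assumes "continuous_on {a..b} f" shows "fun_op f A \<in> self_adjoint_ops"
proof -
  obtain p where p: "uniform_limit {a..b} (\<lambda>k. poly (p k)) f sequentially"
    using Weierstrass_poly_LIMSEQ assms by blast
  show ?thesis
    by (rule self_adjoint_LIMSEQ[OF fun_op_LIMSEQ[OF A p]]) (rule poly_op_self_adjoint[OF op_interval_sa[OF A]])
qed

lemma fun_op_cong_interval:
  assumes "continuous_on {a..b} f" "\<And>s. s \<in> {a..b} \<Longrightarrow> f s = g s"
  shows "fun_op f A = fun_op g A"
proof -
  obtain p where p: "uniform_limit {a..b} (\<lambda>k. poly (p k)) f sequentially"
    using Weierstrass_poly_LIMSEQ assms(1) by blast
  have "uniform_limit {a..b} (\<lambda>k. poly (p k)) g sequentially"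
    using assms(2) by (intro uniform_limitI) (auto dest: uniform_limitD[OF p])
  then show ?thesis using fun_op_LIMSEQ[OF A] p LIMSEQ_unique by blast
qed

lemma fun_op_const: "fun_op (\<lambda>_. c) A = c *\<^sub>R id_blinfun"
  using fun_op_poly[OF op_interval_sa[OF A], of "\<lambda>_. c" "[:c:]"] by (simp add: poly_op_const)

lemma fun_op_ident: "fun_op (\<lambda>s. s) A = A"
  using fun_op_poly[OF op_interval_sa[OF A], of "\<lambda>s. s" "[:0, 1:]"] by (simp add: poly_op_X)

lemma fun_op_add:
  assumes "continuous_on {a..b} f" "continuous_on {a..b} g"
  shows "fun_op (\<lambda>s. f s + g s) A = fun_op f A + fun_op g A"
proof -
  obtain p q where pq: "uniform_limit {a..b} (\<lambda>k. poly (p k)) f sequentially"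
      "uniform_limit {a..b} (\<lambda>k. poly (q k)) g sequentially"
    using Weierstrass_poly_LIMSEQ assms by metis
  have "(\<lambda>k. poly (p k + q k)) = (\<lambda>k s. poly (p k) s + poly (q k) s)"
    by (simp add: fun_eq_iff)
  then have "uniform_limit {a..b} (\<lambda>k. poly (p k + q k)) (\<lambda>s. f s + g s) sequentially"
    using uniform_limit_add[OF pq] by simp
  moreover have "(\<lambda>k. poly_op (p k + q k) A) \<longlonglongrightarrow> fun_op f A + fun_op g A"
    unfolding poly_op_add by (intro tendsto_add fun_op_LIMSEQ[OF A] pq)
  ultimately show ?thesis by (rule fun_op_interval_eqI[OF A])
qed

lemma fun_op_mult:
  assumes "continuous_on {a..b} f" "continuous_on {a..b} g"
  shows "fun_op (\<lambda>s. f s * g s) A = fun_op f A o\<^sub>L fun_op g A"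
proof -
  obtain p q where pq: "uniform_limit {a..b} (\<lambda>k. poly (p k)) f sequentially"
      "uniform_limit {a..b} (\<lambda>k. poly (q k)) g sequentially"
    using Weierstrass_poly_LIMSEQ assms by metis
  have "bounded (f ` {a..b})" "bounded (g ` {a..b})"
    using assms compact_continuous_image compact_imp_bounded by blast+
  moreover have "(\<lambda>k. poly (p k * q k)) = (\<lambda>k s. poly (p k) s * poly (q k) s)"
    by (simp add: fun_eq_iff)
  ultimately have "uniform_limit {a..b} (\<lambda>k. poly (p k * q k)) (\<lambda>s. f s * g s) sequentially"
    using uniform_lim_mult[OF pq] by simp
  moreover have "(\<lambda>k. poly_op (p k * q k) A) \<longlonglongrightarrow> (fun_op f A o\<^sub>L fun_op g A)"
    unfolding poly_op_mult
    by (intro bounded_bilinear.tendsto[OF bounded_bilinear_blinfun_compose] fun_op_LIMSEQ[OF A] pq)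
  ultimately show ?thesis by (rule fun_op_interval_eqI[OF A])
qed

lemma fun_op_scale:
  assumes "continuous_on {a..b} f"
  shows "fun_op (\<lambda>s. c * f s) A = c *\<^sub>R fun_op f A"
  using fun_op_mult[of "\<lambda>_. c" f] assms by (simp add: fun_op_const compose_simps)

lemma fun_op_diff:
  assumes "continuous_on {a..b} f" "continuous_on {a..b} g"
  shows "fun_op (\<lambda>s. f s - g s) A = fun_op f A - fun_op g A"
  using fun_op_add[of f "\<lambda>s. - 1 * g s"] fun_op_scale[OF assms(2), of "-1"] assms
  by (simp add: continuous_intros)

lemma norm_fun_op_le:
  assumes f: "continuous_on {a..b} f" and e: "0 \<le> e" "\<And>s. s \<in> {a..b} \<Longrightarrow> \<bar>f s\<bar> \<le> e"
  shows "norm (fun_op f A) \<le> e"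
proof -
  obtain p where p: "uniform_limit {a..b} (\<lambda>k. poly (p k)) f sequentially"
    using Weierstrass_poly_LIMSEQ f by blast
  show ?thesis
  proof (rule field_le_epsilon)
    fix d :: real assume "d > 0"
    show "norm (fun_op f A) \<le> e + d"
    proof (rule tendsto_upperbound[OF tendsto_norm[OF fun_op_LIMSEQ[OF A p]]])
      show "\<forall>\<^sub>F k in sequentially. norm (poly_op (p k) A) \<le> e + d"
        using uniform_limitD[OF p \<open>d > 0\<close>]
      proof eventually_elim
        case (elim k)
        show ?case
        proof (rule norm_poly_op_interval_le[OF A])
          fix s assume "s \<in> {a..b}"
          then show "\<bar>poly (p k) s\<bar> \<le> e + d"
            using elim e(2)[of s] by (force simp: dist_real_def)
        qed (use e \<open>d > 0\<close> in auto)
      qed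
    qed simp
  qed
qed

text \<open>Subtracting the midpoint of [c, d] turns the two-sided bound on f into a bound of the
  absolute value, to which the norm estimate applies.\<close>

lemma fun_op_interval:
  assumes f: "continuous_on {a..b} f" and cd: "\<And>s. s \<in> {a..b} \<Longrightarrow> c \<le> f s \<and> f s \<le> d"
  shows "fun_op f A \<in> op_interval c d"
proof (cases "a \<le> b")
  case True
  then have "c \<le> d" using cd[of a] by simp
  define g where "g s = f s - (c + d) / 2" for s
  have g: "fun_op g A = fun_op f A - ((c + d) / 2) *\<^sub>R id_blinfun"
    unfolding g_def using fun_op_diff[OF f, of "\<lambda>_. (c + d) / 2"] by (simp add: fun_op_const)
  have cg: "continuous_on {a..b} g" unfolding g_def by (intro continuous_intros f)
  have "norm (fun_op g A) \<le> (d - c) / 2"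
  proof (rule norm_fun_op_le[OF cg])
    fix s assume "s \<in> {a..b}"
    from cd[OF this] show "\<bar>g s\<bar> \<le> (d - c) / 2" unfolding g_def abs_le_iff by (simp add: field_simps)
  qed (use \<open>c \<le> d\<close> in auto)
  then have "fun_op g A \<in> op_interval (- ((d - c) / 2)) ((d - c) / 2)"
    by (intro op_interval_mono[OF self_adjoint_op_interval[OF fun_op_self_adjoint[OF cg]]]) auto
  then show ?thesis
    using fun_op_self_adjoint[OF f]
    by (simp add: g op_interval_def blinfun.bilinear_simps rinner.diff_right rinner_scaleR_right
        rinner_self field_simps)
next
  \<comment> \<open>For \<open>a > b\<close> the form bounds force the zero space; the hypothesis on
    f is then void and does not even give \<open>c \<le> d\<close>.\<close>
  case False
  have "x = 0" for x :: 'a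
  proof -
    have "(b - a) * (norm x)\<^sup>2 \<ge> 0"
      using op_interval_lower[OF A, of x] op_interval_upper[OF A, of x] by (simp add: left_diff_distrib)
    then show ?thesis using False by (simp add: zero_le_mult_iff)
  qed
  then show ?thesis
    using fun_op_self_adjoint[OF f] by (simp add: op_interval_def) (metis norm_zero power_zero_numeral mult_zero_right order_refl rinner.zero_right)
qed

lemma fun_op_mono:
  assumes "continuous_on {a..b} f" "continuous_on {a..b} g" "\<And>s. s \<in> {a..b} \<Longrightarrow> f s \<le> g s"
  shows "fun_op f A \<preceq> fun_op g A"
proof -
  have c: "continuous_on {a..b} (\<lambda>s. g s - f s)" by (intro continuous_intros assms)
  then have "bounded ((\<lambda>s. g s - f s) ` {a..b})"
    using compact_continuous_image compact_imp_bounded by blast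
  then obtain d where bd: "\<forall>y \<in> (\<lambda>s. g s - f s) ` {a..b}. norm y \<le> d"
    unfolding bounded_iff by blast
  then have d: "g s - f s \<le> d" if "s \<in> {a..b}" for s
    using bd[rule_format, OF imageI[OF that]] by (auto simp: abs_le_iff)
  have "fun_op (\<lambda>s. g s - f s) A \<in> op_interval 0 d"
    using assms(3) d by (intro fun_op_interval[OF c]) auto
  then show ?thesis
    using op_interval_lower[of "fun_op g A - fun_op f A" 0 d] op_interval_sa
    unfolding fun_op_diff[OF assms(2,1)] op_le_def pos_semidef_iff by fastforce
qed

lemma tendsto_fun_op:
  assumes g: "uniform_limit {a..b} g f sequentially"
    and c: "continuous_on {a..b} f" "\<And>k. continuous_on {a..b} (g k)"
  shows "(\<lambda>k. fun_op (g k) A) \<longlonglongrightarrow> fun_op f A"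
proof (rule tendstoI)
  fix e :: real assume e: "e > 0"
  then have "\<forall>\<^sub>F k in sequentially. \<forall>s\<in>{a..b}. dist (g k s) (f s) < e / 2"
    using uniform_limitD[OF g, of "e / 2"] by simp
  then show "\<forall>\<^sub>F k in sequentially. dist (fun_op (g k) A) (fun_op f A) < e"
  proof eventually_elim
    case (elim k)
    have "norm (fun_op (\<lambda>s. g k s - f s) A) \<le> e / 2"
      using elim e by (intro norm_fun_op_le) (auto intro!: continuous_intros c simp: dist_real_def less_imp_le)
    then show ?case using e by (simp add: fun_op_diff c dist_norm)
  qed
qed

lemma fun_op_poly_comp:
  assumes "continuous_on {a..b} g"
  shows "poly_op p (fun_op g A) = fun_op (\<lambda>s. poly p (g s)) A"
proof (induction p)
  case 0
  then show ?case using fun_op_const[of 0] by simp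
next
  case (pCons c p)
  have c: "continuous_on {a..b} (\<lambda>s. poly p (g s))" for p
    by (intro continuous_intros assms)
  show ?case
    using fun_op_add[of "\<lambda>_. c" "\<lambda>s. g s * poly p (g s)"] fun_op_mult[of g "\<lambda>s. poly p (g s)"]
    by (simp add: poly_op_pCons pCons.IH fun_op_const assms c continuous_intros)
qed

lemma fun_op_comp:
  assumes g: "continuous_on {a..b} g" "\<And>s. s \<in> {a..b} \<Longrightarrow> g s \<in> {c..d}"
    and f: "continuous_on {c..d} f"
  shows "fun_op f (fun_op g A) = fun_op (\<lambda>s. f (g s)) A"
proof -
  obtain p where p: "uniform_limit {c..d} (\<lambda>k. poly (p k)) f sequentially"
    using Weierstrass_poly_LIMSEQ f by blast
  have gi: "fun_op g A \<in> op_interval c d"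
    using g(2) by (intro fun_op_interval[OF g(1)]) auto
  have "uniform_limit {a..b} (\<lambda>k s. poly (p k) (g s)) (\<lambda>s. f (g s)) sequentially"
    using uniform_limit_compose'[OF p, of g "{a..b}"] g(2) by (auto simp: Pi_iff)
  moreover have "continuous_on {a..b} (\<lambda>s. f (g s))"
    using continuous_on_compose2[OF f g(1)] g(2) by blast
  ultimately have "(\<lambda>k. fun_op (\<lambda>s. poly (p k) (g s)) A) \<longlonglongrightarrow> fun_op (\<lambda>s. f (g s)) A"
    by (intro tendsto_fun_op) (auto intro!: continuous_intros g)
  then show ?thesis
    using fun_op_LIMSEQ[OF gi p] LIMSEQ_unique by (simp add: fun_op_poly_comp[OF g(1)])
qed

lemma fun_op_commute:
  assumes "continuous_on {a..b} f" "continuous_on {a..b} g"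
  shows "fun_op f A o\<^sub>L fun_op g A = fun_op g A o\<^sub>L fun_op f A"
  using fun_op_mult[OF assms] fun_op_mult[OF assms(2,1)] by (simp add: mult.commute)

end

section \<open>Geometric means\<close>

lemma pos_defI: "A \<in> op_interval a b \<Longrightarrow> 0 < a \<Longrightarrow> A \<in> pos_def_ops"
  for A :: "'a::chilbert_space op"
  using op_interval_mono[of A a b a "max a b"] unfolding pos_def_ops_iff
  by (intro exI[of _ a] exI[of _ "max a b"]) auto

lemma pos_defE:
  fixes A :: "'a::chilbert_space op"
  assumes "A \<in> pos_def_ops"
  obtains a b where "0 < a" "a \<le> b" "A \<in> op_interval a b"
  using assms by (auto simp: pos_def_ops_iff)

lemma pos_def_sa: "A \<in> pos_def_ops \<Longrightarrow> A \<in> self_adjoint_ops"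
  by (simp add: pos_def_ops_def pos_semidef_def)

lemma pos_def_add:
  fixes A :: "'a::chilbert_space op"
  assumes "A \<in> pos_def_ops" "B \<in> pos_def_ops" shows "A + B \<in> pos_def_ops"
proof -
  obtain a b where A: "0 < a" "A \<in> op_interval a b" using assms(1) by (rule pos_defE)
  obtain c d where B: "0 < c" "B \<in> op_interval c d" using assms(2) by (rule pos_defE)
  have "A + B \<in> op_interval (a + c) (b + d)"
    using A B by (auto simp: op_interval_iff scaleR_add_left intro: op_le_add)
  then show ?thesis using A B by (intro pos_defI[of _ "a + c"]) auto
qed

lemma pos_def_scaleR:
  fixes A :: "'a::chilbert_space op"
  assumes "A \<in> pos_def_ops" "0 < r" shows "r *\<^sub>R A \<in> pos_def_ops"
  using assms(1)
proof (rule pos_defE)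
  fix a b assume "0 < a" "A \<in> op_interval a b"
  then show ?thesis using assms(2) op_interval_scaleR[of A a b r] by (intro pos_defI[of _ "r * a"]) auto
qed

lemma continuous_on_powr_pos: "0 < a \<Longrightarrow> continuous_on {a..b} (\<lambda>s. s powr r)" for a b r :: real
  by (intro continuous_intros) auto

lemma continuous_on_powr_Ioi: "continuous_on {0<..} (\<lambda>s. s powr r)" for r :: real
  by (intro continuous_intros) auto

lemma fun_op_pos_def:
  fixes A :: "'a::chilbert_space op"
  assumes "A \<in> pos_def_ops" "continuous_on {0<..} f" "\<And>s. 0 < s \<Longrightarrow> 0 < f s"
  shows "fun_op f A \<in> pos_def_ops"
proof -
  obtain a b where A: "0 < a" "a \<le> b" "A \<in> op_interval a b" using assms(1) by (rule pos_defE)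
  have c: "continuous_on {a..b} f" using assms(2) by (rule continuous_on_subset) (use A in auto)
  obtain x where x: "x \<in> {a..b}" "\<And>s. s \<in> {a..b} \<Longrightarrow> f x \<le> f s"
    using continuous_attains_inf[OF _ _ c] A by auto
  obtain y where y: "y \<in> {a..b}" "\<And>s. s \<in> {a..b} \<Longrightarrow> f s \<le> f y"
    using continuous_attains_sup[OF _ _ c] A by auto
  have "fun_op f A \<in> op_interval (f x) (f y)"
    using x y by (intro fun_op_interval[OF A(3) c]) auto
  then show ?thesis using x assms(3)[of x] A by (intro pos_defI) auto
qed

lemma fun_op_cong_pos:
  fixes A :: "'a::chilbert_space op"
  assumes "A \<in> pos_def_ops" "continuous_on {0<..} f" "\<And>s. 0 < s \<Longrightarrow> f s = g s"
  shows "fun_op f A = fun_op g A"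
proof -
  obtain a b where A: "0 < a" "a \<le> b" "A \<in> op_interval a b" using assms(1) by (rule pos_defE)
  show ?thesis
    by (rule fun_op_cong_interval[OF A(3) continuous_on_subset[OF assms(2)]]) (use A assms in auto)
qed

subsection \<open>Inverses\<close>

lemma is_inverse_self_adjoint:
  assumes "is_inverse A B" "A \<in> self_adjoint_ops" shows "B \<in> self_adjoint_ops"
proof (rule self_adjointI)
  show "B \<in> bounded_ops" using assms by (simp add: is_inverse_def)
  have AB: "A (B x) = x" for x
    using assms by (metis is_inverse_def blinfun_apply_blinfun_compose blinfun_apply_id_blinfun)
  show "rinner (B x) y = rinner x (B y)" for x y
    by (metis AB self_adjoint_rinner[OF assms(2)])
qed

lemma is_inverse_sym: "is_inverse A B \<Longrightarrow> A \<in> bounded_ops \<Longrightarrow> is_inverse B A"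
  by (simp add: is_inverse_def)

text \<open>Variational argument at one vector: with y = Q' x and p = P' x, positivity of P at y - p
  gives 2 <y,x> - <y,P y> <= <p,x>, and P <= Q bounds <y,P y> by <y,x>. No square roots are
  involved.\<close>

lemma is_inverse_antimono:
  fixes P Q :: "'a::chilbert_space op"
  assumes P: "P \<in> pos_def_ops" and "P \<preceq> Q" "Q \<in> self_adjoint_ops"
    and inv: "is_inverse P P'" "is_inverse Q Q'"
  shows "Q' \<preceq> P'"
proof (rule op_leI)
  show "Q' \<in> self_adjoint_ops" "P' \<in> self_adjoint_ops"
    using is_inverse_self_adjoint inv pos_def_sa[OF P] assms(3) by blast+
  fix x
  define y p where "y = Q' x" and "p = P' x"
  have x: "x = Q y" "x = P p"
    using inv unfolding y_def p_def
    by (metis is_inverse_def blinfun_apply_blinfun_compose blinfun_apply_id_blinfun)+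
  have "0 \<le> rinner (y - p) (P (y - p))"
    using P by (simp add: pos_def_ops_def pos_semidef_iff)
  also have "\<dots> = rinner y (P y) - 2 * rinner y (P p) + rinner p (P p)"
    using self_adjoint_rinner[OF pos_def_sa[OF P], of y p] rinner_commute[of "P y" p]
    by (simp add: blinfun.bilinear_simps rinner.diff_left rinner.diff_right)
  finally have "2 * rinner y x - rinner y (P y) \<le> rinner p x" by (simp flip: x)
  moreover have "rinner y (P y) \<le> rinner y x"
    unfolding x(1) by (rule op_leD[OF assms(2)])
  ultimately show "rinner x (Q' x) \<le> rinner x (P' x)"
    using rinner_commute[of x y] rinner_commute[of x p] by (simp flip: y_def p_def)
qed

lemma is_inverse_fun_op:
  fixes A :: "'a::chilbert_space op"
  assumes A: "A \<in> op_interval a b"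
    and "continuous_on {a..b} f" "continuous_on {a..b} g" "\<And>s. s \<in> {a..b} \<Longrightarrow> f s * g s = 1"
  shows "is_inverse (fun_op f A) (fun_op g A)"
proof -
  have "fun_op (\<lambda>s. f s * g s) A = id_blinfun"
    using fun_op_cong_interval[OF A, of "\<lambda>s. f s * g s" "\<lambda>_. 1"] assms fun_op_const[OF A, of 1]
    by (simp add: continuous_on_mult)
  then show ?thesis
    using fun_op_mult[OF A assms(2,3)] fun_op_commute[OF A assms(2,3)]
      self_adjoint_bounded[OF fun_op_self_adjoint[OF A assms(3)]]
    by (simp add: is_inverse_def)
qed

lemma inv_op_eq_fun_op:
  fixes A :: "'a::chilbert_space op"
  assumes A: "A \<in> op_interval a b" and "0 < a"
  shows "is_inverse A (fun_op inverse A)" "inv_op A = fun_op inverse A"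
proof -
  have "is_inverse (fun_op (\<lambda>s. s) A) (fun_op inverse A)"
    using \<open>0 < a\<close> by (intro is_inverse_fun_op[OF A] continuous_intros) auto
  then show "is_inverse A (fun_op inverse A)" by (simp add: fun_op_ident[OF A])
  then show "inv_op A = fun_op inverse A" by (rule inv_op_eq)
qed

lemma inv_op_interval:
  fixes A :: "'a::chilbert_space op"
  assumes A: "A \<in> op_interval a b" and "0 < a" 
  shows "inv_op A \<in> op_interval (inverse b) (inverse a)"
  unfolding inv_op_eq_fun_op[OF assms]
  using \<open>0 < a\<close> by (intro fun_op_interval[OF A] continuous_intros) auto

subsection \<open>Square roots and perspectives\<close>

definition sqrt_op :: "'a::complex_inner op \<Rightarrow> 'a op" where
  "sqrt_op X = fun_op (\<lambda>s. s powr (1/2)) X"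

definition isqrt_op :: "'a::complex_inner op \<Rightarrow> 'a op" where
  "isqrt_op X = fun_op (\<lambda>s. s powr (-1/2)) X"

definition normalized :: "'a::complex_inner op \<Rightarrow> 'a op \<Rightarrow> 'a op" where
  "normalized X A = isqrt_op X o\<^sub>L A o\<^sub>L isqrt_op X"

definition persp :: "(real \<Rightarrow> real) \<Rightarrow> 'a::complex_inner op \<Rightarrow> 'a op \<Rightarrow> 'a op" where
  "persp f X A = sqrt_op X o\<^sub>L fun_op f (normalized X A) o\<^sub>L sqrt_op X"

lemma geo_mean_eq_persp: "geo_mean t X A = persp (\<lambda>s. s powr t) X A"
  by (simp add: geo_mean_def persp_def normalized_def sqrt_op_def isqrt_op_def Let_def)

lemma sqrt_op_props:
  fixes X :: "'a::chilbert_space op"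
  assumes "X \<in> pos_def_ops"
  shows sqrt_op_sa: "sqrt_op X \<in> self_adjoint_ops"
    and isqrt_op_sa: "isqrt_op X \<in> self_adjoint_ops"
    and sqrt_op_inverse: "is_inverse (sqrt_op X) (isqrt_op X)"
    and sqrt_op_square: "sqrt_op X o\<^sub>L sqrt_op X = X"
    and isqrt_op_square: "isqrt_op X o\<^sub>L isqrt_op X = inv_op X"
proof -
  obtain a b where X: "0 < a" "X \<in> op_interval a b" using assms by (rule pos_defE)
  note c = continuous_on_powr_pos[OF X(1)]
  show "sqrt_op X \<in> self_adjoint_ops" "isqrt_op X \<in> self_adjoint_ops"
    unfolding sqrt_op_def isqrt_op_def by (intro fun_op_self_adjoint[OF X(2)] c)+
  show "is_inverse (sqrt_op X) (isqrt_op X)"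
    unfolding sqrt_op_def isqrt_op_def
    using X(1) by (intro is_inverse_fun_op[OF X(2)] c; simp flip: powr_add)
  have "sqrt_op X o\<^sub>L sqrt_op X = fun_op (\<lambda>s. s powr (1/2) * s powr (1/2)) X"
    unfolding sqrt_op_def by (rule fun_op_mult[OF X(2) c c, symmetric])
  also have "\<dots> = fun_op (\<lambda>s. s) X"
    using X(1) by (intro fun_op_cong_interval[OF X(2)] continuous_intros) (auto simp flip: powr_add)
  finally show "sqrt_op X o\<^sub>L sqrt_op X = X" by (simp add: fun_op_ident[OF X(2)])
  have "isqrt_op X o\<^sub>L isqrt_op X = fun_op (\<lambda>s. s powr (-1/2) * s powr (-1/2)) X"
    unfolding isqrt_op_def by (rule fun_op_mult[OF X(2) c c, symmetric])
  also have "\<dots> = fun_op inverse X"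
    using X(1) by (intro fun_op_cong_interval[OF X(2)] continuous_intros)
      (auto simp: powr_minus_divide inverse_eq_divide simp flip: powr_add)
  finally show "isqrt_op X o\<^sub>L isqrt_op X = inv_op X"
    by (simp add: inv_op_eq_fun_op[OF X(2,1)])
qed

lemma sqrt_op_cancel:
  fixes X :: "'a::chilbert_space op"
  assumes "X \<in> pos_def_ops"
  shows "sqrt_op X o\<^sub>L isqrt_op X = id_blinfun" "isqrt_op X o\<^sub>L sqrt_op X = id_blinfun"
    and sqrt_normalized: "sqrt_op X o\<^sub>L normalized X A o\<^sub>L sqrt_op X = A"
    and isqrt_sandwich: "isqrt_op X o\<^sub>L (sqrt_op X o\<^sub>L A o\<^sub>L sqrt_op X) o\<^sub>L isqrt_op X = A"
    and normalized_self: "normalized X X = id_blinfun"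
proof -
  show 1: "sqrt_op X o\<^sub>L isqrt_op X = id_blinfun" and 2: "isqrt_op X o\<^sub>L sqrt_op X = id_blinfun"
    using sqrt_op_inverse[OF assms] by (auto simp: is_inverse_def)
  show n: "sqrt_op X o\<^sub>L normalized X A o\<^sub>L sqrt_op X = A"
    "isqrt_op X o\<^sub>L (sqrt_op X o\<^sub>L A o\<^sub>L sqrt_op X) o\<^sub>L isqrt_op X = A" for A
    using 1 2 unfolding normalized_def by (metis compose_assoc compose_id_left compose_id_right)+
  show "normalized X X = id_blinfun"
    using n(2)[of id_blinfun] by (simp add: sqrt_op_square[OF assms] normalized_def)
qed

lemma sandwich_op_interval:
  assumes "A \<in> op_interval c d" "S \<in> self_adjoint_ops" "S o\<^sub>L S \<in> op_interval a b" "0 \<le> c" "0 \<le> d"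
  shows "S o\<^sub>L A o\<^sub>L S \<in> op_interval (c * a) (d * b)"
proof -
  have "S o\<^sub>L (c *\<^sub>R id_blinfun) o\<^sub>L S \<preceq> S o\<^sub>L A o\<^sub>L S" "S o\<^sub>L A o\<^sub>L S \<preceq> S o\<^sub>L (d *\<^sub>R id_blinfun) o\<^sub>L S"
    using assms(1) by (auto simp: op_interval_iff intro: op_le_sandwich assms(2))
  moreover have "S o\<^sub>L (r *\<^sub>R id_blinfun) o\<^sub>L S = r *\<^sub>R (S o\<^sub>L S)" for r
    by (simp add: compose_simps)
  moreover have "(c * a) *\<^sub>R id_blinfun \<preceq> c *\<^sub>R (S o\<^sub>L S)" "d *\<^sub>R (S o\<^sub>L S) \<preceq> (d * b) *\<^sub>R id_blinfun"
    using op_interval_scaleR[OF assms(3,4)] op_interval_scaleR[OF assms(3,5)]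
    by (simp_all add: op_interval_iff)
  ultimately show ?thesis by (auto simp: op_interval_iff intro: op_le_trans)
qed

lemma normalized_op_interval:
  fixes X :: "'a::chilbert_space op"
  assumes X: "X \<in> op_interval a b" "0 < a" and A: "A \<in> op_interval c d" "0 \<le> c" "0 \<le> d"
  shows "normalized X A \<in> op_interval (c / b) (d / a)"
proof -
  have pd: "X \<in> pos_def_ops" using X by (rule pos_defI)
  have "isqrt_op X o\<^sub>L isqrt_op X \<in> op_interval (inverse b) (inverse a)"
    unfolding isqrt_op_square[OF pd] by (rule inv_op_interval[OF X])
  from sandwich_op_interval[OF A(1) isqrt_op_sa[OF pd] this A(2,3)]
  show ?thesis by (simp add: normalized_def divide_inverse)
qed

lemma normalized_pos_def:
  fixes X :: "'a::chilbert_space op"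
  assumes "X \<in> pos_def_ops" "A \<in> pos_def_ops"
  shows "normalized X A \<in> pos_def_ops"
proof -
  obtain a b where X: "0 < a" "a \<le> b" "X \<in> op_interval a b" using assms(1) by (rule pos_defE)
  obtain c d where A: "0 < c" "c \<le> d" "A \<in> op_interval c d" using assms(2) by (rule pos_defE)
  show ?thesis
    by (rule pos_defI[OF normalized_op_interval[OF X(3,1) A(3)]]) (use A X in auto)
qed

lemma sqrt_sandwich_pos_def:
  fixes X :: "'a::chilbert_space op"
  assumes "X \<in> pos_def_ops" "A \<in> pos_def_ops"
  shows "sqrt_op X o\<^sub>L A o\<^sub>L sqrt_op X \<in> pos_def_ops"
proof -
  obtain a b where X: "0 < a" "X \<in> op_interval a b" using assms(1) by (rule pos_defE)
  obtain c d where A: "0 < c" "c \<le> d" "A \<in> op_interval c d" using assms(2) by (rule pos_defE)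
  show ?thesis
    by (rule pos_defI[OF sandwich_op_interval[OF A(3) sqrt_op_sa[OF assms(1)]]])
      (use A X in \<open>auto simp: sqrt_op_square[OF assms(1)]\<close>)
qed

lemma persp_pos_def:
  fixes X :: "'a::chilbert_space op"
  assumes "X \<in> pos_def_ops" "A \<in> pos_def_ops" "continuous_on {0<..} f" "\<And>s. 0 < s \<Longrightarrow> 0 < f s"
  shows "persp f X A \<in> pos_def_ops"
  unfolding persp_def
  by (intro sqrt_sandwich_pos_def fun_op_pos_def normalized_pos_def assms)

subsection \<open>Monotone perspectives\<close>

text \<open>The functions for which the perspective is monotone in its first argument contain \<open>1\<close> and the
  identity and are closed under arithmetic and harmonic means and locally uniform limits, hence
  under geometric means by the arithmetic-harmonic iteration; so they contain \<open>s\<^sup>t\<close> for dyadic and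
  then for all \<open>t \<in> [0,1]\<close>.\<close>

definition mono_persp :: "'a::chilbert_space itself \<Rightarrow> (real \<Rightarrow> real) \<Rightarrow> bool" where
  "mono_persp _ f \<longleftrightarrow> continuous_on {0<..} f \<and> (\<forall>s>0. 0 < f s) \<and>
     (\<forall>X\<in>pos_def_ops. \<forall>Y\<in>pos_def_ops. \<forall>A\<in>(pos_def_ops :: 'a op set).
        X \<preceq> Y \<longrightarrow> persp f X A \<preceq> persp f Y A)"

lemma mono_perspD:
  fixes X :: "'a::chilbert_space op"
  assumes "mono_persp TYPE('a) f"
  shows "continuous_on {0<..} f" "0 < s \<Longrightarrow> 0 < f s"
    "X \<in> pos_def_ops \<Longrightarrow> Y \<in> pos_def_ops \<Longrightarrow> A \<in> pos_def_ops \<Longrightarrow> X \<preceq> Y \<Longrightarrow> persp f X A \<preceq> persp f Y A"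
  using assms by (auto simp: mono_persp_def)

lemma mono_persp_cong:
  assumes f: "mono_persp TYPE('a::chilbert_space) f" and eq: "\<And>s. 0 < s \<Longrightarrow> f s = g s"
  shows "mono_persp TYPE('a) g"
proof -
  have "persp f X A = persp g X A" if X: "X \<in> pos_def_ops" and A: "A \<in> pos_def_ops" for X A :: "'a op"
    unfolding persp_def
    using fun_op_cong_pos[OF normalized_pos_def[OF X A] mono_perspD(1)[OF f] eq] by simp
  moreover have "continuous_on {0<..} g"
    using mono_perspD(1)[OF f] by (rule continuous_on_eq) (use eq in auto)
  ultimately show ?thesis using f eq unfolding mono_persp_def by metis
qed

lemma mono_persp_1: "mono_persp TYPE('a::chilbert_space) (\<lambda>_. 1)"
proof -
  have "persp (\<lambda>_. 1) X A = X" if X: "X \<in> pos_def_ops" and A: "A \<in> pos_def_ops" for X A :: "'a op"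
    using pos_defE[OF normalized_pos_def[OF X A]] fun_op_const[of "normalized X A" _ _ 1] sqrt_op_square[OF X]
    unfolding persp_def by (metis compose_id_right scaleR_one)
  then show ?thesis by (simp add: mono_persp_def)
qed

lemma mono_persp_ident: "mono_persp TYPE('a::chilbert_space) (\<lambda>s. s)"
proof -
  have "persp (\<lambda>s. s) X A = A" if X: "X \<in> pos_def_ops" and A: "A \<in> pos_def_ops" for X A :: "'a op"
    using pos_defE[OF normalized_pos_def[OF X A]] fun_op_ident[of "normalized X A"] sqrt_normalized[OF X]
    unfolding persp_def by metis
  then show ?thesis by (simp add: mono_persp_def)
qed

lemma mono_persp_arith:
  assumes f: "mono_persp TYPE('a::chilbert_space) f" and g: "mono_persp TYPE('a) g"
  shows "mono_persp TYPE('a) (\<lambda>s. (f s + g s) / 2)"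
proof -
  have eq: "persp (\<lambda>s. (f s + g s) / 2) X A = (1/2) *\<^sub>R (persp f X A + persp g X A)"
    if X: "X \<in> pos_def_ops" and A: "A \<in> pos_def_ops" for X A :: "'a op"
  proof -
    obtain a b where N: "0 < a" "normalized X A \<in> op_interval a b"
      using pos_defE[OF normalized_pos_def[OF X A]] by metis
    have c: "continuous_on {a..b} f" "continuous_on {a..b} g"
      using mono_perspD(1)[OF f] mono_perspD(1)[OF g] N by (auto elim!: continuous_on_subset)
    have "fun_op (\<lambda>s. (1/2) * (f s + g s)) (normalized X A)
        = (1/2) *\<^sub>R (fun_op f (normalized X A) + fun_op g (normalized X A))"
      by (simp only: fun_op_scale[OF N(2)] fun_op_add[OF N(2)] c continuous_on_add)
    then show ?thesis by (simp add: persp_def compose_simps)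
  qed
  have "continuous_on {0<..} (\<lambda>s. (f s + g s) / 2)"
    by (intro continuous_intros mono_perspD(1)[OF f] mono_perspD(1)[OF g]) auto
  then show ?thesis
    using mono_perspD(2)[OF f] mono_perspD(2)[OF g] mono_perspD(3)[OF f] mono_perspD(3)[OF g]
    by (auto simp: mono_persp_def eq add_pos_pos intro!: op_le_scaleR op_le_add)
qed

lemma is_inverse_persp:
  fixes X :: "'a::chilbert_space op"
  assumes "X \<in> pos_def_ops" "A \<in> pos_def_ops" "continuous_on {0<..} f" "\<And>s. 0 < s \<Longrightarrow> 0 < f s"
  shows "is_inverse (persp f X A)
    (isqrt_op X o\<^sub>L fun_op (\<lambda>s. inverse (f s)) (normalized X A) o\<^sub>L isqrt_op X)"
proof -
  obtain a b where N: "0 < a" "normalized X A \<in> op_interval a b"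
    using pos_defE[OF normalized_pos_def[OF assms(1,2)]] by metis
  have c: "continuous_on {a..b} f" "f s \<noteq> 0" if "s \<in> {a..b}" for s
    using assms(3) N assms(4)[of s] that by (auto elim!: continuous_on_subset)
  have "continuous_on {a..b} f" using assms(3) by (rule continuous_on_subset) (use N in auto)
  moreover have "continuous_on {a..b} (\<lambda>s. inverse (f s))"
    by (intro continuous_intros calculation) (use c in blast)
  ultimately have "is_inverse (fun_op f (normalized X A)) (fun_op (\<lambda>s. inverse (f s)) (normalized X A))"
    using c by (intro is_inverse_fun_op[OF N(2)]) auto
  from is_inverse_compose[OF is_inverse_compose[OF sqrt_op_inverse[OF assms(1)] this] sqrt_op_inverse[OF assms(1)]]
  show ?thesis by (simp add: persp_def compose_assoc)
qed

text \<open>The inverse of a perspective is an explicit sandwich \<open>J\<close>, linear in 1/f, so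
  the inverse for the harmonic mean is the average of the inverses for f and g. Inversion reverses
  the order twice.\<close>

lemma mono_persp_harm:
  assumes f: "mono_persp TYPE('a::chilbert_space) f" and g: "mono_persp TYPE('a) g"
  shows "mono_persp TYPE('a) (\<lambda>s. 2 / (1 / f s + 1 / g s))"
proof -
  define h where "h s = 2 / (1 / f s + 1 / g s)" for s
  note fp = mono_perspD(2)[OF f] and gp = mono_perspD(2)[OF g]
  have hp: "0 < h s" if "0 < s" for s
    using fp[OF that] gp[OF that] by (simp add: h_def add_pos_pos)
  have hc: "continuous_on {0<..} h"
    unfolding h_def
  proof (intro continuous_intros mono_perspD(1)[OF f] mono_perspD(1)[OF g] ballI)
    fix s :: real assume "s \<in> {0<..}"
    then have "0 < f s" "0 < g s" using fp gp by auto
    then show "f s \<noteq> 0" "g s \<noteq> 0" "1 / f s + 1 / g s \<noteq> 0"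
      using add_pos_pos[of "1 / f s" "1 / g s"] by auto
  qed
  define J where "J k X A = isqrt_op X o\<^sub>L fun_op (\<lambda>s. inverse (k s)) (normalized X A) o\<^sub>L isqrt_op X"
    for k and X A :: "'a op"
  have J: "is_inverse (persp k X A) (J k X A)" "persp k X A \<in> pos_def_ops" "J k X A \<in> pos_def_ops"
    if "X \<in> pos_def_ops" "A \<in> pos_def_ops" "continuous_on {0<..} k" "\<And>s. 0 < s \<Longrightarrow> 0 < k s" for k X A
  proof -
    show 1: "is_inverse (persp k X A) (J k X A)" unfolding J_def by (rule is_inverse_persp[OF that])
    show 2: "persp k X A \<in> pos_def_ops" by (rule persp_pos_def[OF that])
    obtain a b where N: "0 < a" "persp k X A \<in> op_interval a b" "a \<le> b"
      using pos_defE[OF 2] by metis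
    have "J k X A = inv_op (persp k X A)" by (rule inv_op_eq[OF 1, symmetric])
    then show "J k X A \<in> pos_def_ops"
      using inv_op_interval[OF N(2,1)] N by (auto intro!: pos_defI)
  qed
  have Jh: "J h X A = (1/2) *\<^sub>R (J f X A + J g X A)"
    if X: "X \<in> pos_def_ops" and A: "A \<in> pos_def_ops" for X A :: "'a op"
  proof -
    obtain a b where N: "0 < a" "normalized X A \<in> op_interval a b"
      using pos_defE[OF normalized_pos_def[OF X A]] by metis
    have c: "continuous_on {a..b} (\<lambda>s. inverse (f s))" "continuous_on {a..b} (\<lambda>s. inverse (g s))"
    proof -
      have "f s \<noteq> 0" "g s \<noteq> 0" if "s \<in> {a..b}" for s
        using fp[of s] gp[of s] that N(1) by auto
      moreover have "continuous_on {a..b} f"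
        by (rule continuous_on_subset[OF mono_perspD(1)[OF f]]) (use N in auto)
      moreover have "continuous_on {a..b} g"
        by (rule continuous_on_subset[OF mono_perspD(1)[OF g]]) (use N in auto)
      ultimately show "continuous_on {a..b} (\<lambda>s. inverse (f s))" "continuous_on {a..b} (\<lambda>s. inverse (g s))"
        by (simp_all add: continuous_on_inverse)
    qed
    have "fun_op (\<lambda>s. inverse (h s)) (normalized X A)
        = fun_op (\<lambda>s. (1/2) * (inverse (f s) + inverse (g s))) (normalized X A)"
      by (simp add: h_def inverse_eq_divide)
    also have "\<dots> = (1/2) *\<^sub>R (fun_op (\<lambda>s. inverse (f s)) (normalized X A)
        + fun_op (\<lambda>s. inverse (g s)) (normalized X A))"
      by (simp only: fun_op_scale[OF N(2)] fun_op_add[OF N(2)] c continuous_on_add)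
    finally show ?thesis by (simp add: J_def compose_simps)
  qed
  have "persp h X A \<preceq> persp h Y A"
    if X: "X \<in> pos_def_ops" and Y: "Y \<in> pos_def_ops" and A: "A \<in> pos_def_ops" and "X \<preceq> Y"
    for X Y A :: "'a op"
  proof -
    have "J k Y A \<preceq> J k X A" if k: "mono_persp TYPE('a) k" for k
      by (rule is_inverse_antimono[OF J(2)[OF X A mono_perspD(1,2)[OF k]] mono_perspD(3)[OF k X Y A \<open>X \<preceq> Y\<close>]
          pos_def_sa[OF J(2)[OF Y A mono_perspD(1,2)[OF k]]] J(1)[OF X A mono_perspD(1,2)[OF k]]
          J(1)[OF Y A mono_perspD(1,2)[OF k]]])
    then have "J h Y A \<preceq> J h X A"
      unfolding Jh[OF X A] Jh[OF Y A] using f g by (intro op_le_scaleR op_le_add) auto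
    then show ?thesis
      using is_inverse_antimono[OF J(3)[OF Y A hc hp] _ pos_def_sa[OF J(3)[OF X A hc hp]]
          is_inverse_sym[OF J(1)[OF Y A hc hp]] is_inverse_sym[OF J(1)[OF X A hc hp]]]
        self_adjoint_bounded[OF pos_def_sa[OF J(2)[OF X A hc hp]]]
        self_adjoint_bounded[OF pos_def_sa[OF J(2)[OF Y A hc hp]]] by blast
  qed
  then have "mono_persp TYPE('a) h" using hc hp by (auto simp: mono_persp_def)
  then show ?thesis by (simp add: h_def[abs_def])
qed

lemma mono_persp_limit:
  assumes g: "\<And>j. mono_persp TYPE('a::chilbert_space) (g j)"
    and f: "continuous_on {0<..} f" "\<And>s. 0 < s \<Longrightarrow> 0 < f s"
    and lim: "\<And>a b. 0 < a \<Longrightarrow> uniform_limit {a..b} g f sequentially"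
  shows "mono_persp TYPE('a) f"
proof -
  have l: "(\<lambda>j. persp (g j) X A) \<longlonglongrightarrow> persp f X A" if X: "X \<in> pos_def_ops" and A: "A \<in> pos_def_ops" for X A :: "'a op"
  proof -
    obtain a b where N: "0 < a" "normalized X A \<in> op_interval a b"
      using pos_defE[OF normalized_pos_def[OF X A]] by metis
    have "(\<lambda>j. fun_op (g j) (normalized X A)) \<longlonglongrightarrow> fun_op f (normalized X A)"
      by (intro tendsto_fun_op[OF N(2) lim[OF N(1)]] continuous_on_subset[OF f(1)]
          continuous_on_subset[OF mono_perspD(1)[OF g]]) (use N in auto)
    then show ?thesis
      unfolding persp_def by (intro bounded_bilinear.tendsto[OF bounded_bilinear_blinfun_compose] tendsto_const)
  qed
  have "persp f X A \<preceq> persp f Y A"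
    if "X \<in> pos_def_ops" "Y \<in> pos_def_ops" "A \<in> pos_def_ops" "X \<preceq> Y" for X Y A :: "'a op"
    by (rule op_le_LIMSEQ[OF l l]) (use that mono_perspD(3)[OF g] in auto)
  then show ?thesis using f by (auto simp: mono_persp_def)
qed

section \<open>The arithmetic-harmonic iteration on positive reals\<close>

primrec ah_mean :: "real \<Rightarrow> real \<Rightarrow> nat \<Rightarrow> real \<times> real" where
  "ah_mean x y 0 = (x, y)"
| "ah_mean x y (Suc j) =
    (let (a, b) = ah_mean x y j in ((a + b) / 2, 2 / (1 / a + 1 / b)))"

text \<open>The product is invariant, and the gap at least halves: (a+b)/2 - 2ab/(a+b) = (a-b)^2 /
  (2(a+b)), where |a-b| <= a+b.\<close>

lemma ah_mean:
  assumes "0 < x" "0 < y"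
  shows "0 < fst (ah_mean x y j)" "0 < snd (ah_mean x y j)"
    "fst (ah_mean x y j) * snd (ah_mean x y j) = x * y"
    "\<bar>fst (ah_mean x y j) - snd (ah_mean x y j)\<bar> \<le> \<bar>x - y\<bar> / 2 ^ j"
proof -
  have "0 < fst (ah_mean x y j) \<and> 0 < snd (ah_mean x y j) \<and>
    fst (ah_mean x y j) * snd (ah_mean x y j) = x * y \<and>
    \<bar>fst (ah_mean x y j) - snd (ah_mean x y j)\<bar> \<le> \<bar>x - y\<bar> / 2 ^ j"
  proof (induction j)
    case (Suc j)
    obtain a b where ab: "ah_mean x y j = (a, b)" by fastforce
    have pos: "0 < a" "0 < b" and prod: "a * b = x * y" and diff: "\<bar>a - b\<bar> \<le> \<bar>x - y\<bar> / 2 ^ j"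
      using Suc ab by auto
    have h: "2 / (1 / a + 1 / b) = 2 * a * b / (a + b)" using pos by (simp add: field_simps)
    have "(a + b) / 2 - 2 * a * b / (a + b) = (a - b)\<^sup>2 / (2 * (a + b))"
      using pos by (simp add: field_simps power2_eq_square)
    also have "\<bar>\<dots>\<bar> = \<bar>a - b\<bar> * \<bar>a - b\<bar> / (2 * (a + b))"
      using pos by (simp add: power2_eq_square abs_mult)
    also have "\<dots> \<le> (a + b) * \<bar>a - b\<bar> / (2 * (a + b))"
      using pos by (intro divide_right_mono mult_right_mono) auto
    also have "\<dots> = \<bar>a - b\<bar> / 2"
      using pos nonzero_mult_divide_mult_cancel_left[of "a + b" "\<bar>a - b\<bar>" 2]
      by (simp only: mult.commute[of 2])
    also have "\<dots> \<le> \<bar>x - y\<bar> / 2 ^ Suc j" using diff by (simp add: field_simps)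
    finally show ?case using pos prod by (simp add: ab h add_pos_pos)
  qed (use assms in auto)
  then show "0 < fst (ah_mean x y j)" "0 < snd (ah_mean x y j)"
    "fst (ah_mean x y j) * snd (ah_mean x y j) = x * y"
    "\<bar>fst (ah_mean x y j) - snd (ah_mean x y j)\<bar> \<le> \<bar>x - y\<bar> / 2 ^ j" by auto
qed

text \<open>The root of the invariant product lies between the two components, so their gap bounds
  the error.\<close>

lemma fst_ah_mean_approx:
  assumes "0 < x" "0 < y"
  shows "\<bar>fst (ah_mean x y j) - sqrt (x * y)\<bar> \<le> \<bar>x - y\<bar> / 2 ^ j"
proof -
  define a b where "a = fst (ah_mean x y j)" and "b = snd (ah_mean x y j)"
  have ab: "0 < a" "0 < b" "a * b = x * y" "\<bar>a - b\<bar> \<le> \<bar>x - y\<bar> / 2 ^ j"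
    unfolding a_def b_def using ah_mean[OF assms] by auto
  have "min a b \<le> sqrt (a * b)"
    using ab(1,2) by (intro real_le_rsqrt) (auto simp: power2_eq_square min_def intro!: mult_mono)
  moreover have "sqrt (a * b) \<le> max a b"
    using ab(1,2) by (intro real_le_lsqrt) (auto simp: power2_eq_square max_def intro!: mult_mono)
  ultimately have "\<bar>a - sqrt (a * b)\<bar> \<le> \<bar>a - b\<bar>" by (auto simp: min_def max_def split: if_splits)
  then show ?thesis using ab by (simp add: a_def)
qed

lemma mono_persp_geo:
  assumes f: "mono_persp TYPE('a::chilbert_space) f" and g: "mono_persp TYPE('a) g"
  shows "mono_persp TYPE('a) (\<lambda>s. sqrt (f s * g s))"
proof (rule mono_persp_limit)
  have "mono_persp TYPE('a) (\<lambda>s. fst (ah_mean (f s) (g s) j)) \<and>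
      mono_persp TYPE('a) (\<lambda>s. snd (ah_mean (f s) (g s) j))" for j
  proof (induction j)
    case (Suc j)
    then show ?case
      using mono_persp_arith[OF conjunct1 conjunct2, OF Suc Suc]
        mono_persp_harm[OF conjunct1 conjunct2, OF Suc Suc]
      by (simp add: Let_def case_prod_unfold)
  qed (use f g in auto)
  then show "mono_persp TYPE('a) (\<lambda>s. fst (ah_mean (f s) (g s) j))" for j by blast
  show "continuous_on {0<..} (\<lambda>s. sqrt (f s * g s))"
    by (intro continuous_intros mono_perspD(1)[OF f] mono_perspD(1)[OF g])
  show "0 < sqrt (f s * g s)" if "0 < s" for s
    using mono_perspD(2)[OF f that] mono_perspD(2)[OF g that] by simp
  fix a b :: real assume a: "0 < a"
  have "continuous_on {a..b} (\<lambda>s. f s - g s)"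
    using a by (intro continuous_intros continuous_on_subset[OF mono_perspD(1)[OF f]]
        continuous_on_subset[OF mono_perspD(1)[OF g]]) auto
  then have "bounded ((\<lambda>s. f s - g s) ` {a..b})"
    using compact_continuous_image compact_imp_bounded by blast
  then obtain K where K: "\<forall>y \<in> (\<lambda>s. f s - g s) ` {a..b}. norm y \<le> K"
    unfolding bounded_iff by blast
  show "uniform_limit {a..b} (\<lambda>j s. fst (ah_mean (f s) (g s) j)) (\<lambda>s. sqrt (f s * g s)) sequentially"
  proof (rule uniform_limitI)
    fix e :: real assume "e > 0"
    have "(\<lambda>j. (\<bar>K\<bar> + 1) / 2 ^ j) \<longlonglongrightarrow> 0" by (rule LIMSEQ_divide_realpow_zero) simp
    then have "\<forall>\<^sub>F j in sequentially. (\<bar>K\<bar> + 1) / 2 ^ j < e"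
      using \<open>e > 0\<close> by (rule order_tendstoD)
    then show "\<forall>\<^sub>F j in sequentially. \<forall>s\<in>{a..b}. dist (fst (ah_mean (f s) (g s) j)) (sqrt (f s * g s)) < e"
    proof eventually_elim
      case (elim j)
      show ?case
      proof
        fix s assume s: "s \<in> {a..b}"
        then have "0 < s" using a by auto
        have "\<bar>f s - g s\<bar> \<le> \<bar>K\<bar> + 1" using K[rule_format, OF imageI[OF s]] by auto
        then have "\<bar>f s - g s\<bar> / 2 ^ j \<le> (\<bar>K\<bar> + 1) / 2 ^ j" by (intro divide_right_mono) auto
        then show "dist (fst (ah_mean (f s) (g s) j)) (sqrt (f s * g s)) < e"
          using elim fst_ah_mean_approx[OF mono_perspD(2)[OF f \<open>0 < s\<close>] mono_perspD(2)[OF g \<open>0 < s\<close>], of j]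
          by (simp add: dist_real_def)
      qed
    qed
  qed
qed

lemma mono_persp_dyadic: "k \<le> 2 ^ m \<Longrightarrow> mono_persp TYPE('a::chilbert_space) (\<lambda>s. s powr (real k / 2 ^ m))"
proof (induction m arbitrary: k)
  case 0
  then have "k = 0 \<or> k = 1" by auto
  then show ?case
    using mono_persp_cong[OF mono_persp_1, of "\<lambda>s. s powr 0"] mono_persp_cong[OF mono_persp_ident, of "\<lambda>s. s powr 1"]
    by auto
next
  case (Suc m)
  \<comment> \<open>The two halves of k, rounded down and up, are admissible numerators one level
    lower; the geometric mean averages the two exponents.\<close>
  define i j where "i = k div 2" and "j = (k + 1) div 2"
  have ij: "i \<le> 2 ^ m" "j \<le> 2 ^ m" "i + j = k" using Suc.prems by (auto simp: i_def j_def)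
  have "mono_persp TYPE('a) (\<lambda>s. sqrt (s powr (real i / 2 ^ m) * s powr (real j / 2 ^ m)))"
    by (intro mono_persp_geo Suc.IH ij)
  then show ?case
  proof (rule mono_persp_cong)
    fix s :: real assume "0 < s"
    have "sqrt (s powr (real i / 2 ^ m) * s powr (real j / 2 ^ m)) = sqrt (s powr (real k / 2 ^ m))"
      by (simp add: ij(3)[symmetric] add_divide_distrib flip: powr_add)
    also have "\<dots> = s powr (real k / 2 ^ Suc m)"
      using \<open>0 < s\<close> by (simp add: powr_half_sqrt[symmetric] powr_powr field_simps)
    finally show "sqrt (s powr (real i / 2 ^ m) * s powr (real j / 2 ^ m)) = s powr (real k / 2 ^ Suc m)" .
  qed
qed

lemma abs_exp_diff_le:
  fixes x y :: real
  assumes "\<bar>x\<bar> \<le> L" "\<bar>y\<bar> \<le> L"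
  shows "\<bar>exp x - exp y\<bar> \<le> exp L * \<bar>x - y\<bar>"
proof -
  have *: "exp u - exp v \<le> exp L * \<bar>u - v\<bar>" if "\<bar>u\<bar> \<le> L" for u v :: real
  proof -
    have "1 - exp (v - u) \<le> u - v" using exp_ge_add_one_self[of "v - u"] by linarith
    then have "exp u * (1 - exp (v - u)) \<le> exp u * (u - v)" by (rule mult_left_mono) simp
    moreover have "exp u - exp v = exp u * (1 - exp (v - u))"
      by (simp add: right_diff_distrib flip: exp_add)
    ultimately have "exp u - exp v \<le> exp u * (u - v)" by simp
    also have "\<dots> \<le> exp u * \<bar>u - v\<bar>" by (intro mult_left_mono) auto
    also have "\<dots> \<le> exp L * \<bar>u - v\<bar>" using that by (intro mult_right_mono) auto
    finally show ?thesis .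
  qed
  show ?thesis using *[OF assms(1), of y] *[OF assms(2), of x] by (simp add: abs_le_iff abs_minus_commute)
qed

lemma abs_ln_le:
  fixes a b s :: real
  assumes "0 < a" "s \<in> {a..b}" shows "\<bar>ln s\<bar> \<le> max \<bar>ln a\<bar> \<bar>ln b\<bar>"
proof -
  have "ln a \<le> ln s" "ln s \<le> ln b" using assms by auto
  then show ?thesis by linarith
qed

lemma abs_powr_diff_le:
  fixes s :: real
  assumes "0 < s" "\<bar>ln s\<bar> \<le> L" "\<bar>u\<bar> \<le> 1" "\<bar>v\<bar> \<le> 1"
  shows "\<bar>s powr u - s powr v\<bar> \<le> exp L * L * \<bar>u - v\<bar>"
proof -
  have b: "\<bar>w * ln s\<bar> \<le> L" if "\<bar>w\<bar> \<le> 1" for w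
    using mult_mono[OF that assms(2)] by (simp add: abs_mult)
  have "\<bar>s powr u - s powr v\<bar> \<le> exp L * \<bar>u * ln s - v * ln s\<bar>"
    using assms(1) abs_exp_diff_le[OF b[OF assms(3)] b[OF assms(4)]] by (simp add: powr_def)
  also have "\<dots> = exp L * (\<bar>ln s\<bar> * \<bar>u - v\<bar>)" by (simp add: abs_mult mult.commute flip: left_diff_distrib)
  also have "\<dots> \<le> exp L * (L * \<bar>u - v\<bar>)"
    using assms(2) by (intro mult_left_mono mult_right_mono) auto
  finally show ?thesis by simp
qed

lemma mono_persp_powr:
  assumes t: "0 \<le> t" "t \<le> 1"
  shows "mono_persp TYPE('a::chilbert_space) (\<lambda>s. s powr t)"
proof (rule mono_persp_limit)
  define k where "k m = nat \<lfloor>2 ^ m * t\<rfloor>" for m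
  have k: "real (k m) \<le> 2 ^ m * t" "2 ^ m * t < real (k m) + 1" for m
    using t by (auto simp: k_def)
  have k1: "k m \<le> 2 ^ m" for m
  proof -
    have "real (k m) \<le> 2 ^ m" using k(1)[of m] t(2) by (meson mult_left_le order_trans zero_le_numeral zero_le_power)
    then show ?thesis by (metis of_nat_le_iff of_nat_numeral of_nat_power)
  qed
  then show "mono_persp TYPE('a) (\<lambda>s. s powr (real (k m) / 2 ^ m))" for m
    by (rule mono_persp_dyadic)
  have km: "\<bar>real (k m) / 2 ^ m - t\<bar> \<le> 1 / 2 ^ m" for m
  proof -
    have "real (k m) / 2 ^ m - t = (real (k m) - 2 ^ m * t) / 2 ^ m"
      by (simp add: diff_divide_distrib)
    then have "\<bar>real (k m) / 2 ^ m - t\<bar> = \<bar>real (k m) - 2 ^ m * t\<bar> / 2 ^ m"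
      by (simp only: abs_divide) simp
    also have "\<dots> \<le> 1 / 2 ^ m" using k[of m] by (intro divide_right_mono) auto
    finally show ?thesis .
  qed
  fix a b :: real assume "0 < a"
  define L where "L = max \<bar>ln a\<bar> \<bar>ln b\<bar>"
  show "uniform_limit {a..b} (\<lambda>m s. s powr (real (k m) / 2 ^ m)) (\<lambda>s. s powr t) sequentially"
  proof (rule uniform_limitI)
    fix e :: real assume "e > 0"
    have "(\<lambda>m. exp L * L / 2 ^ m) \<longlonglongrightarrow> 0" by (rule LIMSEQ_divide_realpow_zero) simp
    then have "\<forall>\<^sub>F m in sequentially. exp L * L / 2 ^ m < e"
      using \<open>e > 0\<close> by (rule order_tendstoD)
    then show "\<forall>\<^sub>F m in sequentially. \<forall>s\<in>{a..b}. dist (s powr (real (k m) / 2 ^ m)) (s powr t) < e"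
    proof eventually_elim
      case (elim m)
      have "dist (s powr (real (k m) / 2 ^ m)) (s powr t) < e" if "s \<in> {a..b}" for s
      proof -
        have "real (k m) \<le> 2 ^ m" using k1[of m] by (metis of_nat_le_iff of_nat_numeral of_nat_power)
        then have "\<bar>s powr (real (k m) / 2 ^ m) - s powr t\<bar> \<le> exp L * L * \<bar>real (k m) / 2 ^ m - t\<bar>"
          using that \<open>0 < a\<close> abs_ln_le[OF \<open>0 < a\<close> that] t by (intro abs_powr_diff_le) (auto simp: L_def)
        also have "\<dots> \<le> exp L * L * (1 / 2 ^ m)" by (intro mult_left_mono km) (auto simp: L_def)
        finally show ?thesis using elim by (simp add: dist_real_def)
      qed
      then show ?case by blast
    qed
  qed
qed (simp_all add: continuous_on_powr_Ioi)

subsection \<open>Properties of the weighted geometric mean\<close>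

lemma geo_mean_mono:
  fixes X :: "'a::chilbert_space op"
  assumes "0 \<le> t" "t \<le> 1" "X \<in> pos_def_ops" "Y \<in> pos_def_ops" "A \<in> pos_def_ops" "X \<preceq> Y"
  shows "geo_mean t X A \<preceq> geo_mean t Y A"
  unfolding geo_mean_eq_persp by (rule mono_perspD(3)[OF mono_persp_powr]) (use assms in auto)

lemma geo_mean_pos_def:
  fixes X :: "'a::chilbert_space op"
  assumes "X \<in> pos_def_ops" "A \<in> pos_def_ops"
  shows "geo_mean t X A \<in> pos_def_ops"
  unfolding geo_mean_eq_persp by (rule persp_pos_def[OF assms]) (simp_all add: continuous_on_powr_Ioi)

lemma fun_op_powr_scaleR:
  fixes X :: "'a::chilbert_space op"
  assumes "X \<in> pos_def_ops" "0 < c"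
  shows "fun_op (\<lambda>s. s powr r) (c *\<^sub>R X) = c powr r *\<^sub>R fun_op (\<lambda>s. s powr r) X"
proof -
  obtain a b where X: "0 < a" "X \<in> op_interval a b" using assms(1) by (rule pos_defE)
  have "c *\<^sub>R X = fun_op (\<lambda>s. c * s) X"
    using fun_op_scale[OF X(2), of "\<lambda>s. s" c] by (simp add: fun_op_ident[OF X(2)])
  also have "fun_op (\<lambda>s. s powr r) \<dots> = fun_op (\<lambda>s. (c * s) powr r) X"
    using X(1) assms(2)
    by (intro fun_op_comp[OF X(2), of _ "c * a" "c * b"] continuous_on_powr_pos continuous_intros) auto
  also have "\<dots> = fun_op (\<lambda>s. c powr r * s powr r) X"
    using X(1) assms(2)
    by (intro fun_op_cong_interval[OF X(2)] continuous_intros) (auto simp: powr_mult)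
  also have "\<dots> = c powr r *\<^sub>R fun_op (\<lambda>s. s powr r) X"
    by (rule fun_op_scale[OF X(2) continuous_on_powr_pos[OF X(1)]])
  finally show ?thesis .
qed

lemma normalized_scaleR:
  fixes X :: "'a::chilbert_space op"
  assumes "X \<in> pos_def_ops" "0 < c"
  shows "normalized (c *\<^sub>R X) A = (1 / c) *\<^sub>R normalized X A"
proof -
  have "c powr (-1/2) * c powr (-1/2) = 1 / c"
    using assms(2) by (simp add: powr_minus_divide flip: powr_add)
  then show ?thesis
    by (simp add: normalized_def isqrt_op_def fun_op_powr_scaleR[OF assms] compose_simps)
qed

lemma geo_mean_scaleR:
  fixes X :: "'a::chilbert_space op"
  assumes X: "X \<in> pos_def_ops" and A: "A \<in> pos_def_ops" and c: "0 < c"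
  shows "geo_mean t (c *\<^sub>R X) A = c powr (1 - t) *\<^sub>R geo_mean t X A"
proof -
  have "c powr (1/2) * ((1 / c) powr t * c powr (1/2)) = c powr (1/2) * c powr (- t) * c powr (1/2)"
    using c by (simp add: powr_divide powr_minus_divide)
  also have "\<dots> = c powr (1 - t)"
    using c by (simp flip: powr_add)
  finally have "c powr (1/2) * ((1 / c) powr t * c powr (1/2)) = c powr (1 - t)" .
  then show ?thesis
    using c by (simp add: geo_mean_eq_persp persp_def sqrt_op_def normalized_scaleR[OF X c]
        fun_op_powr_scaleR[OF X c] fun_op_powr_scaleR[OF normalized_pos_def[OF X A]] compose_simps mult_ac)
qed

lemma powr_le_affine:
  fixes s t :: real
  assumes "0 < s" "0 \<le> t" "t \<le> 1"
  shows "s powr t \<le> 1 - t + t * s"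
proof -
  have "exp ((1 - t) *\<^sub>R 0 + t *\<^sub>R ln s) \<le> (1 - t) * exp 0 + t * exp (ln s)"
    using assms by (intro convex_onD[OF exp_convex]) auto
  then show ?thesis using assms by (simp add: powr_def)
qed

lemma geo_mean_le_arith:
  fixes X :: "'a::chilbert_space op"
  assumes X: "X \<in> pos_def_ops" and A: "A \<in> pos_def_ops" and t: "0 \<le> t" "t \<le> 1"
  shows "geo_mean t X A \<preceq> (1 - t) *\<^sub>R X + t *\<^sub>R A"
proof -
  obtain a b where N: "0 < a" "normalized X A \<in> op_interval a b"
    using pos_defE[OF normalized_pos_def[OF X A]] by metis
  have "fun_op (\<lambda>s. s powr t) (normalized X A) \<preceq> fun_op (\<lambda>s. (1 - t) + t * s) (normalized X A)"
    using N(1) t by (intro fun_op_mono[OF N(2)] continuous_on_powr_pos continuous_intros powr_le_affine) auto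
  also have "fun_op (\<lambda>s. (1 - t) + t * s) (normalized X A) = (1 - t) *\<^sub>R id_blinfun + t *\<^sub>R normalized X A"
    by (simp add: fun_op_add[OF N(2)] fun_op_const[OF N(2)] fun_op_scale[OF N(2)] fun_op_ident[OF N(2)] continuous_intros)
  finally have "geo_mean t X A \<preceq> sqrt_op X o\<^sub>L ((1 - t) *\<^sub>R id_blinfun + t *\<^sub>R normalized X A) o\<^sub>L sqrt_op X"
    unfolding geo_mean_eq_persp persp_def by (intro op_le_sandwich sqrt_op_sa X)
  then show ?thesis
    using sqrt_normalized[OF X, of A] by (simp add: compose_simps sqrt_op_square[OF X])
qed

text \<open>Provides the lower end of the invariant interval of the fixed point map: a scalar below
  all entries is a subsolution.\<close>

lemma geo_mean_ge:
  fixes X :: "'a::chilbert_space op"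
  assumes X: "X \<in> pos_def_ops" and A: "A \<in> pos_def_ops" and t: "0 \<le> t" and "X \<preceq> A"
  shows "X \<preceq> geo_mean t X A"
proof -
  obtain a b where N: "0 < a" "normalized X A \<in> op_interval a b"
    using pos_defE[OF normalized_pos_def[OF X A]] by metis
  have "id_blinfun \<preceq> normalized X A"
    unfolding normalized_self[OF X, symmetric] normalized_def by (intro op_le_sandwich assms isqrt_op_sa)
  then have N1: "normalized X A \<in> op_interval 1 b" using N by (simp add: op_interval_iff)
  have "fun_op (\<lambda>s. s powr t) (normalized X A) \<in> op_interval 1 (b powr t)"
    using t by (intro fun_op_interval[OF N1] continuous_on_powr_pos) (auto intro: ge_one_powr_ge_zero powr_mono2)
  then have "id_blinfun \<preceq> fun_op (\<lambda>s. s powr t) (normalized X A)"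
    by (simp add: op_interval_iff)
  from op_le_sandwich[OF this sqrt_op_sa[OF X]] show ?thesis
    by (simp add: geo_mean_eq_persp persp_def sqrt_op_square[OF X])
qed

section \<open>Power means\<close>

lemma pos_def_sum:
  fixes X :: "nat \<Rightarrow> 'a::chilbert_space op"
  assumes "finite I" "I \<noteq> {}" "\<And>i. i \<in> I \<Longrightarrow> X i \<in> pos_def_ops"
  shows "sum X I \<in> pos_def_ops"
  using assms by (induction rule: finite_ne_induct) (auto intro: pos_def_add)

text \<open>Finiteness of the Thompson distance, in one direction.\<close>

lemma pos_def_le_scaleR:
  fixes P Z :: "'a::chilbert_space op"
  assumes "P \<in> pos_def_ops" "Z \<in> pos_def_ops"
  obtains c where "1 \<le> c" "P \<preceq> c *\<^sub>R Z"
proof -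
  obtain a b where P: "0 < a" "a \<le> b" "P \<in> op_interval a b" using assms(1) by (rule pos_defE)
  obtain c d where Z: "0 < c" "c \<le> d" "Z \<in> op_interval c d" using assms(2) by (rule pos_defE)
  have "P \<preceq> b *\<^sub>R id_blinfun" using P by (simp add: op_interval_iff)
  also have "\<dots> \<preceq> (max 1 (b / c) * c) *\<^sub>R id_blinfun"
    using Z P by (auto intro!: op_leI self_adjoint_scaleR mult_right_mono
        simp: blinfun.bilinear_simps rinner_scaleR_right rinner_self max_def field_simps)
  also have "\<dots> \<preceq> max 1 (b / c) *\<^sub>R Z"
    using Z op_le_scaleR[of "c *\<^sub>R id_blinfun" Z "max 1 (b / c)"] by (simp add: op_interval_iff)
  finally show thesis by (intro that[of "max 1 (b / c)"]) auto
qed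

lemma scaleR_id_mono: "a \<le> b \<Longrightarrow> a *\<^sub>R id_blinfun \<preceq> b *\<^sub>R id_blinfun"
  by (auto intro!: op_leI self_adjoint_scaleR mult_right_mono
      simp: blinfun.bilinear_simps rinner_scaleR_right rinner_self)

lemma op_interval_scaleR_mono:
  assumes "X \<in> op_interval 0 d" "a \<le> b" shows "a *\<^sub>R X \<preceq> b *\<^sub>R X"
proof (rule op_leI)
  show "a *\<^sub>R X \<in> self_adjoint_ops" "b *\<^sub>R X \<in> self_adjoint_ops"
    using op_interval_sa[OF assms(1)] by (auto intro: self_adjoint_scaleR)
  show "rinner x ((a *\<^sub>R X) x) \<le> rinner x ((b *\<^sub>R X) x)" for x
    using op_interval_lower[OF assms(1), of x] assms(2)
    by (simp add: blinfun.bilinear_simps rinner_scaleR_right mult_right_mono)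
qed

lemma fun_op_powr_inv_op:
  fixes Y :: "'a::chilbert_space op"
  assumes "Y \<in> pos_def_ops"
  shows "fun_op (\<lambda>s. s powr r) (inv_op Y) = fun_op (\<lambda>s. s powr (- r)) Y"
proof -
  obtain a b where Y: "0 < a" "a \<le> b" "Y \<in> op_interval a b" using assms by (rule pos_defE)
  have "fun_op (\<lambda>s. s powr r) (fun_op inverse Y) = fun_op (\<lambda>s. (inverse s) powr r) Y"
    using Y by (intro fun_op_comp[OF Y(3), of _ "inverse b" "inverse a"] continuous_on_powr_pos continuous_intros) auto
  also have "\<dots> = fun_op (\<lambda>s. s powr (- r)) Y"
    using Y by (intro fun_op_cong_interval[OF Y(3)] continuous_intros)
      (auto simp: powr_minus inverse_powr)
  finally show ?thesis by (simp add: inv_op_eq_fun_op[OF Y(3,1)])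
qed

lemma inv_op_pos_def:
  fixes Y :: "'a::chilbert_space op"
  assumes "Y \<in> pos_def_ops" shows "inv_op Y \<in> pos_def_ops"
proof -
  obtain a b where Y: "0 < a" "a \<le> b" "Y \<in> op_interval a b" using assms by (rule pos_defE)
  show ?thesis by (rule pos_defI[OF inv_op_interval[OF Y(3,1)]]) (use Y in auto)
qed

lemma isqrt_op_inv_op:
  fixes Y :: "'a::chilbert_space op"
  assumes "Y \<in> pos_def_ops" shows "isqrt_op (inv_op Y) = sqrt_op Y"
  using fun_op_powr_inv_op[OF assms, of "-1/2"] by (simp add: isqrt_op_def sqrt_op_def)

text \<open>The square root of Y is the inverse square root of \<open>inv_op Y\<close>. This is how
  power means with negative exponent are brought to the same normalized equation as the positive
  ones.\<close>

lemma normalized_inv_op: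
  fixes Y :: "'a::chilbert_space op"
  assumes Y: "Y \<in> pos_def_ops" and A: "A \<in> pos_def_ops"
  shows "normalized Y (inv_op A) = inv_op (normalized (inv_op Y) A)"
proof (rule inv_op_eq[symmetric])
  obtain a b where A': "0 < a" "A \<in> op_interval a b" using A by (rule pos_defE)
  have iA: "is_inverse A (inv_op A)" using inv_op_eq_fun_op[OF A'(2,1)] by simp
  show "is_inverse (normalized (inv_op Y) A) (normalized Y (inv_op A))"
    using is_inverse_compose[OF is_inverse_compose[OF sqrt_op_inverse[OF Y] iA] sqrt_op_inverse[OF Y]]
    by (simp add: normalized_def isqrt_op_inv_op[OF Y] compose_assoc)
qed

text \<open>The tangent line of 1/s at s = 1. It replaces the harmonic mean by a lower bound affine
  in the weights, which can be integrated over the simplex.\<close>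

lemma two_minus_le_inv_op:
  fixes Y :: "'a::chilbert_space op"
  assumes "Y \<in> pos_def_ops" shows "2 *\<^sub>R id_blinfun - Y \<preceq> inv_op Y"
proof -
  obtain a b where Y: "0 < a" "a \<le> b" "Y \<in> op_interval a b" using assms by (rule pos_defE)
  have "fun_op (\<lambda>s. 2 - s) Y \<preceq> fun_op inverse Y"
  proof (intro fun_op_mono[OF Y(3)] continuous_intros)
    fix s assume "s \<in> {a..b}"
    then have "0 < s" using Y by auto
    moreover have "0 \<le> (s - 1)\<^sup>2" by simp
    ultimately show "2 - s \<le> inverse s" by (simp add: power2_eq_square field_simps)
  qed (use Y in auto)
  then show ?thesis
    by (simp add: fun_op_diff[OF Y(3)] fun_op_const[OF Y(3)] fun_op_ident[OF Y(3)] inv_op_eq_fun_op[OF Y(3,1)] continuous_intros)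
qed

text \<open>One interval for all entries: the iterates and means stay in it, and the error constants
  below depend on m and M only, hence not on the weights.\<close>

locale weighted_tuple =
  fixes n :: nat and w :: "nat \<Rightarrow> real" and A :: "nat \<Rightarrow> 'a::chilbert_space op" and m M :: real
  assumes w: "w \<in> weight_simplex n" and m: "0 < m" and mM: "m \<le> M"
    and A: "\<And>k. k \<in> {1..n} \<Longrightarrow> A k \<in> op_interval m M"
begin

lemma w_pos: "k \<in> {1..n} \<Longrightarrow> 0 < w k" and w_sum: "(\<Sum>k=1..n. w k) = 1"
  using w by (auto simp: weight_simplex_def)

lemma index_nonempty: "{1..n} \<noteq> {}"
  using w_sum by (metis sum.empty zero_neq_one)

lemma M_pos: "0 < M" using m mM by simp

lemma A_pos_def: "k \<in> {1..n} \<Longrightarrow> A k \<in> pos_def_ops"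
  using A m by (blast intro: pos_defI)

lemma weighted_sum_const: "(\<Sum>k=1..n. w k *\<^sub>R X) = X" for X :: "'a op"
  by (simp only: w_sum scaleR_one flip: scaleR_sum_left)

definition step :: "real \<Rightarrow> 'a op \<Rightarrow> 'a op" where
  "step t X = (\<Sum>k=1..n. w k *\<^sub>R geo_mean t X (A k))"

lemma step_pos_def: "X \<in> pos_def_ops \<Longrightarrow> step t X \<in> pos_def_ops"
  unfolding step_def using index_nonempty
  by (intro pos_def_sum) (auto intro!: pos_def_scaleR geo_mean_pos_def A_pos_def w_pos)

lemma step_mono:
  "0 \<le> t \<Longrightarrow> t \<le> 1 \<Longrightarrow> X \<in> pos_def_ops \<Longrightarrow> Y \<in> pos_def_ops \<Longrightarrow> X \<preceq> Y \<Longrightarrow> step t X \<preceq> step t Y"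
  unfolding step_def
  by (intro op_le_sum op_le_scaleR geo_mean_mono A_pos_def) (auto simp: w_pos less_imp_le)

lemma step_scaleR:
  "X \<in> pos_def_ops \<Longrightarrow> 0 < c \<Longrightarrow> step t (c *\<^sub>R X) = c powr (1 - t) *\<^sub>R step t X"
  unfolding step_def scaleR_sum_right
  by (intro sum.cong refl) (simp add: geo_mean_scaleR A_pos_def mult.commute)

lemma step_le_arith:
  assumes "0 \<le> t" "t \<le> 1" "X \<in> pos_def_ops"
  shows "step t X \<preceq> (1 - t) *\<^sub>R X + t *\<^sub>R (\<Sum>k=1..n. w k *\<^sub>R A k)"
proof -
  have "step t X \<preceq> (\<Sum>k=1..n. w k *\<^sub>R ((1 - t) *\<^sub>R X + t *\<^sub>R A k))"
    unfolding step_def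
    by (intro op_le_sum op_le_scaleR geo_mean_le_arith A_pos_def assms) (auto simp: w_pos less_imp_le)
  also have "\<dots> = (1 - t) *\<^sub>R (\<Sum>k=1..n. w k *\<^sub>R X) + t *\<^sub>R (\<Sum>k=1..n. w k *\<^sub>R A k)"
    by (simp add: scaleR_add_right sum.distrib scaleR_sum_right mult.commute)
  finally show ?thesis by (simp only: weighted_sum_const)
qed

lemma arith_mean_op_interval: "(\<Sum>k=1..n. w k *\<^sub>R A k) \<in> op_interval m M"
proof -
  have "(\<Sum>k=1..n. w k *\<^sub>R (m *\<^sub>R id_blinfun)) \<preceq> (\<Sum>k=1..n. w k *\<^sub>R A k)"
    "(\<Sum>k=1..n. w k *\<^sub>R A k) \<preceq> (\<Sum>k=1..n. w k *\<^sub>R (M *\<^sub>R id_blinfun))"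
    by (intro op_le_sum op_le_scaleR; use A in \<open>auto simp: op_interval_iff w_pos less_imp_le\<close>)+
  then show ?thesis by (simp only: weighted_sum_const op_interval_iff)
qed

text \<open>By monotonicity it is enough to treat the scalars at the two ends: the arithmetic bound
  handles M, and m is a subsolution.\<close>

lemma step_op_interval:
  assumes t: "0 \<le> t" "t \<le> 1" and X: "X \<in> op_interval m M"
  shows "step t X \<in> op_interval m M"
proof -
  have pd: "r *\<^sub>R (id_blinfun :: 'a op) \<in> pos_def_ops" if "0 < r" for r
    using that op_interval_scaleR[OF op_interval_id[of 1 1], of r] by (intro pos_defI[of _ r r]) auto
  have Xpd: "X \<in> pos_def_ops" using X m by (rule pos_defI)
  have "step t X \<preceq> step t (M *\<^sub>R id_blinfun)"
    using X by (intro step_mono t Xpd pd M_pos) (simp add: op_interval_iff)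
  also have "\<dots> \<preceq> (1 - t) *\<^sub>R (M *\<^sub>R id_blinfun) + t *\<^sub>R (\<Sum>k=1..n. w k *\<^sub>R A k)"
    by (intro step_le_arith t pd M_pos)
  also have "\<dots> \<preceq> (1 - t) *\<^sub>R (M *\<^sub>R id_blinfun) + t *\<^sub>R (M *\<^sub>R id_blinfun)"
    using arith_mean_op_interval t by (intro op_le_add op_le_scaleR) (auto simp: op_interval_iff M_pos less_imp_le)
  also have "\<dots> = M *\<^sub>R id_blinfun"
    unfolding scaleR_add_left[symmetric] by simp
  finally have 1: "step t X \<preceq> M *\<^sub>R id_blinfun" .
  have "m *\<^sub>R (id_blinfun :: 'a op) = (\<Sum>k=1..n. w k *\<^sub>R (m *\<^sub>R id_blinfun))" by (simp only: weighted_sum_const)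
  also have "\<dots> \<preceq> step t (m *\<^sub>R id_blinfun)"
    unfolding step_def using A
    by (intro op_le_sum op_le_scaleR geo_mean_ge pd m A_pos_def t) (auto simp: w_pos less_imp_le op_interval_iff)
  also have "\<dots> \<preceq> step t X"
    using X by (intro step_mono t Xpd pd m) (simp add: op_interval_iff)
  finally show ?thesis using 1 by (simp add: op_interval_iff)
qed

text \<open>The map \<open>step t\<close> is monotone and homogeneous of degree \<open>1 - t < 1\<close>, hence a contraction of the
  Thompson metric: subsolutions lie below supersolutions.\<close>

lemma step_comparison:
  assumes t: "0 < t" "t \<le> 1" and P: "P \<in> pos_def_ops" "P \<preceq> step t P"
    and Z: "Z \<in> pos_def_ops" "step t Z \<preceq> Z"
  shows "P \<preceq> Z"
proof -
  obtain c where c: "1 \<le> c" "P \<preceq> c *\<^sub>R Z" using pos_def_le_scaleR P(1) Z(1) by blast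
  \<comment> \<open>Each application of \<open>step t\<close> raises the comparison constant to the
    power 1 - t, so the constants tend to \<open>c powr 0\<close>, that is to 1.\<close>
  have "P \<preceq> (c powr (1 - t) ^ j) *\<^sub>R Z" for j
  proof (induction j)
    case (Suc j)
    let ?a = "c powr (1 - t) ^ j"
    have a: "0 < ?a" using c by simp
    have "P \<preceq> step t P" by (rule P)
    also have "\<dots> \<preceq> step t (?a *\<^sub>R Z)"
      using t by (intro step_mono P Suc pos_def_scaleR Z a) auto
    also have "\<dots> = ?a powr (1 - t) *\<^sub>R step t Z" by (rule step_scaleR[OF Z(1) a])
    also have "\<dots> \<preceq> ?a powr (1 - t) *\<^sub>R Z" by (intro op_le_scaleR Z) simp
    also have "?a powr (1 - t) = c powr (1 - t) ^ Suc j"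
      using c by (simp add: powr_powr mult.commute)
    finally show ?case .
  qed (use c in simp)
  moreover have "(\<lambda>j. (c powr (1 - t) ^ j) *\<^sub>R Z) \<longlonglongrightarrow> (c powr 0) *\<^sub>R Z"
    using t c by (intro tendsto_intros LIMSEQ_power_zero) auto
  then have "(\<lambda>j. (c powr (1 - t) ^ j) *\<^sub>R Z) \<longlonglongrightarrow> Z" using c by simp
  ultimately show ?thesis by (rule op_le_LIMSEQ[OF tendsto_const, rotated])
qed

text \<open>Iteration from the top of the interval. The iterates decrease, and X_j <= c^(q^j)
  X_(j+1), so consecutive differences are summable in norm. Instead of continuity of
  \<open>step t\<close>, monotonicity and homogeneity carry the limit through: L is squeezed between
  multiples of L with factors tending to 1.\<close>

lemma ex_step_fixed_point:
  assumes t: "0 < t" "t \<le> 1"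
  shows "\<exists>L \<in> op_interval m M. step t L = L"
proof -
  \<comment> \<open>M/m is the largest constant needed at the start: M I = c (m I) <= c X_1. The
    exponent q is the degree of homogeneity.\<close>
  define c q where "c = M / m" and "q = 1 - t"
  have c: "1 \<le> c" using m mM by (simp add: c_def)
  have q: "0 \<le> q" "q < 1" using t by (auto simp: q_def)
  define X where "X j = (step t ^^ j) (M *\<^sub>R id_blinfun)" for j
  have X0: "X 0 = M *\<^sub>R id_blinfun" and XS: "X (Suc j) = step t (X j)" for j by (simp_all add: X_def)
  have Xi: "X j \<in> op_interval m M" for j
  proof (induction j)
    case 0
    show ?case
      using M_pos mM op_interval_scaleR[OF op_interval_id[of 1 1], of M]
      by (auto simp: X0 intro: op_interval_mono)
  qed (use t in \<open>auto simp: XS intro: step_op_interval\<close>)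
  then have Xp: "X j \<in> pos_def_ops" for j using m by (blast intro: pos_defI)
  have dec: "X (Suc j) \<preceq> X j" for j
  proof (induction j)
    case 0 then show ?case using Xi[of 1] by (simp add: X0 op_interval_iff)
  next
    case (Suc j) then show ?case
      unfolding XS[of "Suc j"] XS[of j] using t Xp by (metis XS less_imp_le step_mono)
  qed
  have inc: "X j \<preceq> (c powr (q ^ j)) *\<^sub>R X (Suc j)" for j
  proof (induction j)
    case 0
    have "c *\<^sub>R (m *\<^sub>R id_blinfun) \<preceq> c *\<^sub>R X (Suc 0)"
      using Xi[of "Suc 0"] c by (intro op_le_scaleR) (auto simp: op_interval_iff)
    then show ?case using m M_pos c by (simp add: X0 c_def)
  next
    case (Suc j)
    have p: "0 < c powr (q ^ j)" using c by simp
    have "X (Suc j) \<preceq> step t ((c powr (q ^ j)) *\<^sub>R X (Suc j))"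
      unfolding XS[of j] using t Suc Xp p
      by (intro step_mono pos_def_scaleR) (auto simp: XS intro: step_pos_def)
    also have "\<dots> = (c powr (q ^ Suc j)) *\<^sub>R X (Suc (Suc j))"
      using c by (simp add: step_scaleR[OF Xp p] XS[of "Suc j"] powr_powr q_def[symmetric] mult.commute)
    finally show ?case .
  qed
  have diff: "norm (X (Suc j) - X j) \<le> (c - 1) * M * q ^ j" for j
  proof -
    have q1: "0 \<le> q ^ j" "q ^ j \<le> 1" using q by (auto simp: power_le_one)
    \<comment> \<open>Bernoulli's inequality for an exponent in [0,1] makes the rate
      geometric.\<close>
    have le: "c powr (q ^ j) - 1 \<le> (c - 1) * q ^ j"
      using powr_le_affine[of c "q ^ j"] c q1 by (simp add: algebra_simps)
    have "(c powr (q ^ j) - 1) *\<^sub>R X (Suc j) \<preceq> ((c - 1) * q ^ j) *\<^sub>R X (Suc j)"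
      by (rule op_interval_scaleR_mono[OF op_interval_mono[OF Xi] le]) (use m in auto)
    also have "\<dots> \<preceq> ((c - 1) * q ^ j) *\<^sub>R (M *\<^sub>R id_blinfun)"
      using Xi[of "Suc j"] c q1 by (intro op_le_scaleR) (auto simp: op_interval_iff)
    finally have "(c powr (q ^ j) - 1) *\<^sub>R X (Suc j) \<preceq> ((c - 1) * M * q ^ j) *\<^sub>R id_blinfun"
      by (simp add: mult_ac)
    moreover have "X j - X (Suc j) \<preceq> (c powr (q ^ j) - 1) *\<^sub>R X (Suc j)"
      using inc[of j] by (simp add: op_le_def algebra_simps)
    ultimately have 1: "X j - X (Suc j) \<preceq> ((c - 1) * M * q ^ j) *\<^sub>R id_blinfun"
      by (rule op_le_trans[rotated])
    have e: "0 \<le> (c - 1) * M * q ^ j" using c M_pos q1 by simp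
    have "X (Suc j) - X j \<preceq> 0 *\<^sub>R id_blinfun" using dec[of j] by (simp add: op_le_def)
    also have "\<dots> \<preceq> ((c - 1) * M * q ^ j) *\<^sub>R id_blinfun" by (rule scaleR_id_mono[OF e])
    finally show ?thesis using 1 e by (intro norm_diff_le_op_le)
  qed
  have "summable (\<lambda>j. X (Suc j) - X j)"
    by (rule summable_comparison_test'[of "\<lambda>j. (c - 1) * M * q ^ j"])
      (use q diff in \<open>auto intro!: summable_mult summable_geometric\<close>)
  then have "(\<lambda>j. \<Sum>i<j. X (Suc i) - X i) \<longlonglongrightarrow> (\<Sum>j. X (Suc j) - X j)"
    by (rule summable_LIMSEQ)
  then have "(\<lambda>j. (\<Sum>i<j. X (Suc i) - X i) + X 0) \<longlonglongrightarrow> (\<Sum>j. X (Suc j) - X j) + X 0"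
    by (intro tendsto_add tendsto_const)
  then obtain L where L: "X \<longlonglongrightarrow> L" by (auto simp: sum_lessThan_telescope)
  have Li: "L \<in> op_interval m M" using L Xi by (rule op_interval_LIMSEQ)
  then have Lp: "L \<in> pos_def_ops" using m by (rule pos_defI)
  have antiX: "X (j + i) \<preceq> X j" for i j
    by (induction i) (auto intro: op_le_trans dec)
  have LX: "L \<preceq> X j" for j
  proof (rule op_le_LIMSEQ[OF _ tendsto_const])
    show "(\<lambda>i. X (i + j)) \<longlonglongrightarrow> L" using L by (rule LIMSEQ_ignore_initial_segment)
    show "X (i + j) \<preceq> X j" for i using antiX[of j i] by (simp add: add.commute)
  qed
  \<comment> \<open>Norm distance rewritten as a multiplicative bound, using that L is at least m I;
    homogeneity of \<open>step t\<close> can act on this form.\<close>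
  have XL: "X j \<preceq> (1 + norm (X j - L) / m) *\<^sub>R L" for j
  proof -
    have "X j - L \<preceq> norm (X j - L) *\<^sub>R id_blinfun"
      using self_adjoint_op_interval[OF self_adjoint_diff[OF op_interval_sa[OF Xi] op_interval_sa[OF Li]]]
      by (simp add: op_interval_iff)
    also have "\<dots> = (norm (X j - L) / m) *\<^sub>R (m *\<^sub>R id_blinfun)" using m by simp
    also have "\<dots> \<preceq> (norm (X j - L) / m) *\<^sub>R L"
      using Li m by (intro op_le_scaleR) (auto simp: op_interval_iff)
    finally show ?thesis by (simp add: op_le_def algebra_simps)
  qed
  have LS: "(\<lambda>j. X (Suc j)) \<longlonglongrightarrow> L" using L by (rule LIMSEQ_Suc)
  have "step t L \<preceq> L"
  proof (rule op_le_LIMSEQ[OF tendsto_const LS])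
    show "step t L \<preceq> X (Suc j)" for j
      unfolding XS using t by (intro step_mono Lp Xp LX) auto
  qed
  moreover have "L \<preceq> step t L"
  proof (rule op_le_LIMSEQ[OF LS])
    define a where "a j = 1 + norm (X j - L) / m" for j
    have a: "1 \<le> a j" for j using m by (simp add: a_def)
    have "a \<longlonglongrightarrow> 1 + norm (L - L) / m"
      unfolding a_def using m by (intro tendsto_intros L) auto
    then have "(\<lambda>j. a j *\<^sub>R step t L) \<longlonglongrightarrow> 1 *\<^sub>R step t L"
      by (intro tendsto_intros) simp
    then show "(\<lambda>j. a j *\<^sub>R step t L) \<longlonglongrightarrow> step t L" by simp
    show "X (Suc j) \<preceq> a j *\<^sub>R step t L" for j
    proof -
      have a0: "0 < a j" using a[of j] by simp
      have "X (Suc j) \<preceq> step t (a j *\<^sub>R L)"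
        unfolding XS using t XL[of j] by (intro step_mono Lp Xp pos_def_scaleR a0) (auto simp: a_def)
      also have "\<dots> = a j powr (1 - t) *\<^sub>R step t L" by (rule step_scaleR[OF Lp a0])
      also have "\<dots> \<preceq> a j *\<^sub>R step t L"
      proof (rule op_interval_scaleR_mono)
        show "step t L \<in> op_interval 0 M"
          by (rule op_interval_mono[OF step_op_interval[OF _ _ Li]]) (use t m in auto)
        show "a j powr (1 - t) \<le> a j"
          using powr_mono[of "1 - t" 1 "a j"] a[of j] t by simp
      qed
      finally show ?thesis .
    qed
  qed
  ultimately show ?thesis using Li op_le_antisym by blast
qed

lemma power_mean_pos:
  assumes t: "0 < t" "t \<le> 1"
  shows "power_mean_pos n t w A \<in> op_interval m M"
    and "step t (power_mean_pos n t w A) = power_mean_pos n t w A"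
proof -
  obtain L where L: "L \<in> op_interval m M" "step t L = L" using ex_step_fixed_point[OF t] by blast
  have Lp: "L \<in> pos_def_ops" using L(1) m by (rule pos_defI)
  have "power_mean_pos n t w A = L"
    unfolding power_mean_pos_def step_def[symmetric]
  proof (rule the_equality)
    fix X assume "X \<in> pos_def_ops \<and> X = step t X"
    then have X: "X \<in> pos_def_ops" "step t X = X" by auto
    show "X = L"
      by (rule op_le_antisym; rule step_comparison[OF t]) (simp_all add: X L Lp)
  qed (use L Lp in auto)
  then show "power_mean_pos n t w A \<in> op_interval m M"
    "step t (power_mean_pos n t w A) = power_mean_pos n t w A" using L by auto
qed

lemma power_mean_pos_pos_def: "0 < t \<Longrightarrow> t \<le> 1 \<Longrightarrow> power_mean_pos n t w A \<in> pos_def_ops"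
  using power_mean_pos(1) m by (blast intro: pos_defI)

lemma power_mean_pos_le_arith:
  assumes t: "0 < t" "t \<le> 1"
  shows "power_mean_pos n t w A \<preceq> (\<Sum>k=1..n. w k *\<^sub>R A k)"
proof -
  let ?P = "power_mean_pos n t w A" and ?S = "\<Sum>k=1..n. w k *\<^sub>R A k"
  have "?P \<preceq> (1 - t) *\<^sub>R ?P + t *\<^sub>R ?S"
    using step_le_arith[of t ?P] power_mean_pos(2)[OF t] power_mean_pos_pos_def[OF t] t by simp
  then have "t *\<^sub>R ?P \<preceq> t *\<^sub>R ?S" by (simp add: op_le_def algebra_simps)
  from op_le_scaleR[OF this, of "1 / t"] t show ?thesis by simp
qed

text \<open>The fixed point equation of the power means in normalized form \<open>moment t X = I\<close>, which makes
  sense for exponents of both signs.\<close>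

definition moment :: "real \<Rightarrow> 'a op \<Rightarrow> 'a op" where
  "moment s X = (\<Sum>k=1..n. w k *\<^sub>R fun_op (\<lambda>b. b powr s) (normalized X (A k)))"

lemma step_eq_moment: "step t X = sqrt_op X o\<^sub>L moment t X o\<^sub>L sqrt_op X"
  by (simp add: step_def moment_def geo_mean_eq_persp persp_def compose_simps
      bounded_bilinear.sum_left[OF bounded_bilinear_blinfun_compose]
      bounded_bilinear.sum_right[OF bounded_bilinear_blinfun_compose])

text \<open>By homogeneity the hypothesis says exactly that c X is a supersolution: the factors
  c^(1-t) and c^t combine to c.\<close>

lemma power_mean_pos_le:
  assumes t: "0 < t" "t \<le> 1" and X: "X \<in> pos_def_ops" and c: "0 < c"
    and le: "moment t X \<preceq> (c powr t) *\<^sub>R id_blinfun"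
  shows "power_mean_pos n t w A \<preceq> c *\<^sub>R X"
proof (rule step_comparison[OF t power_mean_pos_pos_def[OF t]])
  show "c *\<^sub>R X \<in> pos_def_ops" by (rule pos_def_scaleR[OF X c])
  have "step t (c *\<^sub>R X) = c powr (1 - t) *\<^sub>R (sqrt_op X o\<^sub>L moment t X o\<^sub>L sqrt_op X)"
    by (simp only: step_scaleR[OF X c] step_eq_moment[of t X])
  also have "\<dots> \<preceq> c powr (1 - t) *\<^sub>R (sqrt_op X o\<^sub>L ((c powr t) *\<^sub>R id_blinfun) o\<^sub>L sqrt_op X)"
    by (intro op_le_scaleR op_le_sandwich le sqrt_op_sa X) simp
  also have "\<dots> = c *\<^sub>R X"
    using c by (simp add: compose_simps sqrt_op_square[OF X] flip: powr_add)
  finally show "step t (c *\<^sub>R X) \<preceq> c *\<^sub>R X" .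
qed (simp add: power_mean_pos(2)[OF t])

text \<open>The dual statement: X / c is a subsolution.\<close>

lemma power_mean_pos_ge:
  assumes t: "0 < t" "t \<le> 1" and X: "X \<in> pos_def_ops" and c: "0 < c"
    and le: "(c powr (- t)) *\<^sub>R id_blinfun \<preceq> moment t X"
  shows "X \<preceq> c *\<^sub>R power_mean_pos n t w A"
proof -
  have c': "0 < 1 / c" using c by simp
  have "(1 / c) *\<^sub>R X \<preceq> power_mean_pos n t w A"
  proof (rule step_comparison[OF t _ _ power_mean_pos_pos_def[OF t]])
    show "(1 / c) *\<^sub>R X \<in> pos_def_ops" by (rule pos_def_scaleR[OF X c'])
    have "(1 / c) powr (1 - t) * c powr (- t) = c powr (- (1 - t)) * c powr (- t)"
      using c by (simp add: powr_divide powr_minus_divide del: minus_diff_eq)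
    also have "\<dots> = c powr (-1)" by (simp flip: powr_add)
    also have "\<dots> = 1 / c" using c by (simp add: powr_minus_divide)
    finally have e: "(1 / c) powr (1 - t) * c powr (- t) = 1 / c" .
    have "(1 / c) *\<^sub>R X = (1 / c) powr (1 - t) *\<^sub>R (sqrt_op X o\<^sub>L ((c powr (- t)) *\<^sub>R id_blinfun) o\<^sub>L sqrt_op X)"
      by (simp add: compose_simps sqrt_op_square[OF X] e)
    also have "\<dots> \<preceq> (1 / c) powr (1 - t) *\<^sub>R (sqrt_op X o\<^sub>L moment t X o\<^sub>L sqrt_op X)"
      by (intro op_le_scaleR op_le_sandwich le sqrt_op_sa X) simp
    also have "\<dots> = step t ((1 / c) *\<^sub>R X)"
      by (simp only: step_scaleR[OF X c'] step_eq_moment[of t X])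
    finally show "(1 / c) *\<^sub>R X \<preceq> step t ((1 / c) *\<^sub>R X)" .
  qed (simp add: power_mean_pos(2)[OF t])
  from op_le_scaleR[OF this, of c] c show ?thesis by simp
qed

lemma moment_power_mean_pos:
  assumes t: "0 < t" "t \<le> 1"
  shows "moment t (power_mean_pos n t w A) = id_blinfun"
proof -
  let ?P = "power_mean_pos n t w A"
  note P = power_mean_pos_pos_def[OF t]
  have "sqrt_op ?P o\<^sub>L moment t ?P o\<^sub>L sqrt_op ?P = ?P"
    using power_mean_pos(2)[OF t] by (simp add: step_eq_moment)
  then have "moment t ?P = isqrt_op ?P o\<^sub>L ?P o\<^sub>L isqrt_op ?P"
    using isqrt_sandwich[OF P, of "moment t ?P"] by simp
  also have "\<dots> = id_blinfun" using normalized_self[OF P] by (simp add: normalized_def)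
  finally show ?thesis .
qed

lemma weighted_tuple_inv: "weighted_tuple n w (\<lambda>k. inv_op (A k)) (inverse M) (inverse m)"
  using w m mM M_pos A by unfold_locales (auto intro: inv_op_interval le_imp_inverse_le)

text \<open>For s < 0, inverting the tuple and the mean inverts every normalized operator, and
  flipping the exponent undoes this. Hence the moment equation holds with the exponent s itself, and
  both signs can be compared by the same scalar estimate.\<close>

lemma power_mean_props:
  assumes s: "s \<in> {-1..1}" "s \<noteq> 0"
  shows "power_mean n s w A \<in> op_interval m M" "moment s (power_mean n s w A) = id_blinfun"
proof -
  interpret inv: weighted_tuple n w "\<lambda>k. inv_op (A k)" "inverse M" "inverse m"
    by (rule weighted_tuple_inv)
  have "power_mean n s w A \<in> op_interval m M \<and> moment s (power_mean n s w A) = id_blinfun"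
  proof (cases "0 < s")
    case True
    then show ?thesis
      using s power_mean_pos(1)[of s] moment_power_mean_pos[of s] by (auto simp: power_mean_def)
  next
    case False
    then have u: "0 < - s" "- s \<le> 1" using s by auto
    define Y where "Y = power_mean_pos n (- s) w (\<lambda>k. inv_op (A k))"
    have X: "power_mean n s w A = inv_op Y" using False by (simp add: power_mean_def Y_def)
    have Yp: "Y \<in> pos_def_ops" unfolding Y_def by (rule inv.power_mean_pos_pos_def[OF u])
    have "Y \<in> op_interval (inverse M) (inverse m)"
      unfolding Y_def by (rule inv.power_mean_pos(1)[OF u])
    from inv_op_interval[OF this] have i: "inv_op Y \<in> op_interval m M" using M_pos by simp
    have "fun_op (\<lambda>b. b powr (- s)) (normalized Y (inv_op (A k))) = fun_op (\<lambda>b. b powr s) (normalized (inv_op Y) (A k))"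
      if "k \<in> {1..n}" for k
      using that fun_op_powr_inv_op[OF normalized_pos_def[OF inv_op_pos_def[OF Yp] A_pos_def], of k "- s"]
      by (simp add: normalized_inv_op[OF Yp A_pos_def])
    then have "moment s (inv_op Y) = inv.moment (- s) Y"
      unfolding moment_def inv.moment_def by (intro sum.cong) auto
    then show ?thesis
      using i inv.moment_power_mean_pos[OF u] unfolding X by (simp add: Y_def)
  qed
  then show "power_mean n s w A \<in> op_interval m M" "moment s (power_mean n s w A) = id_blinfun" by auto
qed

lemma power_mean_le_arith: "0 < t \<Longrightarrow> t \<le> 1 \<Longrightarrow> power_mean n t w A \<preceq> (\<Sum>k=1..n. w k *\<^sub>R A k)"
  using power_mean_pos_le_arith by (simp add: power_mean_def)

lemma power_mean_ge_harm:
  assumes "0 < t" "t \<le> 1"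
  shows "2 *\<^sub>R id_blinfun - (\<Sum>k=1..n. w k *\<^sub>R inv_op (A k)) \<preceq> power_mean n (- t) w A"
proof -
  interpret inv: weighted_tuple n w "\<lambda>k. inv_op (A k)" "inverse M" "inverse m"
    by (rule weighted_tuple_inv)
  let ?Y = "power_mean_pos n t w (\<lambda>k. inv_op (A k))"
  have "2 *\<^sub>R id_blinfun - (\<Sum>k=1..n. w k *\<^sub>R inv_op (A k)) \<preceq> 2 *\<^sub>R id_blinfun - ?Y"
    using inv.power_mean_pos_le_arith[OF assms] by (simp add: op_le_def)
  also have "\<dots> \<preceq> inv_op ?Y"
    by (rule two_minus_le_inv_op[OF inv.power_mean_pos_pos_def[OF assms]])
  finally show ?thesis using assms by (simp add: power_mean_def)
qed

end

section \<open>The Karcher mean\<close>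

lemma exp_second_order:
  fixes x :: real
  assumes "\<bar>x\<bar> \<le> L"
  shows "0 \<le> exp x - 1 - x" "exp x - 1 - x \<le> exp L * x\<^sup>2"
proof -
  show "0 \<le> exp x - 1 - x" using exp_ge_add_one_self[of x] by linarith
  have "exp x * (1 - exp (- x)) \<le> exp x * x"
    using exp_ge_add_one_self[of "- x"] by (intro mult_left_mono) auto
  then have "exp x - 1 - x \<le> x * (exp x - exp 0)"
    by (simp add: right_diff_distrib mult.commute flip: exp_add)
  also have "\<dots> \<le> \<bar>x\<bar> * \<bar>exp x - exp 0\<bar>" by (metis abs_ge_self abs_mult)
  also have "\<dots> \<le> \<bar>x\<bar> * (exp L * \<bar>x - 0\<bar>)"
    using assms by (intro mult_left_mono abs_exp_diff_le) auto
  finally show "exp x - 1 - x \<le> exp L * x\<^sup>2" by (simp add: power2_eq_square mult_ac)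
qed

lemma powr_second_order:
  fixes b s :: real
  assumes "0 < b" "\<bar>ln b\<bar> \<le> L" "\<bar>s\<bar> \<le> 1"
  shows "0 \<le> b powr s - 1 - s * ln b" "b powr s - 1 - s * ln b \<le> exp L * L\<^sup>2 * s\<^sup>2"
proof -
  have sl: "\<bar>s * ln b\<bar> \<le> L"
    using mult_mono[OF assms(3,2)] by (simp add: abs_mult)
  note e = exp_second_order[OF sl]
  show "0 \<le> b powr s - 1 - s * ln b" using e(1) assms(1) by (simp add: powr_def)
  have "(ln b)\<^sup>2 \<le> L\<^sup>2" using assms(2) by (metis abs_ge_zero power2_abs power_mono)
  then have "exp L * (s * ln b)\<^sup>2 \<le> exp L * (L\<^sup>2 * s\<^sup>2)"
    unfolding power_mult_distrib mult.commute[of "L\<^sup>2"] by (intro mult_left_mono) auto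
  from order_trans[OF e(2) this] show "b powr s - 1 - s * ln b \<le> exp L * L\<^sup>2 * s\<^sup>2"
    using assms(1) by (simp add: powr_def mult.assoc)
qed

text \<open>Both difference quotients approximate ln b to first order. In the combination shown the
  logarithm cancels, and only the two quadratic remainders are left; s may have either sign.\<close>

lemma powr_difference_quotients:
  fixes b s t :: real
  assumes "0 < b" "\<bar>ln b\<bar> \<le> L" "\<bar>s\<bar> \<le> 1" "s \<noteq> 0" "0 < t" "t \<le> 1"
  shows "\<bar>b powr t - 1 - t / s * (b powr s - 1)\<bar> \<le> exp L * L\<^sup>2 * t * (t + \<bar>s\<bar>)"
proof -
  define K where "K = exp L * L\<^sup>2"
  define r where "r u = b powr u - 1 - u * ln b" for u
  have r: "0 \<le> r u" "r u \<le> K * u\<^sup>2" if "\<bar>u\<bar> \<le> 1" for u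
    using powr_second_order[OF assms(1,2) that] by (auto simp: r_def K_def)
  have "b powr t - 1 - t / s * (b powr s - 1) = r t - t / s * r s"
    using assms(4) by (simp add: r_def field_simps)
  also have "\<bar>\<dots>\<bar> \<le> \<bar>r t\<bar> + \<bar>t / s * r s\<bar>" by (rule abs_triangle_ineq4)
  also have "\<dots> \<le> K * t\<^sup>2 + t / \<bar>s\<bar> * (K * s\<^sup>2)"
    using r[of t] r[of s] assms by (intro add_mono) (auto simp: abs_mult intro!: mult_left_mono divide_right_mono)
  also have "t / \<bar>s\<bar> * (K * s\<^sup>2) = K * t * \<bar>s\<bar>"
    using assms(4) by (simp add: power2_eq_square abs_if field_simps)
  finally show ?thesis by (simp add: K_def power2_eq_square algebra_simps)
qed

text \<open>Closeness in the Thompson metric implies closeness in norm on a bounded set of positive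
  operators.\<close>

lemma norm_diff_le_Thompson:
  fixes P X :: "'a::chilbert_space op"
  assumes "P \<in> op_interval 0 M" "X \<in> op_interval 0 M" "0 \<le> M" "1 \<le> c" "P \<preceq> c *\<^sub>R X" "X \<preceq> c *\<^sub>R P"
  shows "norm (P - X) \<le> M * (c - 1)"
proof (rule norm_diff_le_op_le)
  have *: "Y - Z \<preceq> (M * (c - 1)) *\<^sub>R id_blinfun" if "Y \<preceq> c *\<^sub>R Z" "Z \<in> op_interval 0 M" for Y Z :: "'a op"
  proof -
    have "Y - Z \<preceq> (c - 1) *\<^sub>R Z" using that(1) by (simp add: op_le_def algebra_simps)
    also have "\<dots> \<preceq> (c - 1) *\<^sub>R (M *\<^sub>R id_blinfun)"
      using that(2) assms(4) by (intro op_le_scaleR) (auto simp: op_interval_iff)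
    finally show ?thesis by (simp add: mult.commute)
  qed
  show "P - X \<preceq> (M * (c - 1)) *\<^sub>R id_blinfun" "X - P \<preceq> (M * (c - 1)) *\<^sub>R id_blinfun"
    using * assms by auto
qed (use assms in simp)

context weighted_tuple
begin

text \<open>\<open>ell\<close> bounds |ln b| for b in [m/M, M/m], which contains the spectra of all
  normalized operators. \<open>K\<close> is the constant in
  \<open>powr_difference_quotients\<close>, \<open>K'\<close> the Lipschitz constant of b^t in t,
  and \<open>err\<close> the norm bound resulting from a Thompson factor exp(2 K u).\<close>

definition ell :: real where "ell = ln (M / m)"
definition K :: real where "K = exp ell * ell\<^sup>2"
definition K' :: real where "K' = exp ell * ell"
definition err :: "real \<Rightarrow> real" where "err u = M * (exp (2 * K * u) - 1)"

lemma ell_nonneg: "0 \<le> ell"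
  using m mM by (auto simp: ell_def)

lemma K_nonneg: "0 \<le> K" "0 \<le> K'"
  using ell_nonneg by (auto simp: K_def K'_def)

lemma normalized_A:
  assumes "X \<in> op_interval m M" "k \<in> {1..n}"
  shows "normalized X (A k) \<in> op_interval (m / M) (M / m)"
  using assms A M_pos m by (intro normalized_op_interval) auto

lemma normalized_range:
  assumes "b \<in> {m / M..M / m}"
  shows "0 < b" "\<bar>ln b\<bar> \<le> ell"
proof -
  show "0 < b" using assms m M_pos by (meson atLeastAtMost_iff divide_pos_pos less_le_trans)
  have "ln (m / M) = - ell" using m M_pos by (simp add: ell_def ln_div)
  then show "\<bar>ln b\<bar> \<le> ell"
    using abs_ln_le[OF _ assms] m M_pos ell_nonneg by (simp add: ell_def)
qed

lemma continuous_on_powr_range: "continuous_on {m / M..M / m} (\<lambda>b. b powr s)"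
  using m M_pos by (intro continuous_on_powr_pos) auto

text \<open>On the relevant spectra b^t stays within D of 1 + (t/s)(b^s - 1). In the weighted sum
  the second part cancels, since the weights sum to one and the moment of order s is the
  identity.\<close>

lemma moment_compare:
  assumes X: "X \<in> op_interval m M" and mom: "moment s X = id_blinfun"
    and s: "s \<in> {-1..1}" "s \<noteq> 0" and t: "0 < t" "t \<le> 1"
  defines "D \<equiv> K * t * (t + \<bar>s\<bar>)"
  shows "moment t X \<preceq> (1 + D) *\<^sub>R id_blinfun" "(1 - D) *\<^sub>R id_blinfun \<preceq> moment t X"
proof -
  define F where "F u k = fun_op (\<lambda>b. b powr u) (normalized X (A k))" for u k
  define c where "c = t / s"
  have aff: "fun_op (\<lambda>b. a + c * b powr s) (normalized X (A k)) = a *\<^sub>R id_blinfun + c *\<^sub>R F s k"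
    if "k \<in> {1..n}" for a k
    using normalized_A[OF X that]
    by (simp add: F_def fun_op_add fun_op_const fun_op_scale continuous_on_powr_range continuous_on_mult_left)
  have sc: "\<bar>b powr t - 1 - c * (b powr s - 1)\<bar> \<le> D" if "b \<in> {m / M..M / m}" for b
    using powr_difference_quotients[OF normalized_range[OF that], of s t] s t
    by (auto simp: c_def D_def K_def abs_le_iff)
  have sum: "(\<Sum>k=1..n. w k *\<^sub>R (a *\<^sub>R id_blinfun + c *\<^sub>R F s k)) = (a + c) *\<^sub>R id_blinfun" for a
  proof -
    have "(\<Sum>k=1..n. w k *\<^sub>R (a *\<^sub>R id_blinfun + c *\<^sub>R F s k))
        = (\<Sum>k=1..n. w k *\<^sub>R (a *\<^sub>R id_blinfun)) + c *\<^sub>R moment s X"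
      by (simp add: moment_def F_def scaleR_add_right sum.distrib scaleR_sum_right mult.commute)
    then show ?thesis by (simp only: weighted_sum_const mom scaleR_add_left)
  qed
  have up: "F t k \<preceq> (1 + D - c) *\<^sub>R id_blinfun + c *\<^sub>R F s k" if k: "k \<in> {1..n}" for k
    unfolding aff[OF k, symmetric] unfolding F_def
  proof (rule fun_op_mono[OF normalized_A[OF X k]])
    fix b assume "b \<in> {m / M..M / m}"
    from sc[OF this] show "b powr t \<le> 1 + D - c + c * b powr s"
      by (simp add: abs_le_iff algebra_simps)
  qed (intro continuous_intros continuous_on_powr_range)+
  have lo: "(1 - D - c) *\<^sub>R id_blinfun + c *\<^sub>R F s k \<preceq> F t k" if k: "k \<in> {1..n}" for k
    unfolding aff[OF k, symmetric] unfolding F_def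
  proof (rule fun_op_mono[OF normalized_A[OF X k]])
    fix b assume "b \<in> {m / M..M / m}"
    from sc[OF this] show "1 - D - c + c * b powr s \<le> b powr t"
      by (simp add: abs_le_iff algebra_simps)
  qed (intro continuous_intros continuous_on_powr_range)+
  have "moment t X \<preceq> (\<Sum>k=1..n. w k *\<^sub>R ((1 + D - c) *\<^sub>R id_blinfun + c *\<^sub>R F s k))"
    unfolding moment_def F_def[symmetric]
    by (intro op_le_sum op_le_scaleR up) (auto simp: w_pos less_imp_le)
  then show "moment t X \<preceq> (1 + D) *\<^sub>R id_blinfun" by (simp only: sum diff_add_cancel)
  have "(\<Sum>k=1..n. w k *\<^sub>R ((1 - D - c) *\<^sub>R id_blinfun + c *\<^sub>R F s k)) \<preceq> moment t X"
    unfolding moment_def F_def[symmetric]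
    by (intro op_le_sum op_le_scaleR lo) (auto simp: w_pos less_imp_le)
  then show "(1 - D) *\<^sub>R id_blinfun \<preceq> moment t X" by (simp only: sum diff_add_cancel)
qed

lemma power_mean_op_interval_0:
  "s \<in> {-1..1} \<Longrightarrow> s \<noteq> 0 \<Longrightarrow> power_mean n s w A \<in> op_interval 0 M"
  using power_mean_props(1)[of s] m by (auto intro: op_interval_mono)

text \<open>The mean X with exponent s almost solves the equation with exponent t: its moment is
  within D of the identity. Since D has a factor t, the t-th root demanded by homogeneity leaves
  only the factor c = exp(2 K (t + |s|)), for which \<open>c powr t\<close> is exp(2 D) and absorbs
  both 1 + D and, inverted, 1 - D.\<close>

lemma power_mean_close:
  assumes s: "s \<in> {-1..1}" "s \<noteq> 0" and t: "0 < t" "t \<le> 1"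
    and D: "K * t * (t + \<bar>s\<bar>) \<le> 1 / 2"
  shows "norm (power_mean n t w A - power_mean n s w A) \<le> err (t + \<bar>s\<bar>)"
proof -
  define X D c where "X = power_mean n s w A" and "D = K * t * (t + \<bar>s\<bar>)" and "c = exp (2 * K * (t + \<bar>s\<bar>))"
  have X: "X \<in> op_interval m M" "moment s X = id_blinfun"
    unfolding X_def using power_mean_props[OF s] by auto
  have Xp: "X \<in> pos_def_ops" using X(1) m by (rule pos_defI)
  have D0: "0 \<le> D" using K_nonneg t by (simp add: D_def)
  have c: "1 \<le> c" "0 < c" using K_nonneg t by (simp_all add: c_def)
  have ct: "c powr t = exp (2 * D)" "c powr (- t) = exp (- (2 * D))"
    by (simp_all add: c_def D_def powr_def mult_ac)
  have P: "power_mean n t w A = power_mean_pos n t w A" using t by (simp add: power_mean_def)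
  note mom = moment_compare[OF X s t, folded D_def]
  have "1 + D \<le> exp (2 * D)" using exp_ge_add_one_self[of "2 * D"] D0 by linarith
  then have "moment t X \<preceq> (c powr t) *\<^sub>R id_blinfun"
    unfolding ct by (intro op_le_trans[OF mom(1)] scaleR_id_mono)
  then have 1: "power_mean n t w A \<preceq> c *\<^sub>R X"
    unfolding P by (rule power_mean_pos_le[OF t Xp c(2)])
  \<comment> \<open>The place where D <= 1/2 enters: (1 + 2 D)(1 - D) is at least 1 exactly because
    D (1 - 2 D) is nonnegative.\<close>
  have "exp (- (2 * D)) \<le> 1 - D"
  proof -
    have "exp (- (2 * D)) = 1 / exp (2 * D)" by (simp add: exp_minus inverse_eq_divide)
    also have "\<dots> \<le> 1 / (1 + 2 * D)"
      using D0 exp_ge_add_one_self[of "2 * D"] by (intro divide_left_mono) auto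
    also have "\<dots> \<le> 1 - D"
      using mult_left_mono[OF D[folded D_def] D0] D0 by (simp add: divide_simps algebra_simps)
    finally show ?thesis .
  qed
  then have "(c powr (- t)) *\<^sub>R id_blinfun \<preceq> moment t X"
    unfolding ct by (intro op_le_trans[OF scaleR_id_mono mom(2)])
  then have 2: "X \<preceq> c *\<^sub>R power_mean n t w A"
    unfolding P by (rule power_mean_pos_ge[OF t Xp c(2)])
  have "norm (power_mean n t w A - X) \<le> M * (c - 1)"
    using power_mean_op_interval_0[OF s] power_mean_op_interval_0[of t] t M_pos c 1 2
    by (intro norm_diff_le_Thompson) (auto simp: X_def)
  then show ?thesis by (simp add: X_def err_def c_def)
qed

lemma err_mono: "u \<le> v \<Longrightarrow> err u \<le> err v"
  unfolding err_def using M_pos K_nonneg by (auto intro!: mult_left_mono)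

lemma tendsto_err: "(f \<longlongrightarrow> u) F \<Longrightarrow> ((\<lambda>x. err (f x)) \<longlongrightarrow> err u) F"
  unfolding err_def by (intro tendsto_intros)

lemma err_0 [simp]: "err 0 = 0"
  by (simp add: err_def)

lemma ex_power_mean_limit:
  "\<exists>L. \<forall>s\<in>{-1..1}. s \<noteq> 0 \<longrightarrow> norm (power_mean n s w A - L) \<le> err \<bar>s\<bar>"
proof -
  \<comment> \<open>Chosen so that K * \<tau> * (\<tau> + |s|) <= 2 K d <= 1/2 for every \<tau> <= d
    and |s| <= 1. The reference exponents are positive, as \<open>power_mean_close\<close> requires
    for one of the two; s is arbitrary.\<close>
  define d where "d = 1 / (4 * K + 4)"
  have d: "0 < d" "d \<le> 1" "2 * (K * d) \<le> 1 / 2" using K_nonneg by (auto simp: d_def divide_simps)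
  define \<tau> where "\<tau> j = d / real (Suc j)" for j
  have \<tau>: "0 < \<tau> j" "\<tau> j \<le> d" "\<tau> j \<le> 1" for j
  proof -
    show "0 < \<tau> j" using d by (simp add: \<tau>_def)
    show "\<tau> j \<le> d" using d by (simp add: \<tau>_def divide_le_eq mult_le_cancel_left1)
    then show "\<tau> j \<le> 1" using d by simp
  qed
  have \<tau>_mono: "\<tau> j \<le> \<tau> i" if "i \<le> j" for i j
    unfolding \<tau>_def using d that by (intro divide_left_mono) auto
  have \<tau>_lim: "\<tau> \<longlonglongrightarrow> 0"
    unfolding \<tau>_def by (rule LIMSEQ_Suc[OF lim_const_over_n])
  have close: "norm (power_mean n (\<tau> j) w A - power_mean n s w A) \<le> err (\<tau> j + \<bar>s\<bar>)"
    if s: "s \<in> {-1..1}" "s \<noteq> 0" for s j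
  proof (rule power_mean_close[OF s \<tau>(1,3)])
    have "K * \<tau> j * (\<tau> j + \<bar>s\<bar>) \<le> K * d * 2"
      using K_nonneg s \<tau>[of j] d by (intro mult_mono) (auto simp: abs_le_iff)
    then show "K * \<tau> j * (\<tau> j + \<bar>s\<bar>) \<le> 1 / 2" using d by simp
  qed
  have "Cauchy (\<lambda>j. power_mean n (\<tau> j) w A)"
  proof (rule metric_CauchyI)
    fix e :: real assume "0 < e"
    have "(\<lambda>j. err (\<tau> j + \<tau> j)) \<longlonglongrightarrow> err (0 + 0)" by (intro tendsto_err tendsto_add \<tau>_lim)
    then have "\<forall>\<^sub>F j in sequentially. err (\<tau> j + \<tau> j) < e"
      using \<open>0 < e\<close> by (intro order_tendstoD) auto
    then obtain N where N: "err (\<tau> N + \<tau> N) < e" by (auto simp: eventually_sequentially)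
    have "dist (power_mean n (\<tau> i) w A) (power_mean n (\<tau> j) w A) < e" if "i \<ge> N" "j \<ge> N" for i j
    proof -
      have "dist (power_mean n (\<tau> i) w A) (power_mean n (\<tau> j) w A) \<le> err (\<tau> i + \<bar>\<tau> j\<bar>)"
        unfolding dist_norm using \<tau>[of j] by (intro close) auto
      also have "\<dots> \<le> err (\<tau> N + \<tau> N)"
        using \<tau>_mono that \<tau>[of j] by (intro err_mono add_mono) auto
      finally show ?thesis using N by simp
    qed
    then show "\<exists>N. \<forall>i\<ge>N. \<forall>j\<ge>N. dist (power_mean n (\<tau> i) w A) (power_mean n (\<tau> j) w A) < e" by blast
  qed
  then obtain L where L: "(\<lambda>j. power_mean n (\<tau> j) w A) \<longlonglongrightarrow> L"
    using Cauchy_convergent convergent_def by blast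
  have "norm (power_mean n s w A - L) \<le> err \<bar>s\<bar>" if s: "s \<in> {-1..1}" "s \<noteq> 0" for s
  proof (rule LIMSEQ_le)
    show "(\<lambda>j. norm (power_mean n s w A - power_mean n (\<tau> j) w A)) \<longlonglongrightarrow> norm (power_mean n s w A - L)"
      by (intro tendsto_intros L)
    have "(\<lambda>j. err (\<tau> j + \<bar>s\<bar>)) \<longlonglongrightarrow> err (0 + \<bar>s\<bar>)"
      by (intro tendsto_err tendsto_add \<tau>_lim tendsto_const)
    then show "(\<lambda>j. err (\<tau> j + \<bar>s\<bar>)) \<longlonglongrightarrow> err \<bar>s\<bar>" by simp
    show "\<exists>N. \<forall>j\<ge>N. norm (power_mean n s w A - power_mean n (\<tau> j) w A) \<le> err (\<tau> j + \<bar>s\<bar>)"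
      using close[OF s] by (auto simp: norm_minus_commute)
  qed
  then show ?thesis by blast
qed

text \<open>Convergence holds in operator norm, hence strongly as the definition asks; the strong
  limit is unique because 0 is a limit point of {-1..1}.\<close>

lemma tendsto_karcher_mean:
  "((\<lambda>s. power_mean n s w A) \<longlongrightarrow> karcher_mean n w A) (at 0 within {-1..1})"
proof -
  obtain L where L: "\<And>s. s \<in> {-1..1} \<Longrightarrow> s \<noteq> 0 \<Longrightarrow> norm (power_mean n s w A - L) \<le> err \<bar>s\<bar>"
    using ex_power_mean_limit by blast
  have "((\<lambda>s. power_mean n s w A - L) \<longlongrightarrow> 0) (at 0 within {-1..1})"
  proof (rule Lim_null_comparison)
    show "\<forall>\<^sub>F s in at 0 within {-1..1}. norm (power_mean n s w A - L) \<le> err \<bar>s\<bar>"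
      unfolding eventually_at_filter by (rule always_eventually) (use L in auto)
    have "((\<lambda>s. err \<bar>s\<bar>) \<longlongrightarrow> err \<bar>0\<bar>) (at 0 within {-1..1})"
      by (intro tendsto_err tendsto_intros)
    then show "((\<lambda>s. err \<bar>s\<bar>) \<longlongrightarrow> 0) (at 0 within {-1..1})" by simp
  qed
  then have lim: "((\<lambda>s. power_mean n s w A) \<longlongrightarrow> L) (at 0 within {-1..1})" by (simp add: LIM_zero_iff)
  have nontriv: "at 0 within {-1..1} \<noteq> (bot :: real filter)"
    by (simp add: at_within_Icc_at)
  have "karcher_mean n w A = L"
    unfolding karcher_mean_def
  proof (rule the_equality)
    show "\<forall>x. ((\<lambda>t. power_mean n t w A x) \<longlongrightarrow> L x) (at 0 within {-1..1})"
      using tendsto_blinfun_apply[OF lim] by blast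
    fix L' assume L': "\<forall>x. ((\<lambda>t. power_mean n t w A x) \<longlongrightarrow> blinfun_apply L' x) (at 0 within {-1..1})"
    show "L' = L"
      by (rule blinfun_eqI) (rule tendsto_unique[OF nontriv L'[rule_format] tendsto_blinfun_apply[OF lim]])
  qed
  then show ?thesis using lim by simp
qed

lemma karcher_mean_LIMSEQ:
  assumes "\<sigma> \<longlonglongrightarrow> 0" "\<And>j. \<sigma> j \<in> {-1..1}" "\<And>j. \<sigma> j \<noteq> 0"
  shows "(\<lambda>j. power_mean n (\<sigma> j) w A) \<longlonglongrightarrow> karcher_mean n w A"
  by (rule filterlim_compose[OF tendsto_karcher_mean]) (use assms in \<open>auto simp: filterlim_at\<close>)

lemma inverse_Suc_LIMSEQ:
  "(\<lambda>j. 1 / real (Suc j)) \<longlonglongrightarrow> 0" "(\<lambda>j. - (1 / real (Suc j))) \<longlonglongrightarrow> 0"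
  using LIMSEQ_Suc[OF lim_const_over_n[of "1 :: real"]] tendsto_minus[OF LIMSEQ_Suc[OF lim_const_over_n[of "1 :: real"]]] by simp_all

lemma karcher_mean_LIMSEQ_pos: "(\<lambda>j. power_mean n (1 / real (Suc j)) w A) \<longlonglongrightarrow> karcher_mean n w A"
  and karcher_mean_LIMSEQ_neg: "(\<lambda>j. power_mean n (- (1 / real (Suc j))) w A) \<longlonglongrightarrow> karcher_mean n w A"
  by (rule karcher_mean_LIMSEQ; use inverse_Suc_LIMSEQ in \<open>simp add: divide_simps\<close>)+

lemma karcher_mean_op_interval: "karcher_mean n w A \<in> op_interval m M"
  by (rule op_interval_LIMSEQ[OF karcher_mean_LIMSEQ_pos]) (rule power_mean_props(1); simp add: divide_simps)

lemma karcher_mean_le_arith: "karcher_mean n w A \<preceq> (\<Sum>k=1..n. w k *\<^sub>R A k)"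
  by (rule op_le_LIMSEQ[OF karcher_mean_LIMSEQ_pos tendsto_const])
    (rule power_mean_le_arith; simp add: divide_simps)

text \<open>The arithmetic bound was inherited from positive exponents, this one from negative ones;
  both bounds concern the same operator because the limit at 0 is two-sided.\<close>

lemma karcher_mean_ge_harm:
  "2 *\<^sub>R id_blinfun - (\<Sum>k=1..n. w k *\<^sub>R inv_op (A k)) \<preceq> karcher_mean n w A"
  by (rule op_le_LIMSEQ[OF tendsto_const karcher_mean_LIMSEQ_neg])
    (rule power_mean_ge_harm; simp add: divide_simps)

text \<open>Both weight vectors sum to one, so new weights change the moment at X only by G, the sum
  of (w'_k - w_k)(F_k - I). Here F_k - I is of size O(t) because b^t - 1 is, so the t-th root again
  leaves a factor independent of t, and the bound survives t tending to 0.\<close>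

lemma power_mean_weights_le:
  assumes w': "w' \<in> weight_simplex n" and t: "0 < t" "t \<le> 1"
  shows "power_mean n t w' A \<preceq> exp (K' * (\<Sum>k=1..n. \<bar>w' k - w k\<bar>)) *\<^sub>R power_mean n t w A"
proof -
  interpret w': weighted_tuple n w' A m M using w' m mM A by unfold_locales
  define X \<delta> where "X = power_mean n t w A" and "\<delta> = (\<Sum>k=1..n. \<bar>w' k - w k\<bar>)"
  define F where "F k = fun_op (\<lambda>b. b powr t) (normalized X (A k))" for k
  have t': "t \<in> {-1..1}" "t \<noteq> 0" using t by auto
  have X: "X \<in> op_interval m M" "moment t X = id_blinfun"
    unfolding X_def using power_mean_props[OF t'] by auto
  have Xp: "X \<in> pos_def_ops" using X(1) m by (rule pos_defI)
  have F: "norm (F k - id_blinfun) \<le> K' * t" "F k - id_blinfun \<in> self_adjoint_ops" if k: "k \<in> {1..n}" for k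
  proof -
    note N = normalized_A[OF X(1) k]
    have e: "F k - id_blinfun = fun_op (\<lambda>b. b powr t - 1) (normalized X (A k))"
      by (simp add: F_def fun_op_diff[OF N] fun_op_const[OF N] continuous_on_powr_range)
    have c: "continuous_on {m / M..M / m} (\<lambda>b. b powr t - 1)"
      by (intro continuous_intros continuous_on_powr_range)
    show "norm (F k - id_blinfun) \<le> K' * t"
      unfolding e
    proof (rule norm_fun_op_le[OF N c])
      fix b assume b: "b \<in> {m / M..M / m}"
      show "\<bar>b powr t - 1\<bar> \<le> K' * t"
        using abs_powr_diff_le[OF normalized_range[OF b], of t 0] normalized_range[OF b] t by (simp add: K'_def)
    qed (use K_nonneg t in simp)
    show "F k - id_blinfun \<in> self_adjoint_ops" unfolding e by (rule fun_op_self_adjoint[OF N c])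
  qed
  define G where "G = (\<Sum>k=1..n. (w' k - w k) *\<^sub>R (F k - id_blinfun))"
  have "norm G \<le> (\<Sum>k=1..n. \<bar>w' k - w k\<bar> * (K' * t))"
    unfolding G_def using F by (intro sum_norm_le) (auto intro!: mult_left_mono)
  then have nG: "norm G \<le> K' * \<delta> * t" by (simp add: \<delta>_def sum_distrib_left sum_distrib_right mult_ac)
  have "G \<in> self_adjoint_ops" unfolding G_def using F by (intro self_adjoint_sum self_adjoint_scaleR) auto
  from self_adjoint_op_interval[OF this] have Gle: "G \<preceq> (K' * \<delta> * t) *\<^sub>R id_blinfun"
    using nG by (auto simp: op_interval_iff intro: op_le_trans scaleR_id_mono)
  have "G = (w'.moment t X - (\<Sum>k=1..n. w' k *\<^sub>R id_blinfun)) - (moment t X - (\<Sum>k=1..n. w k *\<^sub>R id_blinfun))"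
    unfolding G_def w'.moment_def moment_def F_def[symmetric]
    by (simp add: scaleR_diff_left scaleR_diff_right sum_subtractf)
  then have "w'.moment t X = id_blinfun + G"
    by (simp only: weighted_sum_const w'.weighted_sum_const X(2)) simp
  also have "\<dots> \<preceq> 1 *\<^sub>R id_blinfun + (K' * \<delta> * t) *\<^sub>R id_blinfun"
    by (intro op_le_add Gle) simp
  also have "\<dots> = (1 + K' * \<delta> * t) *\<^sub>R id_blinfun" by (simp only: scaleR_add_left)
  also have "\<dots> \<preceq> (exp (K' * \<delta>) powr t) *\<^sub>R id_blinfun"
    using exp_ge_add_one_self[of "K' * \<delta> * t"] by (intro scaleR_id_mono) (simp add: powr_def mult_ac)
  finally have "power_mean_pos n t w' A \<preceq> exp (K' * \<delta>) *\<^sub>R X"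
    by (rule w'.power_mean_pos_le[OF t Xp exp_gt_zero])
  then show ?thesis using t by (simp add: power_mean_def X_def \<delta>_def)
qed

lemma karcher_mean_weights_continuous:
  assumes w': "w' \<in> weight_simplex n"
  shows "norm (karcher_mean n w' A - karcher_mean n w A) \<le> M * (exp (K' * (\<Sum>k=1..n. \<bar>w' k - w k\<bar>)) - 1)"
proof -
  interpret w': weighted_tuple n w' A m M using w' m mM A by unfold_locales
  define c where "c = exp (K' * (\<Sum>k=1..n. \<bar>w' k - w k\<bar>))"
  have c: "1 \<le> c" using K_nonneg by (simp add: c_def sum_nonneg)
  have "norm (power_mean n t w' A - power_mean n t w A) \<le> M * (c - 1)" if t: "0 < t" "t \<le> 1" for t
  proof (rule norm_diff_le_Thompson)
    show "power_mean n t w' A \<preceq> c *\<^sub>R power_mean n t w A"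
      unfolding c_def by (rule power_mean_weights_le[OF w' t])
    show "power_mean n t w A \<preceq> c *\<^sub>R power_mean n t w' A"
      using w'.power_mean_weights_le[OF w t] unfolding c_def
      by (subst abs_minus_commute)
  qed (use t c M_pos power_mean_op_interval_0[of t] w'.power_mean_op_interval_0[of t] in auto)
  then have "norm (power_mean n (1 / real (Suc j)) w' A - power_mean n (1 / real (Suc j)) w A) \<le> M * (c - 1)" for j
    by (simp add: divide_simps)
  then show ?thesis
    unfolding c_def[symmetric]
    by (intro LIMSEQ_le_const2[OF tendsto_norm[OF tendsto_diff[OF w'.karcher_mean_LIMSEQ_pos karcher_mean_LIMSEQ_pos]]]) auto
qed

end

section \<open>Bochner integrals of operator-valued functions\<close>

abbreviation "step_integral \<equiv> Bochner_Integration.simple_bochner_integral"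
abbreviation "step_integrable \<equiv> Bochner_Integration.simple_bochner_integrable"

lemma simple_bochner_integrable_finite:
  assumes "emeasure M (space M) \<noteq> \<infinity>" "simple_function M f"
  shows "step_integrable M f"
proof (rule simple_bochner_integrable.intros[OF assms(2)])
  have "{y \<in> space M. f y \<noteq> 0} \<in> sets M"
    using simple_functionD(2)[OF assms(2), of "- {0}"] by (simp add: vimage_def Int_def conj_commute)
  then have "emeasure M {y \<in> space M. f y \<noteq> 0} \<le> emeasure M (space M)"
    by (intro emeasure_mono) auto
  then show "emeasure M {y \<in> space M. f y \<noteq> 0} \<noteq> \<infinity>" using assms(1) by (auto simp: top_unique)
qed

text \<open>On a finite measure space one uniform error sequence yields everything the definition
  asks for: pointwise convergence, convergence of the error integrals, and a Cauchy sequence of step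
  integrals. Separability of the range never enters.\<close>

lemma ex_has_Bochner_integral_uniform_limit:
  fixes f :: "'x \<Rightarrow> 'b::banach"
  assumes fin: "emeasure M (space M) \<noteq> \<infinity>" and s: "\<And>i. simple_function M (s i)"
    and le: "\<And>i x. x \<in> space M \<Longrightarrow> norm (f x - s i x) \<le> e i" and e: "e \<longlonglongrightarrow> 0"
  shows "\<exists>y. has_Bochner_integral M f y"
proof -
  define V where "V = measure M (space M)"
  have V: "emeasure M (space M) = ennreal V" "0 \<le> V"
    using fin by (auto simp: V_def emeasure_eq_ennreal_measure)
  have e': "(\<lambda>i. \<bar>e i\<bar>) \<longlonglongrightarrow> 0" using e by (rule tendsto_rabs_zero)
  note sb = simple_bochner_integrable_finite[OF fin s]
  have diff: "norm (step_integral M (s i) - step_integral M (s j)) \<le> (\<bar>e i\<bar> + \<bar>e j\<bar>) * V" for i j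
  proof -
    let ?g = "\<lambda>x. s i x - s j x"
    have sg: "step_integrable M ?g"
      by (rule simple_bochner_integrable_compose2[OF _ sb sb]) simp
    have "ennreal (norm (step_integral M ?g))
        \<le> ennreal (step_integral M (\<lambda>x. norm (?g x)))"
      by (intro ennreal_leI simple_bochner_integral_norm_bound sg)
    also have "\<dots> = (\<integral>\<^sup>+x. norm (?g x) \<partial>M)"
      by (intro simple_bochner_integral_eq_nn_integral simple_bochner_integrable_compose2[where p="\<lambda>x y. norm (x - y)", OF _ sb sb]) auto
    also have "\<dots> \<le> (\<integral>\<^sup>+x. ennreal (\<bar>e i\<bar> + \<bar>e j\<bar>) \<partial>M)"
    proof (intro nn_integral_mono ennreal_leI)
      fix x assume "x \<in> space M"
      then have "norm (s i x - s j x) \<le> e i + e j"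
        using le[of x i] le[of x j] norm_triangle_ineq4[of "f x - s j x" "f x - s i x"] by simp
      then show "norm (?g x) \<le> \<bar>e i\<bar> + \<bar>e j\<bar>" by linarith
    qed
    also have "\<dots> = ennreal ((\<bar>e i\<bar> + \<bar>e j\<bar>) * V)" by (simp add: V ennreal_mult)
    finally show ?thesis
      using V(2) by (simp add: simple_bochner_integral_diff[OF sb sb])
  qed
  have "Cauchy (\<lambda>i. step_integral M (s i))"
  proof (rule metric_CauchyI)
    fix d :: real assume d: "0 < d"
    have "(\<lambda>i. \<bar>e i\<bar> * V) \<longlonglongrightarrow> 0 * V" by (intro tendsto_intros e')
    then have "\<forall>\<^sub>F i in sequentially. \<bar>e i\<bar> * V < d / 2" using d by (intro order_tendstoD) auto
    then obtain N where N: "\<And>i. i \<ge> N \<Longrightarrow> \<bar>e i\<bar> * V < d / 2" by (auto simp: eventually_sequentially)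
    have "dist (step_integral M (s i)) (step_integral M (s j)) < d"
      if "i \<ge> N" "j \<ge> N" for i j
      using diff[of i j] N[OF that(1)] N[OF that(2)] by (simp add: dist_norm distrib_right)
    then show "\<exists>N. \<forall>i\<ge>N. \<forall>j\<ge>N. dist (step_integral M (s i)) (step_integral M (s j)) < d"
      by blast
  qed
  then obtain y where y: "(\<lambda>i. step_integral M (s i)) \<longlonglongrightarrow> y"
    using Cauchy_convergent convergent_def by blast
  have "(\<lambda>i. s i x) \<longlonglongrightarrow> f x" if "x \<in> space M" for x
  proof -
    have "(\<lambda>i. f x - s i x) \<longlonglongrightarrow> 0"
      by (rule Lim_null_comparison[OF _ e]) (use le[OF that] in auto)
    from tendsto_diff[OF tendsto_const[of "f x"] this] show ?thesis by simp
  qed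
  moreover have "(\<lambda>i. \<integral>\<^sup>+x. ennreal (norm (f x - s i x)) \<partial>M) \<longlonglongrightarrow> 0"
  proof (rule tendsto_sandwich[OF _ _ tendsto_const])
    show "\<forall>\<^sub>F i in sequentially. (\<integral>\<^sup>+x. ennreal (norm (f x - s i x)) \<partial>M) \<le> ennreal (\<bar>e i\<bar> * V)"
    proof (rule always_eventually, rule allI)
      fix i
      have "(\<integral>\<^sup>+x. ennreal (norm (f x - s i x)) \<partial>M) \<le> (\<integral>\<^sup>+x. ennreal \<bar>e i\<bar> \<partial>M)"
        by (intro nn_integral_mono ennreal_leI order_trans[OF le abs_ge_self])
      then show "(\<integral>\<^sup>+x. ennreal (norm (f x - s i x)) \<partial>M) \<le> ennreal (\<bar>e i\<bar> * V)" by (simp add: V ennreal_mult)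
    qed
    have "(\<lambda>i. ennreal (\<bar>e i\<bar> * V)) \<longlonglongrightarrow> ennreal (0 * V)" by (intro tendsto_ennrealI tendsto_intros e')
    then show "(\<lambda>i. ennreal (\<bar>e i\<bar> * V)) \<longlonglongrightarrow> 0" by simp
  qed simp
  ultimately show ?thesis
    unfolding has_Bochner_integral_def by (intro exI[of _ y] exI[of _ s]) (auto simp: sb y intro: AE_I2)
qed

text \<open>The passage from the vector-valued integral to real integrals, where linearity and
  monotonicity are at hand. A bounded functional satisfies the normalization after scaling.\<close>

lemma has_bochner_integral_functional:
  fixes f :: "'x \<Rightarrow> 'b::real_normed_vector" and g :: "'b \<Rightarrow> real"
  assumes f: "has_Bochner_integral M f y" and g: "bounded_linear g" "\<And>z. \<bar>g z\<bar> \<le> norm z"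
    and meas: "(\<lambda>x. g (f x)) \<in> borel_measurable M"
  shows "has_bochner_integral M (\<lambda>x. g (f x)) (g y)"
proof -
  obtain s where s: "\<And>i. step_integrable M (s i)"
    and lim: "(\<lambda>i. \<integral>\<^sup>+x. ennreal (norm (f x - s i x)) \<partial>M) \<longlonglongrightarrow> 0"
    and y: "(\<lambda>i. step_integral M (s i)) \<longlonglongrightarrow> y"
    using f by (auto simp: has_Bochner_integral_def)
  note lin = bounded_linear.linear[OF g(1)]
  show ?thesis
  proof (rule has_bochner_integral.intros[OF meas, where s="\<lambda>i x. g (s i x)"])
    show "step_integrable M (\<lambda>x. g (s i x))" for i
      by (rule simple_bochner_integrable_compose2[where p="\<lambda>x y. g x", OF _ s s]) (simp add: linear_0[OF lin])
    show "(\<lambda>i. \<integral>\<^sup>+x. ennreal (norm (g (f x) - g (s i x))) \<partial>M) \<longlonglongrightarrow> 0"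
    proof (rule tendsto_sandwich[OF _ _ tendsto_const lim])
      show "\<forall>\<^sub>F i in sequentially. (\<integral>\<^sup>+x. ennreal (norm (g (f x) - g (s i x))) \<partial>M)
          \<le> (\<integral>\<^sup>+x. ennreal (norm (f x - s i x)) \<partial>M)"
        by (intro always_eventually allI nn_integral_mono ennreal_leI)
          (simp add: g(2) flip: linear_diff[OF lin])
    qed simp
    have "(\<lambda>i. g (step_integral M (s i))) \<longlonglongrightarrow> g y"
      by (rule bounded_linear.tendsto[OF g(1) y])
    then show "(\<lambda>i. step_integral M (\<lambda>x. g (s i x))) \<longlonglongrightarrow> g y"
      by (simp add: simple_bochner_integral_linear[OF lin s])
  qed
qed

text \<open>The real integrals of the matrix coefficients are unique and determine an operator, so
  any two operator-valued integrals agree. This makes the definite description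
  \<open>Bochner_integral\<close> denote.\<close>

lemma has_bochner_integral_rinner:
  fixes f :: "'x \<Rightarrow> 'a::chilbert_space op"
  assumes fin: "emeasure M (space M) \<noteq> \<infinity>" and s: "\<And>i. simple_function M (s i)"
    and le: "\<And>i x. x \<in> space M \<Longrightarrow> norm (f x - s i x) \<le> e i" and e: "e \<longlonglongrightarrow> 0"
  shows "has_bochner_integral M (\<lambda>x. rinner u (f x v)) (rinner u (Bochner_integral M f v))"
proof -
  have lim: "(\<lambda>i. s i x) \<longlonglongrightarrow> f x" if "x \<in> space M" for x
  proof -
    have "(\<lambda>i. f x - s i x) \<longlonglongrightarrow> 0"
      by (rule Lim_null_comparison[OF _ e]) (use le[OF that] in auto)
    from tendsto_diff[OF tendsto_const[of "f x"] this] show ?thesis by simp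
  qed
  have all: "has_bochner_integral M (\<lambda>x. rinner u (f x v)) (rinner u (y v))"
    if y: "has_Bochner_integral M f y" for u v y
  proof -
    \<comment> \<open>Scales the coefficient functional to norm at most 1; the summand 1 permits
      zero vectors u or v.\<close>
    define N where "N = norm u * norm v + 1"
    have N: "0 < N" by (simp add: N_def add_nonneg_pos)
    define g where "g z = rinner u (blinfun_apply z v) / N" for z
    have bl: "bounded_linear g"
      unfolding g_def
      by (rule bounded_linear_compose[OF bounded_linear_divide
            bounded_linear_compose[OF rinner.bounded_linear_right blinfun.bounded_linear_left]])
    have gn: "\<bar>g z\<bar> \<le> norm z" for z
    proof -
      have "\<bar>rinner u (z v)\<bar> \<le> norm u * (norm z * norm v)"
        by (rule order_trans[OF rinner_Cauchy_Schwarz]) (intro mult_left_mono norm_blinfun norm_ge_zero)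
      also have "\<dots> \<le> norm z * N" by (simp add: N_def algebra_simps)
      finally show ?thesis using N by (simp add: g_def divide_le_eq)
    qed
    have gm: "(\<lambda>x. g (f x)) \<in> borel_measurable M"
    proof (rule borel_measurable_LIMSEQ_real)
      show "(\<lambda>i. g (s i x)) \<longlonglongrightarrow> g (f x)" if "x \<in> space M" for x
        by (rule bounded_linear.tendsto[OF bl lim[OF that]])
      show "(\<lambda>x. g (s i x)) \<in> borel_measurable M" for i
        by (rule borel_measurable_simple_function[OF simple_function_compose1[OF s]])
    qed
    have "has_bochner_integral M (\<lambda>x. N * g (f x)) (N * g y)"
      by (intro has_bochner_integral_mult_right has_bochner_integral_functional[OF y bl gn gm])
    then show ?thesis using N by (simp add: g_def)
  qed
  obtain y where y: "has_Bochner_integral M f y"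
    using ex_has_Bochner_integral_uniform_limit[OF fin s le e] by blast
  have "Bochner_integral M f = y"
    unfolding Bochner_integral_def
  proof (rule the_equality)
    show "has_Bochner_integral M f y" by (rule y)
  next
    fix z assume z: "has_Bochner_integral M f z"
    show "z = y"
    proof (rule blinfun_eqI)
      fix v
      have "rinner u (z v - y v) = 0" for u
        using has_bochner_integral_eq[OF all[OF z] all[OF y], of u v] by (simp add: rinner.diff_right)
      then show "z v = y v" using rinner_eq_zero[of "z v - y v"] by simp
    qed
  qed
  then show ?thesis using all[OF y] by simp
qed

text \<open>Complex linearity and symmetry are identities between matrix coefficients, and these
  pass through uniqueness of the real integrals.\<close>

lemma Bochner_integral_self_adjoint:
  fixes f :: "'x \<Rightarrow> 'a::chilbert_space op"
  assumes int: "\<And>u v. has_bochner_integral M (\<lambda>x. rinner u (f x v)) (rinner u (Bochner_integral M f v))"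
    and f: "\<And>x. x \<in> space M \<Longrightarrow> f x \<in> self_adjoint_ops"
  shows "Bochner_integral M f \<in> self_adjoint_ops"
proof (rule self_adjointI)
  let ?I = "Bochner_integral M f"
  have sw: "rinner u (c *\<^sub>C z) = rinner (cnj c *\<^sub>C u) z" for u z :: 'a and c
    by (simp add: rinner_def cinner_scaleC_left cinner_scaleC_right)
  have "?I (c *\<^sub>C v) = c *\<^sub>C ?I v" for c v
  proof -
    have "rinner u (?I (c *\<^sub>C v) - c *\<^sub>C ?I v) = 0" for u
    proof -
      have "rinner u (f x (c *\<^sub>C v)) = rinner (cnj c *\<^sub>C u) (f x v)" if "x \<in> space M" for x
        using f[OF that] by (simp add: self_adjoint_iff bounded_ops_def sw)
      then have "has_bochner_integral M (\<lambda>x. rinner u (f x (c *\<^sub>C v))) (rinner (cnj c *\<^sub>C u) (?I v))"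
        using int[of "cnj c *\<^sub>C u" v] by (subst has_bochner_integral_cong[OF refl _ refl])
      from has_bochner_integral_eq[OF int this] show ?thesis by (simp add: rinner.diff_right sw)
    qed
    then show ?thesis using rinner_eq_zero[of "?I (c *\<^sub>C v) - c *\<^sub>C ?I v"] by simp
  qed
  then show "?I \<in> bounded_ops" by (simp add: bounded_ops_def)
  fix u v
  have "rinner v (f x u) = rinner u (f x v)" if "x \<in> space M" for x
    using self_adjoint_rinner[OF f[OF that], of v u] by (simp add: rinner_commute)
  then have "has_bochner_integral M (\<lambda>x. rinner v (f x u)) (rinner u (?I v))"
    using int[of u v] by (subst has_bochner_integral_cong[OF refl _ refl])
  from has_bochner_integral_eq[OF int this] show "rinner (?I u) v = rinner u (?I v)"
    by (simp add: rinner_commute)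
qed

lemma has_bochner_integral_le:
  fixes f g :: "'x \<Rightarrow> real"
  assumes "has_bochner_integral \<mu> f a" "has_bochner_integral \<mu> g b" "\<And>x. x \<in> space \<mu> \<Longrightarrow> f x \<le> g x"
  shows "a \<le> b"
  using integral_mono[of \<mu> f g] assms has_bochner_integral_integral_eq[OF assms(1)]
    has_bochner_integral_integral_eq[OF assms(2)] by (auto simp: integrable.intros)

section \<open>The uniform measure on the simplex\<close>

abbreviation coord_measure :: "nat \<Rightarrow> (nat \<Rightarrow> real) measure" where
  "coord_measure n \<equiv> \<Pi>\<^sub>M k\<in>{1..<n}. lborel"

interpretation lborel_product: product_sigma_finite "\<lambda>_ :: nat. lborel :: real measure"
  by standard

text \<open>The other conditions are automatic: the total is 1 by construction, each v_k is at most
  the sum of all, and the last weight is below 1 since \<open>n \<ge> 2\<close> provides a positive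
  coordinate.\<close>

lemma complete_weights_mem_iff:
  assumes "n \<ge> 2"
  shows "complete_weights n v \<in> weight_simplex n \<longleftrightarrow>
    (\<forall>k\<in>{1..<n}. 0 < v k) \<and> (\<Sum>k\<in>{1..<n}. v k) < 1"
proof -
  have ins: "{1..n} = insert n {1..<n}" using assms by auto
  have sum: "(\<Sum>k=1..n. complete_weights n v k) = 1"
    unfolding ins by (simp add: complete_weights_def)
  have "v k < 1" "(\<Sum>k\<in>{1..<n}. v k) > 0"
    if "\<forall>k\<in>{1..<n}. 0 < v k" "(\<Sum>k\<in>{1..<n}. v k) < 1" "k \<in> {1..<n}" for k
  proof -
    show "v k < 1"
      using that member_le_sum[of k "{1..<n}" v] by (auto simp: less_imp_le)
    show "(\<Sum>k\<in>{1..<n}. v k) > 0" using that by (intro sum_pos) auto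
  qed
  moreover have "1 \<in> {1..<n}" using assms by auto
  ultimately show ?thesis
    unfolding weight_simplex_def mem_Collect_eq sum ins
    by (auto simp: complete_weights_def simp del: One_nat_def)
qed

definition weight_region :: "nat \<Rightarrow> (nat \<Rightarrow> real) set" where
  "weight_region n = {v. complete_weights n v \<in> weight_simplex n}"

lemma sets_weight_region:
  assumes "n \<ge> 2" shows "weight_region n \<inter> space (coord_measure n) \<in> sets (coord_measure n)"
proof -
  have "weight_region n \<inter> space (coord_measure n) = {v \<in> space (coord_measure n).
     (\<forall>k\<in>{1..<n}. 0 < v k) \<and> (\<Sum>k\<in>{1..<n}. v k) < 1}"
    by (auto simp: weight_region_def complete_weights_mem_iff[OF assms])
  also have "\<dots> \<in> sets (coord_measure n)" by measurable
  finally show ?thesis .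
qed

text \<open>The graph of a measurable function of the remaining coordinates is null by Fubini: each
  section along coordinate i is a single point.\<close>

lemma AE_component_neq:
  fixes h :: "(nat \<Rightarrow> real) \<Rightarrow> real"
  assumes I: "finite I" "i \<notin> I" and h: "h \<in> borel_measurable (Pi\<^sub>M I (\<lambda>_. lborel))"
  shows "AE v in Pi\<^sub>M (insert i I) (\<lambda>_. lborel). v i \<noteq> h (restrict v I)"
proof -
  let ?P = "\<lambda>I. Pi\<^sub>M I (\<lambda>_ :: nat. lborel :: real measure)"
  let ?E = "{v \<in> space (?P (insert i I)). v i = h (restrict v I)}"
  have [measurable]: "(\<lambda>v. restrict v I) \<in> ?P (insert i I) \<rightarrow>\<^sub>M ?P I"
    by (rule measurable_restrict_subset) auto
  have [measurable]: "(\<lambda>v. h (restrict v I)) \<in> borel_measurable (?P (insert i I))"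
    by (rule measurable_compose[OF _ h]) measurable
  have E: "?E \<in> sets (?P (insert i I))" by measurable
  have "emeasure (?P (insert i I)) ?E = (\<integral>\<^sup>+v. indicator ?E v \<partial>?P (insert i I))"
    using E by simp
  also have "\<dots> = (\<integral>\<^sup>+x. (\<integral>\<^sup>+y. indicator ?E (x(i := y)) \<partial>lborel) \<partial>?P I)"
    by (rule lborel_product.product_nn_integral_insert[OF I]) (use E in simp)
  also have "\<dots> = (\<integral>\<^sup>+x. (\<integral>\<^sup>+y. indicator {h x} y \<partial>lborel) \<partial>?P I)"
  proof (intro nn_integral_cong)
    fix x y assume x: "x \<in> space (?P I)"
    have "restrict (x(i := y)) I = x"
      using x I(2) by (auto simp: space_PiM PiE_def extensional_def fun_eq_iff)
    moreover have "x(i := y) \<in> space (?P (insert i I))"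
      using x by (auto simp: space_PiM PiE_def extensional_def)
    ultimately show "indicator ?E (x(i := y)) = (indicator {h x} y :: ennreal)"
      by (simp add: indicator_def)
  qed
  also have "\<dots> = 0" by simp
  finally have "?E \<in> null_sets (?P (insert i I))" using E by (simp add: null_sets_def)
  then show ?thesis by (rule AE_I') auto
qed

text \<open>The known volume is that of the closed simplex. The two sets differ only on the
  hyperplanes where a coordinate is 0 or the sum is 1, and these are graphs, hence null.\<close>

lemma emeasure_weight_region:
  assumes "n \<ge> 2"
  shows "emeasure (coord_measure n) (weight_region n \<inter> space (coord_measure n)) = ennreal (1 / fact (n - 1))"
proof -
  let ?P = "coord_measure n"
  let ?C = "{x. (\<forall>i\<in>{1..<n}. 0 \<le> x i) \<and> sum x {1..<n} \<le> 1} \<inter> space ?P"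
  have AE1: "AE v in ?P. \<forall>k\<in>{1..<n}. v k \<noteq> 0"
  proof (subst AE_ball_countable, simp, rule ballI)
    fix k assume k: "k \<in> {1..<n}"
    then have ins: "insert k ({1..<n} - {k}) = {1..<n}" by auto
    have "AE v in Pi\<^sub>M (insert k ({1..<n} - {k})) (\<lambda>_. lborel).
        v k \<noteq> (0 :: real)"
      by (rule AE_component_neq[where h="\<lambda>_. 0"]) auto
    then show "AE v in ?P. v k \<noteq> 0" unfolding ins .
  qed
  have AE2: "AE v in ?P. (\<Sum>k\<in>{1..<n}. v k) \<noteq> 1"
  proof -
    let ?I = "{1..<n} - {1}"
    have ins: "insert 1 ?I = {1..<n}" using assms by auto
    have "(\<lambda>x. 1 - (\<Sum>k\<in>?I. x k)) \<in> borel_measurable (Pi\<^sub>M ?I (\<lambda>_. lborel))" by measurable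
    from AE_component_neq[OF _ _ this, of 1]
    have "AE v in ?P. v 1 \<noteq> 1 - (\<Sum>k\<in>?I. restrict v ?I k)" unfolding ins by simp
    moreover have "(\<Sum>k\<in>?I. restrict v ?I k) = (\<Sum>k\<in>{1..<n}. v k) - v 1" for v :: "nat \<Rightarrow> real"
      using assms by (subst sum.remove[of "{1..<n}" 1]) auto
    ultimately show ?thesis by simp
  qed
  have C: "?C \<in> sets ?P"
  proof -
    have "?C = {v \<in> space ?P. (\<forall>i\<in>{1..<n}. 0 \<le> v i) \<and> (\<Sum>k\<in>{1..<n}. v k) \<le> 1}" by auto
    also have "\<dots> \<in> sets ?P" by measurable
    finally show ?thesis .
  qed
  have "emeasure ?P (weight_region n \<inter> space ?P) = emeasure ?P ?C"
  proof (rule emeasure_eq_AE)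
    show "AE v in ?P. (v \<in> weight_region n \<inter> space ?P) = (v \<in> ?C)"
      using AE1 AE2
      by eventually_elim (auto simp: weight_region_def complete_weights_mem_iff[OF assms] less_le)
  qed (use C sets_weight_region[OF assms] in auto)
  also have "\<dots> = ennreal (1 ^ card {1..<n} / fact (card {1..<n}))"
    by (rule emeasure_std_simplex_aux) auto
  finally show ?thesis by simp
qed

lemma space_simplex_measure: "space (simplex_measure n) = weight_region n \<inter> space (coord_measure n)"
  by (simp add: simplex_measure_def space_restrict_space weight_region_def Int_commute)

lemma emeasure_simplex_measure:
  assumes "n \<ge> 2"
  shows "emeasure (simplex_measure n) (space (simplex_measure n)) = ennreal (1 / fact (n - 1))"
proof -
  have "emeasure (simplex_measure n) (space (simplex_measure n))
      = emeasure (coord_measure n) (weight_region n \<inter> space (coord_measure n))"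
    unfolding space_simplex_measure unfolding simplex_measure_def weight_region_def[symmetric]
    using sets_weight_region[OF assms] by (intro emeasure_restrict_space) auto
  then show ?thesis by (simp only: emeasure_weight_region[OF assms])
qed

lemma measurable_simplex_coord:
  "k \<in> {1..<n} \<Longrightarrow> (\<lambda>v. v k) \<in> borel_measurable (simplex_measure n)"
  unfolding simplex_measure_def by (intro measurable_restrict_space1) measurable

lemma measurable_complete_weights:
  "k \<in> {1..n} \<Longrightarrow> (\<lambda>v. complete_weights n v k) \<in> borel_measurable (simplex_measure n)"
  by (cases "k = n") (auto simp: complete_weights_def intro!: borel_measurable_diff borel_measurable_sum measurable_simplex_coord)

lemma nn_integral_simplex:
  assumes "n \<ge> 2"
  shows "(\<integral>\<^sup>+v. f v \<partial>simplex_measure n) = (\<integral>\<^sup>+v. f v * indicator (weight_region n) v \<partial>coord_measure n)"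
  unfolding simplex_measure_def weight_region_def[symmetric]
  by (rule nn_integral_restrict_space[OF sets_weight_region[OF assms]])

text \<open>Reflecting the coordinate \<open>v\<^sub>k\<close> in its range exchanges the \<open>k\<close>-th and the last weight.\<close>

lemma nn_integral_weight_eq:
  assumes n: "n \<ge> 2" and k: "k \<in> {1..<n}"
  shows "(\<integral>\<^sup>+v. ennreal (complete_weights n v k) \<partial>simplex_measure n)
    = (\<integral>\<^sup>+v. ennreal (complete_weights n v n) \<partial>simplex_measure n)"
proof -
  define I where "I = {1..<n} - {k}"
  have ins: "{1..<n} = insert k I" and I: "finite I" "k \<notin> I" using k by (auto simp: I_def)
  let ?R = "weight_region n"
  have R: "x(k := y) \<in> ?R \<longleftrightarrow> (\<forall>j\<in>I. 0 < x j) \<and> 0 < y \<and> y < 1 - sum x I" for x y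
  proof -
    have "sum (x(k := y)) I = sum x I" using I by (intro sum.cong) auto
    then show ?thesis
      unfolding weight_region_def mem_Collect_eq complete_weights_mem_iff[OF n] ins using I by auto
  qed
  have cw: "complete_weights n (x(k := y)) k = y" "complete_weights n (x(k := y)) n = 1 - sum x I - y" for x y
  proof -
    have "sum (x(k := y)) I = sum x I" using I by (intro sum.cong) auto
    then show "complete_weights n (x(k := y)) n = 1 - sum x I - y"
      unfolding complete_weights_def ins using I by simp
    show "complete_weights n (x(k := y)) k = y" using k by (auto simp: complete_weights_def)
  qed
  have meas: "(\<lambda>v. ennreal (complete_weights n v j) * indicator ?R v) \<in> borel_measurable (coord_measure n)"
    if "j \<in> {1..n}" for j
  proof -
    have "(\<lambda>v. complete_weights n v j) \<in> borel_measurable (coord_measure n)"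
      using that by (cases "j = n") (auto simp: complete_weights_def intro!: borel_measurable_diff borel_measurable_sum)
    moreover have "(indicator ?R :: _ \<Rightarrow> ennreal) \<in> borel_measurable (coord_measure n)"
      using sets_weight_region[OF n] by (simp add: borel_measurable_indicator_iff)
    ultimately show ?thesis by measurable
  qed
  have prod: "integral\<^sup>N (coord_measure n) f = (\<integral>\<^sup>+x. (\<integral>\<^sup>+y. f (x(k := y)) \<partial>lborel) \<partial>Pi\<^sub>M I (\<lambda>_. lborel))"
    if "f \<in> borel_measurable (coord_measure n)" for f
    using that unfolding ins by (rule lborel_product.product_nn_integral_insert[OF I])
  have "(\<integral>\<^sup>+v. ennreal (complete_weights n v k) \<partial>simplex_measure n)
      = (\<integral>\<^sup>+x. (\<integral>\<^sup>+y. ennreal y * indicator ?R (x(k := y)) \<partial>lborel) \<partial>Pi\<^sub>M I (\<lambda>_. lborel))"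
    unfolding nn_integral_simplex[OF n] using k by (subst prod[OF meas]) (auto simp: cw)
  also have "\<dots> = (\<integral>\<^sup>+x. (\<integral>\<^sup>+y. ennreal (1 - sum x I - y) * indicator ?R (x(k := y)) \<partial>lborel) \<partial>Pi\<^sub>M I (\<lambda>_. lborel))"
  proof (rule nn_integral_cong)
    fix x
    define g where "g y = ennreal y * (if (\<forall>j\<in>I. 0 < x j) then indicator {0<..<1 - sum x I} y else 0)" for y
    have g: "ennreal y * indicator ?R (x(k := y)) = g y" for y
      by (simp add: g_def R indicator_def)
    have "(\<integral>\<^sup>+y. g y \<partial>lborel) = ennreal \<bar>-1\<bar> * (\<integral>\<^sup>+y. g ((1 - sum x I) + (-1) * y) \<partial>lborel)"
      by (rule nn_integral_real_affine) (auto simp: g_def)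
    also have "\<dots> = (\<integral>\<^sup>+y. ennreal (1 - sum x I - y) * indicator ?R (x(k := y)) \<partial>lborel)"
      by (simp, intro nn_integral_cong) (auto simp: g_def R indicator_def)
    finally show "(\<integral>\<^sup>+y. ennreal y * indicator ?R (x(k := y)) \<partial>lborel)
      = (\<integral>\<^sup>+y. ennreal (1 - sum x I - y) * indicator ?R (x(k := y)) \<partial>lborel)" by (simp add: g)
  qed
  also have "\<dots> = (\<integral>\<^sup>+v. ennreal (complete_weights n v n) \<partial>simplex_measure n)"
    unfolding nn_integral_simplex[OF n] using n by (subst prod[OF meas]) (auto simp: cw)
  finally show ?thesis .
qed

text \<open>The n weights have equal integrals by symmetry and add up to the total mass 1/(n-1)!, so
  each integral is known without being computed.\<close>

lemma has_bochner_integral_weight: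
  assumes n: "n \<ge> 2" and k: "k \<in> {1..n}"
  shows "has_bochner_integral (simplex_measure n) (\<lambda>v. complete_weights n v k) (1 / (real n * fact (n - 1)))"
proof -
  let ?J = "\<lambda>k. \<integral>\<^sup>+v. ennreal (complete_weights n v k) \<partial>simplex_measure n"
  have pos: "0 \<le> complete_weights n v k" if "v \<in> space (simplex_measure n)" "k \<in> {1..n}" for v k
    using that by (auto simp: space_simplex_measure weight_region_def weight_simplex_def less_imp_le)
  have eq: "?J j = ?J n" if "j \<in> {1..n}" for j
    using nn_integral_weight_eq[OF n, of j] that by (cases "j = n") auto
  have "of_nat n * ?J n = (\<Sum>j\<in>{1..n}. ?J n)" by simp
  also have "\<dots> = (\<Sum>j\<in>{1..n}. ?J j)" by (intro sum.cong refl eq[symmetric])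
  also have "\<dots> = (\<integral>\<^sup>+v. (\<Sum>j\<in>{1..n}. ennreal (complete_weights n v j)) \<partial>simplex_measure n)"
    by (intro nn_integral_sum[symmetric] measurable_compose[OF measurable_complete_weights measurable_ennreal])
  also have "\<dots> = (\<integral>\<^sup>+v. 1 \<partial>simplex_measure n)"
  proof (rule nn_integral_cong)
    fix v assume v: "v \<in> space (simplex_measure n)"
    have "(\<Sum>j\<in>{1..n}. ennreal (complete_weights n v j)) = ennreal (\<Sum>j\<in>{1..n}. complete_weights n v j)"
      by (intro sum_ennreal pos v)
    also have "(\<Sum>j\<in>{1..n}. complete_weights n v j) = 1"
      using v by (auto simp: space_simplex_measure weight_region_def weight_simplex_def)
    finally show "(\<Sum>j\<in>{1..n}. ennreal (complete_weights n v j)) = 1" by simp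
  qed
  also have "\<dots> = ennreal (1 / fact (n - 1))" by (simp add: emeasure_simplex_measure[OF n])
  finally have nJ: "of_nat n * ?J n = ennreal (1 / fact (n - 1))" .
  then have "?J n \<noteq> \<infinity>" using n by (auto simp: ennreal_mult_eq_top_iff)
  then obtain r where r: "?J n = ennreal r" "0 \<le> r" by (cases "?J n") auto
  have "ennreal (real n * r) = ennreal (1 / fact (n - 1))"
    using nJ r by (simp add: ennreal_mult ennreal_of_nat_eq_real_of_nat)
  then have "real n * r = 1 / fact (n - 1)" using r by (subst (asm) ennreal_inj) auto
  then have "r = 1 / (real n * fact (n - 1))" using n by (simp add: field_simps)
  then show ?thesis
    using eq[OF k] r pos[OF _ k] measurable_complete_weights[OF k]
    by (intro has_bochner_integral_nn_integral AE_I2) auto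
qed

section \<open>The logarithmic mean\<close>

locale operator_tuple =
  fixes n :: nat and A :: "nat \<Rightarrow> 'a::chilbert_space op" and m M :: real
  assumes n: "n \<ge> 2" and m: "0 < m" and mM: "m \<le> M"
    and A: "\<And>k. k \<in> {1..n} \<Longrightarrow> A k \<in> op_interval m M"
begin

lemma weighted_tuple: "v \<in> weight_region n \<Longrightarrow> weighted_tuple n (complete_weights n v) A m M"
  using m mM A by unfold_locales (auto simp: weight_region_def)

definition karcher_at :: "(nat \<Rightarrow> real) \<Rightarrow> 'a op" where
  "karcher_at v = karcher_mean n (complete_weights n v) A"

text \<open>Label of the grid cube of side 1/(N+1) containing v. It is set to 0 off the relevant
  indices, so that only finitely many labels occur on the simplex.\<close>

definition cell :: "nat \<Rightarrow> (nat \<Rightarrow> real) \<Rightarrow> nat \<Rightarrow> int" where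
  "cell N v = (\<lambda>k. if k \<in> {1..<n} then \<lfloor>real (Suc N) * v k\<rfloor> else 0)"

text \<open>A representative of the cube inside the simplex, meaningful for labels that occur there.
  Evaluating the Karcher mean at it gives a simple function.\<close>

definition cell_point :: "nat \<Rightarrow> (nat \<Rightarrow> int) \<Rightarrow> nat \<Rightarrow> real" where
  "cell_point N j = (SOME v. v \<in> space (simplex_measure n) \<and> cell N v = j)"

lemma simple_function_cell: "simple_function (simplex_measure n) (cell N)"
  unfolding simple_function_def
proof (intro conjI ballI)
  let ?D = "space (simplex_measure n)"
  have "cell N ` ?D \<subseteq> {g. \<forall>k. (k \<in> {1..<n} \<longrightarrow> g k \<in> {0..int (Suc N)}) \<and> (k \<notin> {1..<n} \<longrightarrow> g k = 0)}"
  proof (rule image_subsetI)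
    fix v assume v: "v \<in> ?D"
    have "\<lfloor>real (Suc N) * v k\<rfloor> \<in> {0..int (Suc N)}" if k: "k \<in> {1..<n}" for k
    proof -
      have "0 < complete_weights n v k" "complete_weights n v k < 1"
        using v k by (auto simp: space_simplex_measure weight_region_def weight_simplex_def)
      moreover have "complete_weights n v k = v k" using k by (simp add: complete_weights_def)
      ultimately have "0 \<le> real (Suc N) * v k" "real (Suc N) * v k \<le> real (Suc N) * 1"
        by (auto intro!: mult_left_mono simp del: of_nat_Suc)
      from this(1) floor_mono[OF this(2)]
      have "0 \<le> \<lfloor>real (Suc N) * v k\<rfloor>" "\<lfloor>real (Suc N) * v k\<rfloor> \<le> \<lfloor>real (Suc N) * 1\<rfloor>"
        unfolding zero_le_floor .
      then show ?thesis unfolding mult_1_right floor_of_nat by simp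
    qed
    then show "cell N v \<in> {g. \<forall>k. (k \<in> {1..<n} \<longrightarrow> g k \<in> {0..int (Suc N)}) \<and> (k \<notin> {1..<n} \<longrightarrow> g k = 0)}"
      by (simp add: cell_def)
  qed
  then show "finite (cell N ` ?D)"
    by (rule finite_subset) (intro finite_set_of_finite_funs; simp)
  fix j assume "j \<in> cell N ` ?D"
  then have j0: "j k = 0" if "k \<notin> {1..<n}" for k using that by (auto simp: cell_def)
  have "cell N v = j \<longleftrightarrow> (\<forall>k\<in>{1..<n}. \<lfloor>real (Suc N) * v k\<rfloor> = j k)" for v
    unfolding cell_def fun_eq_iff using j0 by metis
  then have "cell N -` {j} \<inter> ?D = {v \<in> ?D. \<forall>k\<in>{1..<n}. \<lfloor>real (Suc N) * v k\<rfloor> = j k}"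
    by blast
  also have "\<dots> \<in> sets (simplex_measure n)"
  proof (rule sets.sets_Collect_finite_All)
    fix k assume "k \<in> {1..<n}"
    note [measurable] = measurable_simplex_coord[OF this]
    show "{v \<in> ?D. \<lfloor>real (Suc N) * v k\<rfloor> = j k} \<in> sets (simplex_measure n)" by measurable
  qed simp
  finally show "cell N -` {j} \<inter> ?D \<in> sets (simplex_measure n)" .
qed

text \<open>Two points of a cube differ by at most 1/(N+1) in each of the n - 1 coordinates, and
  their last weights by at most the sum of these differences. Both contributions are bounded by
  n/(N+1), whence the 2 n.\<close>

definition approx_err :: "nat \<Rightarrow> real" where
  "approx_err N = M * (exp (weighted_tuple.K' m M * (2 * real n / real (Suc N))) - 1)"

lemma approx_err_LIMSEQ: "approx_err \<longlonglongrightarrow> 0"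
proof -
  have "(\<lambda>N. 2 * real n / real (Suc N)) \<longlonglongrightarrow> 0" by (rule LIMSEQ_Suc[OF lim_const_over_n])
  then have "approx_err \<longlonglongrightarrow> M * (exp (weighted_tuple.K' m M * 0) - 1)"
    unfolding approx_err_def by (intro tendsto_intros)
  then show ?thesis by simp
qed

lemma karcher_at_approx:
  assumes v: "v \<in> space (simplex_measure n)"
  shows "norm (karcher_at v - karcher_at (cell_point N (cell N v))) \<le> approx_err N"
proof -
  define v' where "v' = cell_point N (cell N v)"
  have "\<exists>u. u \<in> space (simplex_measure n) \<and> cell N u = cell N v" using v by blast
  from someI_ex[OF this] have v': "v' \<in> space (simplex_measure n)" "cell N v' = cell N v"
    by (simp_all add: v'_def cell_point_def)
  have R: "v \<in> weight_region n" "v' \<in> weight_region n" using v v' by (auto simp: space_simplex_measure)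
  interpret v': weighted_tuple n "complete_weights n v'" A m M by (rule weighted_tuple[OF R(2)])
  define h where "h = 1 / real (Suc N)"
  have close: "\<bar>v k - v' k\<bar> \<le> h" if "k \<in> {1..<n}" for k
  proof -
    have "\<lfloor>real (Suc N) * v k\<rfloor> = \<lfloor>real (Suc N) * v' k\<rfloor>"
      using fun_cong[OF v'(2), of k] that by (simp add: cell_def)
    then have "\<bar>real (Suc N) * v k - real (Suc N) * v' k\<bar> \<le> 1" by linarith
    then have "real (Suc N) * \<bar>v k - v' k\<bar> \<le> 1"
      by (simp add: abs_mult flip: right_diff_distrib)
    then show ?thesis by (simp add: h_def field_simps)
  qed
  have ins: "{1..n} = insert n {1..<n}" using n by auto
  have s: "(\<Sum>k\<in>{1..<n}. \<bar>v k - v' k\<bar>) \<le> real n * h"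
  proof -
    have "(\<Sum>k\<in>{1..<n}. \<bar>v k - v' k\<bar>) \<le> (\<Sum>k\<in>{1..<n}. h)" by (intro sum_mono close)
    also have "\<dots> \<le> real n * h" by (auto simp: h_def intro!: divide_right_mono)
    finally show ?thesis .
  qed
  have "\<bar>complete_weights n v n - complete_weights n v' n\<bar> = \<bar>\<Sum>k\<in>{1..<n}. v k - v' k\<bar>"
    by (simp add: complete_weights_def sum_subtractf)
  also have "\<dots> \<le> real n * h" using s by (rule order_trans[OF sum_abs])
  finally have "(\<Sum>k=1..n. \<bar>complete_weights n v k - complete_weights n v' k\<bar>) \<le> 2 * (real n * h)"
    unfolding ins using s by (simp add: complete_weights_def)
  then have "exp (v'.K' * (\<Sum>k=1..n. \<bar>complete_weights n v k - complete_weights n v' k\<bar>)) \<le> exp (v'.K' * (2 * (real n * h)))"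
    using v'.K_nonneg by (simp add: mult_left_mono)
  then have "M * (exp (v'.K' * (\<Sum>k=1..n. \<bar>complete_weights n v k - complete_weights n v' k\<bar>)) - 1) \<le> approx_err N"
    using v'.M_pos by (simp add: approx_err_def h_def)
  moreover have "complete_weights n v \<in> weight_simplex n" using R(1) by (simp add: weight_region_def)
  ultimately show ?thesis
    using v'.karcher_mean_weights_continuous[of "complete_weights n v"] by (simp add: karcher_at_def v'_def)
qed

lemma has_bochner_integral_karcher_at:
  "has_bochner_integral (simplex_measure n) (\<lambda>v. rinner x (karcher_at v y))
     (rinner x (Bochner_integral (simplex_measure n) karcher_at y))"
  by (rule has_bochner_integral_rinner[where s="\<lambda>N v. karcher_at (cell_point N (cell N v))" and e=approx_err])
    (auto simp: emeasure_simplex_measure[OF n] approx_err_LIMSEQ karcher_at_approx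
      intro: simple_function_compose1[OF simple_function_cell, of "\<lambda>j. karcher_at (cell_point _ j)"])

lemma log_mean_eq: "log_mean n A = fact (n - 1) *\<^sub>R Bochner_integral (simplex_measure n) karcher_at"
  by (simp add: log_mean_def karcher_at_def[abs_def])

lemma log_mean_self_adjoint: "log_mean n A \<in> self_adjoint_ops"
  unfolding log_mean_eq
proof (intro self_adjoint_scaleR Bochner_integral_self_adjoint[OF has_bochner_integral_karcher_at])
  fix v assume "v \<in> space (simplex_measure n)"
  then interpret weighted_tuple n "complete_weights n v" A m M
    by (intro weighted_tuple) (simp add: space_simplex_measure)
  show "karcher_at v \<in> self_adjoint_ops"
    unfolding karcher_at_def using karcher_mean_op_interval by (rule op_interval_sa)
qed

lemma has_bochner_integral_weighted_sum:
  "has_bochner_integral (simplex_measure n) (\<lambda>v. \<Sum>k=1..n. complete_weights n v k * a k)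
     ((\<Sum>k=1..n. a k) / (real n * fact (n - 1)))"
proof -
  have "has_bochner_integral (simplex_measure n) (\<lambda>v. \<Sum>k\<in>{1..n}. complete_weights n v k * a k)
     (\<Sum>k\<in>{1..n}. 1 / (real n * fact (n - 1)) * a k)"
    by (intro has_bochner_integral_sum has_bochner_integral_mult_left has_bochner_integral_weight[OF n])
  then show ?thesis by (simp add: sum_divide_distrib)
qed

lemma log_mean_le_arith:
  "rinner x (log_mean n A x) \<le> (\<Sum>k=1..n. rinner x (A k x)) / real n"
proof -
  have "rinner x (Bochner_integral (simplex_measure n) karcher_at x)
      \<le> (\<Sum>k=1..n. rinner x (A k x)) / (real n * fact (n - 1))"
  proof (rule has_bochner_integral_le[OF has_bochner_integral_karcher_at has_bochner_integral_weighted_sum])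
    fix v assume "v \<in> space (simplex_measure n)"
    then interpret weighted_tuple n "complete_weights n v" A m M
      by (intro weighted_tuple) (simp add: space_simplex_measure)
    show "rinner x (karcher_at v x) \<le> (\<Sum>k=1..n. complete_weights n v k * rinner x (A k x))"
      using op_leD[OF karcher_mean_le_arith, of x]
      by (simp add: karcher_at_def blinfun.sum_left rinner.sum_right blinfun.scaleR_left rinner_scaleR_right)
  qed
  then have "fact (n - 1) * rinner x (Bochner_integral (simplex_measure n) karcher_at x)
      \<le> fact (n - 1) * ((\<Sum>k=1..n. rinner x (A k x)) / (real n * fact (n - 1)))"
    by (intro mult_left_mono) auto
  then show ?thesis
    by (simp add: log_mean_eq blinfun.scaleR_left rinner_scaleR_right)
qed

lemma log_mean_ge_harm:
  "2 * (norm x)\<^sup>2 - (\<Sum>k=1..n. rinner x (inv_op (A k) x)) / real n \<le> rinner x (log_mean n A x)"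
proof -
  \<comment> \<open>As the weights sum to one, the constant term can be moved under the weighted
    sum. The lower bound then has the form covered by
    \<open>has_bochner_integral_weighted_sum\<close>.\<close>
  define a where "a k = 2 * (norm x)\<^sup>2 - rinner x (inv_op (A k) x)" for k
  have "(\<Sum>k=1..n. a k) / (real n * fact (n - 1)) \<le> rinner x (Bochner_integral (simplex_measure n) karcher_at x)"
  proof (rule has_bochner_integral_le[OF has_bochner_integral_weighted_sum has_bochner_integral_karcher_at])
    fix v assume "v \<in> space (simplex_measure n)"
    then interpret weighted_tuple n "complete_weights n v" A m M
      by (intro weighted_tuple) (simp add: space_simplex_measure)
    have "(\<Sum>k=1..n. complete_weights n v k * a k)
        = (\<Sum>k=1..n. complete_weights n v k) * (2 * (norm x)\<^sup>2) - (\<Sum>k=1..n. complete_weights n v k * rinner x (inv_op (A k) x))"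
      by (simp add: a_def right_diff_distrib sum_subtractf sum_distrib_right)
    then show "(\<Sum>k=1..n. complete_weights n v k * a k) \<le> rinner x (karcher_at v x)"
      using op_leD[OF karcher_mean_ge_harm, of x] w_sum
      by (simp add: karcher_at_def blinfun.sum_left rinner.sum_right blinfun.scaleR_left rinner_scaleR_right
          blinfun.diff_left rinner.diff_right rinner_self)
  qed
  then have "fact (n - 1) * ((\<Sum>k=1..n. a k) / (real n * fact (n - 1)))
      \<le> fact (n - 1) * rinner x (Bochner_integral (simplex_measure n) karcher_at x)"
    by (intro mult_left_mono) auto
  then have "(\<Sum>k=1..n. a k) / real n \<le> rinner x (log_mean n A x)"
    by (simp add: log_mean_eq blinfun.scaleR_left rinner_scaleR_right)
  moreover have "(\<Sum>k=1..n. a k) / real n = 2 * (norm x)\<^sup>2 - (\<Sum>k=1..n. rinner x (inv_op (A k) x)) / real n"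
    using n by (simp add: a_def sum_subtractf diff_divide_distrib)
  ultimately show ?thesis by simp
qed

end

section \<open>Operator monotone functions\<close>

subsection \<open>Operators with two eigenvalues\<close>

lift_definition line_proj :: "'a::complex_inner \<Rightarrow> 'a op" is "\<lambda>v x. cinner v x *\<^sub>C v"
proof (rule bounded_linear_intro)
  fix v x y :: 'a and r :: real
  show "cinner v (x + y) *\<^sub>C v = cinner v x *\<^sub>C v + cinner v y *\<^sub>C v"
    by (simp add: cinner_add_right scaleC_add_left)
  show "cinner v (r *\<^sub>R x) *\<^sub>C v = r *\<^sub>R (cinner v x *\<^sub>C v)"
    by (simp add: cinner_scaleC_right scaleC_scaleC flip: scaleC_of_real)
  have "cmod (cinner v x) \<le> 2 * (norm v * norm x)"
  proof -
    have "cmod (cinner v x) \<le> \<bar>Re (cinner v x)\<bar> + \<bar>Im (cinner v x)\<bar>" by (rule cmod_le)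
    also have "\<dots> = \<bar>rinner v x\<bar> + \<bar>rinner (\<i> *\<^sub>C v) x\<bar>" by (simp add: cinner_eq_rinner)
    also have "\<dots> \<le> norm v * norm x + norm (\<i> *\<^sub>C v) * norm x"
      by (intro add_mono rinner_Cauchy_Schwarz)
    finally show ?thesis by (simp add: norm_scaleC)
  qed
  then have "cmod (cinner v x) * norm v \<le> 2 * (norm v * norm x) * norm v" by (rule mult_right_mono) simp
  then show "norm (cinner v x *\<^sub>C v) \<le> norm x * (2 * norm v * norm v)"
    by (simp add: norm_scaleC mult_ac)
qed

text \<open>Eigenvalue \<open>b\<close> on the line spanned by the unit vector \<open>v\<close> and \<open>a\<close> on its complement.\<close>

definition two_eig :: "real \<Rightarrow> real \<Rightarrow> 'a::complex_inner \<Rightarrow> 'a op" where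
  "two_eig a b v = a *\<^sub>R id_blinfun + (b - a) *\<^sub>R line_proj v"

lemma line_proj_idem: "norm v = 1 \<Longrightarrow> line_proj v o\<^sub>L line_proj v = line_proj v"
  by (rule blinfun_eqI) (simp add: line_proj.rep_eq cinner_scaleC_right cinner_self)

lemma line_proj_self_adjoint: "line_proj v \<in> self_adjoint_ops"
proof -
  have "cinner (cinner v x *\<^sub>C v) y = cinner x (cinner v y *\<^sub>C v)" for x y
    by (simp add: cinner_scaleC_left cinner_scaleC_right cinner_commute[of x v])
  then show ?thesis
    by (auto simp: self_adjoint_ops_def bounded_ops_def line_proj.rep_eq cinner_scaleC_right scaleC_scaleC)
qed

lemma two_eig_self_adjoint: "two_eig a b v \<in> self_adjoint_ops"
  unfolding two_eig_def by (intro self_adjoint_add self_adjoint_scaleR line_proj_self_adjoint) simp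

lemma rinner_two_eig:
  "rinner x (two_eig a b v x) = a * (norm x)\<^sup>2 + (b - a) * (cmod (cinner v x))\<^sup>2"
proof -
  have "rinner x (cinner v x *\<^sub>C v) = (cmod (cinner v x))\<^sup>2"
    unfolding rinner_def cinner_scaleC_right cinner_commute[of x v]
    by (simp add: complex_mult_cnj cmod_def flip: power2_eq_square)
  then show ?thesis
    by (simp add: two_eig_def blinfun.bilinear_simps line_proj.rep_eq rinner_add_right rinner_scaleR_right rinner_self)
qed

lemma two_eig_compose:
  assumes "norm v = 1" shows "two_eig a b v o\<^sub>L two_eig c d v = two_eig (a * c) (b * d) v"
proof -
  have "two_eig a b v o\<^sub>L two_eig c d v
      = (a * c) *\<^sub>R id_blinfun + (a * (d - c) + (b - a) * c + (b - a) * (d - c)) *\<^sub>R line_proj v"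
    by (simp add: two_eig_def compose_simps line_proj_idem[OF assms] scaleR_add_left scaleR_add_right mult_ac add_ac)
  also have "a * (d - c) + (b - a) * c + (b - a) * (d - c) = b * d - a * c" by (simp add: algebra_simps)
  finally show ?thesis by (simp add: two_eig_def)
qed

lemma two_eig_add: "two_eig a b v + two_eig c d v = two_eig (a + c) (b + d) v"
  by (simp add: two_eig_def scaleR_add_left scaleR_diff_left)

lemma two_eig_const: "two_eig a a v = a *\<^sub>R id_blinfun"
  by (simp add: two_eig_def)

lemma poly_op_two_eig:
  assumes "norm v = 1" shows "poly_op p (two_eig a b v) = two_eig (poly p a) (poly p b) v"
proof (induction p)
  case 0
  show ?case by (simp add: two_eig_def)
next
  case (pCons c p)
  have "c *\<^sub>R id_blinfun = two_eig c c v" by (simp add: two_eig_const)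
  then show ?case
    by (simp add: poly_op_pCons pCons.IH two_eig_compose[OF assms] two_eig_add)
qed

lemma spectrum_two_eig:
  fixes v :: "'a::chilbert_space"
  assumes v: "norm v = 1"
  shows "spectrum (two_eig a b v) \<subseteq> complex_of_real ` {a, b}"
proof
  fix z assume z: "z \<in> spectrum (two_eig a b v)"
  then obtain s where s: "z = complex_of_real s"
    using spectrum_self_adjoint_real[OF two_eig_self_adjoint] by blast
  have "s = a \<or> s = b"
  proof (rule ccontr)
    assume ns: "\<not> (s = a \<or> s = b)"
    have "two_eig a b v - scalar_op z = two_eig (a - s) (b - s) v"
      by (simp add: s scalar_op_of_real two_eig_def scaleR_diff_left)
    moreover have "is_inverse (two_eig (a - s) (b - s) v) (two_eig (1 / (a - s)) (1 / (b - s)) v)"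
      using ns self_adjoint_bounded[OF two_eig_self_adjoint]
      by (simp add: is_inverse_def two_eig_compose[OF v] two_eig_const)
    ultimately show False using z by (auto simp: spectrum_def)
  qed
  then show "z \<in> complex_of_real ` {a, b}" using s by auto
qed

text \<open>On a two-point spectrum every f agrees with an affine polynomial. This applies before
  continuity of f is known, so operator monotonicity can be exploited to derive continuity.\<close>

lemma fun_op_two_eig:
  fixes v :: "'a::chilbert_space"
  assumes v: "norm v = 1"
  shows "fun_op f (two_eig a b v) = two_eig (f a) (f b) v"
proof -
  \<comment> \<open>For \<open>a = b\<close> the quotient is 0 by the convention on division, and c
    (b - a) = f b - f a remains true.\<close>
  define c where "c = (f b - f a) / (b - a)"
  define p where "p = [:f a - c * a, c:]"
  have p: "poly p a = f a" "poly p b = f b"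
  proof -
    have "c * (b - a) = f b - f a" by (simp add: c_def)
    then show "poly p a = f a" "poly p b = f b" by (simp_all add: p_def algebra_simps)
  qed
  have "fun_op f (two_eig a b v) = poly_op p (two_eig a b v)"
    using spectrum_two_eig[OF v, of a b] p by (intro fun_op_poly two_eig_self_adjoint) auto
  then show ?thesis by (simp add: poly_op_two_eig[OF v] p)
qed

subsection \<open>Two-by-two matrices acting on the first two coordinates\<close>

lift_definition plane :: "real \<Rightarrow> real \<Rightarrow> ell2" is
  "\<lambda>a b i. if i = 0 then complex_of_real a else if i = 1 then complex_of_real b else 0"
  by (rule summable_finite[of "{0, 1}"]) auto

lemma cinner_plane:
  "cinner (plane a b) x = complex_of_real a * Rep_ell2 x 0 + complex_of_real b * Rep_ell2 x 1"
proof transfer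
  fix a b :: real and x :: "nat \<Rightarrow> complex"
  show "(\<Sum>i. cnj (if i = 0 then complex_of_real a else if i = 1 then complex_of_real b else 0) * x i)
      = complex_of_real a * x 0 + complex_of_real b * x 1"
    by (subst suminf_finite[of "{0, 1}"]) auto
qed

lemma cinner_plane_plane: "cinner (plane a b) (plane c d) = complex_of_real (a * c + b * d)"
  by (simp add: cinner_plane plane.rep_eq)

lemma norm_plane: "(norm (plane a b))\<^sup>2 = a\<^sup>2 + b\<^sup>2"
  using cinner_self[of "plane a b"] by (simp add: cinner_plane_plane power2_eq_square del: of_real_add of_real_mult flip: of_real_add of_real_mult)

lemma coord_norm_le: "(cmod (Rep_ell2 x 0))\<^sup>2 + (cmod (Rep_ell2 x 1))\<^sup>2 \<le> (norm x)\<^sup>2"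
proof -
  have "(L2_set (\<lambda>i. cmod (Rep_ell2 x i)) {..<2})\<^sup>2 \<le> (norm x)\<^sup>2"
    by (intro power_mono L2_set_le_norm_ell2 L2_set_nonneg)
  then show ?thesis by (simp add: L2_set_def numeral_2_eq_2)
qed

lemma OM1_pos: "f \<in> OM1 \<Longrightarrow> 0 < s \<Longrightarrow> 0 < f s" and OM1_one: "f \<in> OM1 \<Longrightarrow> f 1 = 1"
  by (auto simp: OM1_def)

text \<open>The smaller operator has eigenvalue \<beta> at (a,b) and \<alpha> on the complement, the
  larger one \<alpha>' at (a',b') and \<beta>' on the complement. The form hypothesis is their order
  on the real plane, applied to real and imaginary parts; off the plane the order is \<alpha> <=
  \<beta>'. The conclusion tests the order of the images under f at (c,d).\<close>

lemma OM1_two_by_two: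
  assumes f: "f \<in> OM1" and pos: "0 < \<alpha>" "0 < \<beta>" "0 < \<alpha>'" "0 < \<beta>'"
    and unit: "a\<^sup>2 + b\<^sup>2 = 1" "a'\<^sup>2 + b'\<^sup>2 = 1"
    and le: "\<alpha> \<le> \<beta>'"
      "\<And>p q. (\<beta> - \<alpha>) * (a * p + b * q)\<^sup>2 + (\<beta>' - \<alpha>') * (a' * p + b' * q)\<^sup>2 \<le> (\<beta>' - \<alpha>) * (p\<^sup>2 + q\<^sup>2)"
  shows "f \<alpha> * (c\<^sup>2 + d\<^sup>2) + (f \<beta> - f \<alpha>) * (a * c + b * d)\<^sup>2
    \<le> f \<beta>' * (c\<^sup>2 + d\<^sup>2) + (f \<alpha>' - f \<beta>') * (a' * c + b' * d)\<^sup>2"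
proof -
  define v v' where "v = plane a b" and "v' = plane a' b'"
  have nv: "norm v = 1" "norm v' = 1"
    using norm_plane[of a b] norm_plane[of a' b'] unit
    by (simp_all add: v_def v'_def power2_eq_1_iff) (smt (verit) norm_ge_zero)+
  have cm: "(cmod (cinner (plane r s) x))\<^sup>2 = (r * Re (Rep_ell2 x 0) + s * Re (Rep_ell2 x 1))\<^sup>2
      + (r * Im (Rep_ell2 x 0) + s * Im (Rep_ell2 x 1))\<^sup>2" for r s x
    by (simp add: cinner_plane cmod_power2)
  have "two_eig \<alpha> \<beta> v \<preceq> two_eig \<beta>' \<alpha>' v'"
  proof (rule op_leI[OF two_eig_self_adjoint two_eig_self_adjoint])
    fix x
    have "(\<beta> - \<alpha>) * (cmod (cinner v x))\<^sup>2 + (\<beta>' - \<alpha>') * (cmod (cinner v' x))\<^sup>2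
        \<le> (\<beta>' - \<alpha>) * ((cmod (Rep_ell2 x 0))\<^sup>2 + (cmod (Rep_ell2 x 1))\<^sup>2)"
      using le(2)[of "Re (Rep_ell2 x 0)" "Re (Rep_ell2 x 1)"] le(2)[of "Im (Rep_ell2 x 0)" "Im (Rep_ell2 x 1)"]
      unfolding v_def v'_def cm cmod_power2[of "Rep_ell2 x 0"] cmod_power2[of "Rep_ell2 x 1"] by (simp add: algebra_simps)
    also have "\<dots> \<le> (\<beta>' - \<alpha>) * (norm x)\<^sup>2"
      using le(1) coord_norm_le by (intro mult_left_mono) auto
    finally show "rinner x (two_eig \<alpha> \<beta> v x) \<le> rinner x (two_eig \<beta>' \<alpha>' v' x)"
      unfolding rinner_two_eig by (simp add: algebra_simps)
  qed
  moreover have "spectrum (two_eig \<alpha> \<beta> v) \<subseteq> complex_of_real ` {0<..}"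
    "spectrum (two_eig \<beta>' \<alpha>' v') \<subseteq> complex_of_real ` {0<..}"
    using spectrum_two_eig[OF nv(1), of \<alpha> \<beta>] spectrum_two_eig[OF nv(2), of \<beta>' \<alpha>'] pos by auto
  ultimately have "fun_op f (two_eig \<alpha> \<beta> v) \<preceq> fun_op f (two_eig \<beta>' \<alpha>' v')"
    using f two_eig_self_adjoint unfolding OM1_def operator_monotone_def operator_monotone_on_def by blast
  then have "two_eig (f \<alpha>) (f \<beta>) v \<preceq> two_eig (f \<beta>') (f \<alpha>') v'"
    by (simp add: fun_op_two_eig nv)
  from op_leD[OF this, of "plane c d"] show ?thesis
    by (simp add: rinner_two_eig v_def v'_def cinner_plane_plane norm_plane del: of_real_add of_real_mult)
qed

section \<open>Monotonicity, concavity and differentiability at 1 from two-by-two tests\<close>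

lemma OM1_mono:
  assumes "f \<in> OM1" "0 < x" "x \<le> y"
  shows "f x \<le> f y"
  using OM1_two_by_two[OF assms(1), of x x y y 1 0 1 0 1 0] assms by simp

text \<open>The matrix with eigenvalue t at (sqrt l, sqrt (1-l)) and s orthogonally to it has upper
  left entry mu = (1-l) s + l t. It lies below the diagonal matrix with entries mu + \<epsilon> and
  N once N is large. Comparing the upper left entries after applying f gives the claim.\<close>

lemma OM1_concave_eps:
  assumes f: "f \<in> OM1" and st: "0 < s" "s < t" and l: "0 \<le> l" "l \<le> 1" and "0 < \<epsilon>"
  shows "(1 - l) * f s + l * f t \<le> f ((1 - l) * s + l * t + \<epsilon>)"
proof -
  \<comment> \<open>N exceeds t by what the off-diagonal term costs: 2 u p q <= \<epsilon> p^2 +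
    (u^2/\<epsilon>) q^2 with u = t - s.\<close>
  define N mu a b where "N = t + (t - s)\<^sup>2 / \<epsilon>" and "mu = (1 - l) * s + l * t" and "a = sqrt l" and "b = sqrt (1 - l)"
  have ab: "a\<^sup>2 = l" "b\<^sup>2 = 1 - l" using l by (auto simp: a_def b_def)
  have mu: "mu = s + (t - s) * l" by (simp add: mu_def algebra_simps)
  have mu_pos: "0 < mu + \<epsilon>" using st l \<open>0 < \<epsilon>\<close> by (simp add: mu add_pos_nonneg add_nonneg_pos)
  have N: "t \<le> N" using \<open>0 < \<epsilon>\<close> by (simp add: N_def)
  have form: "(t - s) * (a * p + b * q)\<^sup>2 + (N - (mu + \<epsilon>)) * (1 * p + 0 * q)\<^sup>2 \<le> (N - s) * (p\<^sup>2 + q\<^sup>2)" for p q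
  proof -
    define u where "u = t - s"
    have "a * b * (2 * u * p * q) \<le> \<bar>a * b\<bar> * \<bar>2 * u * p * q\<bar>"
      by (metis abs_ge_self abs_mult)
    also have "\<dots> \<le> 1 * \<bar>2 * u * p * q\<bar>"
    proof (rule mult_right_mono)
      have "\<bar>a * b\<bar> \<le> (a\<^sup>2 + b\<^sup>2) / 2"
        using sum_squares_bound[of "\<bar>a\<bar>" "\<bar>b\<bar>"] by (simp add: abs_mult)
      then show "\<bar>a * b\<bar> \<le> 1" by (simp add: ab)
    qed simp
    also have "\<dots> \<le> \<epsilon> * p\<^sup>2 + u\<^sup>2 / \<epsilon> * q\<^sup>2"
    proof -
      have "2 * (sqrt \<epsilon> * \<bar>p\<bar>) * (\<bar>u\<bar> / sqrt \<epsilon> * \<bar>q\<bar>) \<le> (sqrt \<epsilon> * \<bar>p\<bar>)\<^sup>2 + (\<bar>u\<bar> / sqrt \<epsilon> * \<bar>q\<bar>)\<^sup>2"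
        by (rule sum_squares_bound)
      then show ?thesis using \<open>0 < \<epsilon>\<close> by (simp add: power_mult_distrib power_divide abs_mult mult_ac)
    qed
    finally have "2 * u * (a * b) * p * q \<le> \<epsilon> * p\<^sup>2 + u\<^sup>2 / \<epsilon> * q\<^sup>2" by (simp add: mult_ac)
    moreover have "0 \<le> u * l * q\<^sup>2" using st l by (simp add: u_def)
    moreover have "u * (a * p + b * q)\<^sup>2 = u * (a\<^sup>2 * p\<^sup>2 + b\<^sup>2 * q\<^sup>2) + 2 * u * (a * b) * p * q"
      by (simp add: power2_eq_square algebra_simps)
    then have "u * (a * p + b * q)\<^sup>2 = u * (l * p\<^sup>2 + (1 - l) * q\<^sup>2) + 2 * u * (a * b) * p * q"
      by (simp only: ab)
    moreover have eqs: "N - s = u + u\<^sup>2 / \<epsilon>" "N - (mu + \<epsilon>) = u + u\<^sup>2 / \<epsilon> - u * l - \<epsilon>"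
      by (simp_all add: N_def mu u_def)
    have "(N - s) * (p\<^sup>2 + q\<^sup>2) - (u * (l * p\<^sup>2 + (1 - l) * q\<^sup>2) + (N - (mu + \<epsilon>)) * (1 * p + 0 * q)\<^sup>2)
        = \<epsilon> * p\<^sup>2 + u\<^sup>2 / \<epsilon> * q\<^sup>2 + u * l * q\<^sup>2"
      unfolding eqs by (simp add: algebra_simps)
    ultimately show ?thesis unfolding u_def[symmetric] by linarith
  qed
  have "f s * (1\<^sup>2 + 0\<^sup>2) + (f t - f s) * (a * 1 + b * 0)\<^sup>2
      \<le> f N * (1\<^sup>2 + 0\<^sup>2) + (f (mu + \<epsilon>) - f N) * (1 * 1 + 0 * 0)\<^sup>2"
    by (rule OM1_two_by_two[OF f]) (use st N mu_pos ab form in auto)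
  then show ?thesis unfolding mu_def[symmetric] by (simp add: ab algebra_simps)
qed

text \<open>Letting \<epsilon> tend to 0 would presuppose continuity. Instead the weight is lowered
  to l - \<delta>, and \<epsilon> = \<delta> (t - s) shifts the point back to exactly x; the price
  is \<delta> (f t - f s) on the other side, which tends to 0.\<close>

lemma OM1_concave:
  assumes f: "f \<in> OM1" shows "concave_on {0<..} f"
proof
  fix l s t :: real assume l: "0 < l" "l < 1" and st: "s \<in> {0<..}" "t \<in> {0<..}" "s < t"
  define x where "x = (1 - l) * s + l * t"
  have *: "(1 - l) * f s + l * f t \<le> f x + \<delta> * (f t - f s)" if "0 < \<delta>" "\<delta> \<le> l" for \<delta>
  proof -
    have "(1 - (l - \<delta>)) * f s + (l - \<delta>) * f t \<le> f ((1 - (l - \<delta>)) * s + (l - \<delta>) * t + \<delta> * (t - s))"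
      using l st that by (intro OM1_concave_eps[OF f]) auto
    also have "(1 - (l - \<delta>)) * s + (l - \<delta>) * t + \<delta> * (t - s) = x" by (simp add: x_def algebra_simps)
    finally show ?thesis by (simp add: algebra_simps)
  qed
  have "f s \<le> f t" using OM1_mono[OF f] st by simp
  have "(1 - l) * f s + l * f t \<le> f x"
  proof (rule field_le_epsilon)
    fix e :: real assume "0 < e"
    define \<delta> where "\<delta> = min l (e / (f t - f s + 1))"
    have \<delta>: "0 < \<delta>" "\<delta> \<le> l" "\<delta> \<le> e / (f t - f s + 1)" using l \<open>0 < e\<close> \<open>f s \<le> f t\<close> by (auto simp: \<delta>_def)
    have "\<delta> * (f t - f s) \<le> e / (f t - f s + 1) * (f t - f s + 1)"
      using \<delta> \<open>f s \<le> f t\<close> by (intro mult_mono) auto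
    also have "\<dots> = e" using \<open>f s \<le> f t\<close> by simp
    finally show "(1 - l) * f s + l * f t \<le> f x + e" using *[OF \<delta>(1,2)] by simp
  qed
  then show "(1 - l) * f s + l * f t \<le> f ((1 - l) *\<^sub>R s + l *\<^sub>R t)" by (simp add: x_def)
qed (rule convex_real_interval)

lemma OM1_continuous:
  assumes f: "f \<in> OM1" shows "continuous_on {0<..} f"
proof -
  have "continuous_on {0<..} (\<lambda>x. - f x)"
    using OM1_concave[OF f] by (intro convex_on_continuous) (auto simp: concave_on_def)
  then show ?thesis using continuous_on_minus by fastforce
qed

text \<open>The comparison of \<open>diag(0,-8) \<le> ((3,3),(3,-5))\<close>, the latter with eigenvalues \<open>4\<close> and \<open>-6\<close>,
  tested at the vectors \<open>(1,-1)\<close> and \<open>(1,0)\<close>. Equality holds in the first inequality for affine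
  functions, and it fails for a function with a concave kink at \<open>c\<close>.\<close>

lemma OM1_kink:
  assumes f: "f \<in> OM1" and r: "0 < r" "8 * r < c"
  shows "f c + f (c - 8 * r) \<le> 2 / 5 * f (c + 4 * r) + 8 / 5 * f (c - 6 * r)"
    and "f c \<le> 9 / 10 * f (c + 4 * r) + 1 / 10 * f (c - 6 * r)"
proof -
  \<comment> \<open>Normalizes the eigenvector (1,-3) of the second matrix for -6. Both matrices are
    scaled by r and shifted by c.\<close>
  define w where "w = 1 / sqrt 10"
  have w: "w * w = 1 / 10" by (simp add: w_def)
  have unit: "w\<^sup>2 + (-3 * w)\<^sup>2 = 1" "(1::real)\<^sup>2 + 0\<^sup>2 = 1" using w by (simp_all add: power2_eq_square)
  \<comment> \<open>The difference of the two matrices is r times the matrix with all entries 3,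
    whose form is 3 r (p+q)^2.\<close>
  have form: "(c - (c - 8 * r)) * (1 * p + 0 * q)\<^sup>2 + ((c + 4 * r) - (c - 6 * r)) * (w * p + (-3 * w) * q)\<^sup>2
      \<le> ((c + 4 * r) - (c - 8 * r)) * (p\<^sup>2 + q\<^sup>2)" for p q
  proof -
    have "(w * p + (-3 * w) * q)\<^sup>2 = (w * w) * (p - 3 * q)\<^sup>2" by (simp add: power2_eq_square algebra_simps)
    also have "\<dots> = (p - 3 * q)\<^sup>2 / 10" by (simp add: w)
    finally have sq: "(w * p + (-3 * w) * q)\<^sup>2 = (p - 3 * q)\<^sup>2 / 10" .
    have "((c + 4 * r) - (c - 8 * r)) * (p\<^sup>2 + q\<^sup>2)
      - ((c - (c - 8 * r)) * (1 * p + 0 * q)\<^sup>2 + ((c + 4 * r) - (c - 6 * r)) * (w * p + (-3 * w) * q)\<^sup>2)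
      = 3 * r * (p + q)\<^sup>2" unfolding sq by (simp add: power2_eq_square field_simps)
    moreover have "0 \<le> 3 * r * (p + q)\<^sup>2" using r by simp
    ultimately show ?thesis by linarith
  qed
  note two = OM1_two_by_two[OF f, of "c - 8 * r" c "c - 6 * r" "c + 4 * r" 1 0 w "-3 * w", OF _ _ _ _ unit(2,1) _ form]
  have e: "(w * 1 + -3 * w * -1)\<^sup>2 = 8 / 5" "(w * 1 + -3 * w * 0)\<^sup>2 = 1 / 10"
    using w by (simp_all add: power2_eq_square)
  have "f (c - 8 * r) * (1\<^sup>2 + (-1)\<^sup>2) + (f c - f (c - 8 * r)) * (1 * 1 + 0 * -1)\<^sup>2
      \<le> f (c + 4 * r) * (1\<^sup>2 + (-1)\<^sup>2) + (f (c - 6 * r) - f (c + 4 * r)) * (w * 1 + -3 * w * -1)\<^sup>2"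
    by (rule two) (use r in auto)
  then show "f c + f (c - 8 * r) \<le> 2 / 5 * f (c + 4 * r) + 8 / 5 * f (c - 6 * r)"
    unfolding e by (simp add: algebra_simps)
  have "f (c - 8 * r) * (1\<^sup>2 + 0\<^sup>2) + (f c - f (c - 8 * r)) * (1 * 1 + 0 * 0)\<^sup>2
      \<le> f (c + 4 * r) * (1\<^sup>2 + 0\<^sup>2) + (f (c - 6 * r) - f (c + 4 * r)) * (w * 1 + -3 * w * 0)\<^sup>2"
    by (rule two) (use r in auto)
  then show "f c \<le> 9 / 10 * f (c + 4 * r) + 1 / 10 * f (c - 6 * r)"
    unfolding e by (simp add: algebra_simps)
qed

text \<open>Needed to exclude derivative 0 at 1. If f equals 1 at c and at c + 4r, the second kink
  inequality forces f (c - 6r) to be at least 1. The constraint 8r < c lets c - 6r reach every point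
  from c/2 up to c, so flatness spreads downwards by halving.\<close>

lemma OM1_flat_imp_const:
  assumes f: "f \<in> OM1" and flat: "\<And>x. 1 \<le> x \<Longrightarrow> f x = 1"
  shows "0 < x \<Longrightarrow> f x = 1"
proof -
  have le: "f x \<le> 1" if "0 < x" for x
  proof (cases "x \<le> 1")
    case True
    then show ?thesis using OM1_mono[OF f that True] OM1_one[OF f] by linarith
  next
    case False
    then show ?thesis using flat[of x] by linarith
  qed
  have *: "f x = 1" if "1 / 2 ^ j \<le> x" for j x
    using that
  proof (induction j arbitrary: x)
    case 0 then show ?case using flat by simp
  next
    case (Suc j)
    define c :: real where "c = 1 / 2 ^ j"
    have c: "0 < c" "c / 2 \<le> x" using Suc.prems by (auto simp: c_def field_simps)
    show ?case
    proof (cases "c \<le> x")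
      case True then show ?thesis using Suc.IH by (simp add: c_def)
    next
      case False
      define r where "r = (c - x) / 6"
      have r: "0 < r" "8 * r < c" using False c by (auto simp: r_def)
      have rx: "c - 6 * r = x" by (simp add: r_def field_simps)
      have "f c = 1" "f (c + 4 * r) = 1" using Suc.IH r by (auto simp: c_def)
      then have "1 \<le> f x" using OM1_kink(2)[OF f r] rx by simp
      then show ?thesis using le[of x] c by simp
    qed
  qed
  show "f x = 1" if "0 < x"
  proof -
    obtain j where "1 / 2 ^ j < x" using \<open>0 < x\<close> real_arch_pow_inv[of x "1/2"] by (auto simp: power_one_over)
    then show ?thesis using *[of j x] by simp
  qed
qed

text \<open>By concavity the quotients D decrease, so d, the infimum of the left ones, is the left
  derivative and bounds the right ones from above. The first kink inequality bounds a right quotient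
  from below by two left quotients, which makes the one-sided derivatives equal. That d is nonzero
  follows from \<open>OM1_flat_imp_const\<close>.\<close>

lemma OM1_derivative:
  assumes f: "f \<in> OM1" and nc: "\<not> (\<exists>c. \<forall>s>0. f s = c)"
  obtains d where "0 < d" "(f has_real_derivative d) (at 1)" "\<And>x. 0 < x \<Longrightarrow> f x \<le> 1 + d * (x - 1)"
proof -
  note f1 = OM1_one[OF f]
  define D where "D h = (f (1 + h) - 1) / h" for h
  have slope: "D k \<le> D h" if hk: "-1 < h" "h < k" "h \<noteq> 0" "k \<noteq> 0" for h k
  proof -
    have cv: "convex_on {0<..} (\<lambda>x. - f x)" using OM1_concave[OF f] by (simp add: concave_on_def)
    consider "k < 0" | "h < 0" "0 < k" | "0 < h" using hk by linarith
    then show ?thesis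
    proof cases
      case 1
      have "(- f (1 + h) - - f 1) / (1 + h - 1) \<le> (- f (1 + k) - - f 1) / (1 + k - 1)"
        using 1 hk by (intro convex_on_slope_le(2)[OF cv]) auto
      then show ?thesis by (simp add: D_def f1 diff_divide_distrib)
    next
      case 2
      have "(- f (1 + h) - - f 1) / (1 + h - 1) \<le> (- f 1 - - f (1 + k)) / (1 - (1 + k))"
        using 2 hk convex_on_slope_le[OF cv, of "1 + h" "1 + k" 1] by (intro order_trans[OF convex_on_slope_le(1,2)[OF cv, of "1 + h" "1 + k" 1]]) auto
      then show ?thesis by (simp add: D_def f1 diff_divide_distrib)
    next
      case 3
      have "(- f 1 - - f (1 + h)) / (1 - (1 + h)) \<le> (- f 1 - - f (1 + k)) / (1 - (1 + k))"
        using 3 hk by (intro convex_on_slope_le(1)[OF cv]) auto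
      then show ?thesis by (simp add: D_def f1 diff_divide_distrib)
    qed
  qed
  define S d where "S = D ` {-1<..<0}" and "d = Inf S"
  have S: "S \<noteq> {}" by (auto simp: S_def)
  have pos_le: "D h \<le> y" if "0 < h" "y \<in> S" for h y
    using that slope by (auto simp: S_def)
  have bdd: "bdd_below S" using pos_le[of 1] by (auto simp: bdd_below_def)
  have dpos: "D h \<le> d" if "0 < h" for h
    unfolding d_def using pos_le[OF that] by (intro cInf_greatest[OF S])
  have dneg: "d \<le> D h" if "-1 < h" "h < 0" for h
    unfolding d_def using that by (intro cInf_lower bdd) (auto simp: S_def)
  have tangent: "f x \<le> 1 + d * (x - 1)" if "0 < x" for x
  proof -
    consider "x < 1" | "x = 1" | "1 < x" by linarith
    then show ?thesis
    proof cases
      case 1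
      then have "d \<le> (f x - 1) / (x - 1)" using dneg[of "x - 1"] that by (simp add: D_def)
      then show ?thesis using 1 by (simp add: field_simps)
    next
      case 3
      then have "(f x - 1) / (x - 1) \<le> d" using dpos[of "x - 1"] that by (simp add: D_def)
      then show ?thesis using 3 by (simp add: field_simps)
    qed (simp add: f1)
  qed
  have deriv: "(f has_real_derivative d) (at 1)"
    unfolding DERIV_def LIM_eq
  proof (intro allI impI)
    fix e :: real assume "0 < e"
    \<comment> \<open>The kink inequality reads D(4r) >= 6 D(-6r) - 5 D(-8r), so the right quotient
      exceeds d - 5 e'; a sixth of e leaves room.\<close>
    define e' where "e' = e / 6"
    have e': "0 < e'" using \<open>0 < e\<close> by (simp add: e'_def)
    obtain y where "y \<in> S" "y < d + e'"
      using cInf_lessD[OF S, of "d + e'"] e' by (auto simp: d_def)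
    then obtain h0 where h0: "-1 < h0" "h0 < 0" "D h0 < d + e'" by (auto simp: S_def)
    have near: "d \<le> D h" "D h < d + e'" if "h0 \<le> h" "h < 0" for h
    proof -
      show "d \<le> D h" using dneg h0 that by simp
      show "D h < d + e'" using slope[of h0 h] h0 that by (cases "h = h0") auto
    qed
    \<comment> \<open>A positive h is compared, with 4r = h, to left increments as long as 8r = 2h.
      Half of |h0| keeps these within the range where D is close to d, and makes 8r < 1.\<close>
    have "\<bar>D h - d\<bar> < e" if h: "h \<noteq> 0" "\<bar>h\<bar> < - h0 / 2" for h
    proof (cases "h < 0")
      case True
      then show ?thesis using near[of h] h e' h0 by (auto simp: e'_def)
    next
      case False
      then have "0 < h" using h by simp
      define r where "r = h / 4"
      have r: "0 < r" "8 * r < 1" "h0 \<le> - 8 * r" using \<open>0 < h\<close> h h0 by (auto simp: r_def)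
      have fD: "f (1 + k) = 1 + k * D k" if "k \<noteq> 0" for k using that by (simp add: D_def)
      have "1 + (1 - 8 * r * D (- 8 * r)) \<le> 2 / 5 * (1 + 4 * r * D (4 * r)) + 8 / 5 * (1 - 6 * r * D (- 6 * r))"
        using OM1_kink(1)[OF f r(1,2)] fD[of "- 8 * r"] fD[of "4 * r"] fD[of "- 6 * r"] r(1) by (simp add: f1)
      then have "r * (48 * D (- 6 * r) - 40 * D (- 8 * r)) \<le> r * (8 * D (4 * r))"
        by (simp add: algebra_simps)
      then have "48 * D (- 6 * r) - 40 * D (- 8 * r) \<le> 8 * D (4 * r)" using r(1) by simp
      moreover have "d \<le> D (- 6 * r)" "D (- 8 * r) < d + e'" using near r by auto
      ultimately have "d - 5 * e' < D h" by (simp add: r_def)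
      then show ?thesis using dpos[OF \<open>0 < h\<close>] e' by (auto simp: e'_def abs_less_iff)
    qed
    then show "\<exists>s>0. \<forall>x. x \<noteq> 0 \<and> norm (x - 0) < s \<longrightarrow> norm ((f (1 + x) - f 1) / x - d) < e"
      using h0 by (intro exI[of _ "- h0 / 2"]) (auto simp: D_def f1)
  qed
  have "0 \<le> d"
    unfolding d_def
  proof (rule cInf_greatest[OF S])
    fix y assume "y \<in> S"
    then obtain h where h: "y = D h" "-1 < h" "h < 0" by (auto simp: S_def)
    then have "f (1 + h) \<le> 1" using OM1_mono[OF f, of "1 + h" 1] f1 by simp
    then show "0 \<le> y" using h by (simp add: D_def divide_nonpos_neg)
  qed
  moreover have "d \<noteq> 0"
  proof
    assume "d = 0"
    then have "f x \<le> 1" if "0 < x" for x using tangent[OF that] by simp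
    then have "f x = 1" if "1 \<le> x" for x
      using that OM1_mono[OF f, of 1 x] f1 by (intro antisym) auto
    then show False using OM1_flat_imp_const[OF f] nc by blast
  qed
  ultimately show thesis using that[OF _ deriv tangent] by simp
qed

lemma inverse_le_tangent_eps:
  fixes f :: "real \<Rightarrow> real"
  assumes f1: "f 1 = 1" and d: "(f has_real_derivative d) (at 1)" and "0 < e"
  obtains \<delta> where "0 < \<delta>" "\<And>x. \<bar>x - 1\<bar> < \<delta> \<Longrightarrow> inverse (f x) \<le> 1 - d * (x - 1) + e * \<bar>x - 1\<bar>"
proof -
  have "((\<lambda>x. inverse (f x)) has_real_derivative - d) (at 1)"
    by (rule derivative_eq_intros d | simp add: f1)+
  then have "\<exists>s>0. \<forall>h. h \<noteq> 0 \<and> norm (h - 0) < s \<longrightarrow> norm ((inverse (f (1 + h)) - inverse (f 1)) / h - - d) < e"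
    using \<open>0 < e\<close> unfolding DERIV_def LIM_eq by blast
  then obtain s where s: "0 < s" "\<And>h. h \<noteq> 0 \<Longrightarrow> \<bar>h\<bar> < s \<Longrightarrow> \<bar>(inverse (f (1 + h)) - 1) / h + d\<bar> < e"
    by (auto simp: f1)
  show thesis
  proof (rule that[OF s(1)])
    fix x assume x: "\<bar>x - 1\<bar> < s"
    show "inverse (f x) \<le> 1 - d * (x - 1) + e * \<bar>x - 1\<bar>"
    proof (cases "x = 1")
      case False
      define h where "h = x - 1"
      have h: "h \<noteq> 0" "x = 1 + h" using False by (auto simp: h_def)
      have "\<bar>inverse (f x) - 1 + d * h\<bar> = \<bar>((inverse (f (1 + h)) - 1) / h + d) * h\<bar>"
        using h by (simp add: distrib_right)
      also have "\<dots> \<le> e * \<bar>h\<bar>"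
        unfolding abs_mult using s(2)[OF h(1)] x by (intro mult_right_mono) (auto simp: h_def)
      finally show ?thesis unfolding h_def by linarith
    qed (simp add: f1)
  qed
qed

section \<open>The equivalence\<close>

lemma perturbed_identity:
  fixes T :: "'a::chilbert_space op"
  assumes "T \<in> self_adjoint_ops" "norm T \<le> K" "0 \<le> l"
  shows "l *\<^sub>R T + id_blinfun \<in> op_interval (1 - l * K) (1 + l * K)"
proof -
  have T: "T \<in> op_interval (- K) K"
    using assms(2) by (intro op_interval_mono[OF self_adjoint_op_interval[OF assms(1)]]) auto
  have "(1 - l * K) * (norm x)\<^sup>2 \<le> l * rinner x (T x) + (norm x)\<^sup>2"
    "l * rinner x (T x) + (norm x)\<^sup>2 \<le> (1 + l * K) * (norm x)\<^sup>2" for x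
  proof -
    have "l * (- K * (norm x)\<^sup>2) \<le> l * rinner x (T x)" "l * rinner x (T x) \<le> l * (K * (norm x)\<^sup>2)"
      by (intro mult_left_mono op_interval_lower[OF T] op_interval_upper[OF T] assms(3))+
    then show "(1 - l * K) * (norm x)\<^sup>2 \<le> l * rinner x (T x) + (norm x)\<^sup>2"
      "l * rinner x (T x) + (norm x)\<^sup>2 \<le> (1 + l * K) * (norm x)\<^sup>2"
      by (simp_all add: left_diff_distrib distrib_right mult.assoc)
  qed
  moreover have "l *\<^sub>R T + id_blinfun \<in> self_adjoint_ops"
    using assms(1) by (intro self_adjoint_add self_adjoint_scaleR) auto
  ultimately show ?thesis
    by (simp add: op_interval_def blinfun.bilinear_simps rinner_add_right rinner_scaleR_right rinner_self)
qed

lemma fun_op_affine: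
  fixes A :: "'a::chilbert_space op"
  assumes "A \<in> op_interval a b"
  shows "fun_op (\<lambda>s. u + c * s) A = u *\<^sub>R id_blinfun + c *\<^sub>R A"
  using assms
  by (simp add: fun_op_add fun_op_const fun_op_scale fun_op_ident continuous_intros)

locale om1_perturbation =
  fixes f :: "real \<Rightarrow> real" and d :: real and n :: nat and T :: "nat \<Rightarrow> 'a::chilbert_space op" and K :: real
  assumes f: "f \<in> OM1" and d: "0 < d" and tangent: "\<And>x. 0 < x \<Longrightarrow> f x \<le> 1 + d * (x - 1)"
    and n: "n \<ge> 2" and T: "\<And>i. i \<in> {1..n} \<Longrightarrow> T i \<in> self_adjoint_ops"
    and K: "0 < K" "\<And>i. i \<in> {1..n} \<Longrightarrow> norm (T i) \<le> K"
begin

definition S :: "real \<Rightarrow> nat \<Rightarrow> 'a op" where "S l i = l *\<^sub>R T i + id_blinfun"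

definition mean :: "'a op" where "mean = (\<Sum>i=1..n. (1 / real n) *\<^sub>R T i)"

lemma rinner_mean: "(\<Sum>i=1..n. rinner x (T i x)) / real n = rinner x (mean x)"
  by (simp add: mean_def blinfun.sum_left rinner.sum_right blinfun.scaleR_left rinner_scaleR_right sum_divide_distrib)

context
  fixes l :: real
  assumes l: "0 \<le> l" "l * K \<le> 1 / 2"
begin

lemma lK: "0 \<le> l * K"
  using l K by simp

lemma S_interval: "i \<in> {1..n} \<Longrightarrow> S l i \<in> op_interval (1 - l * K) (1 + l * K)"
  unfolding S_def using perturbed_identity T K(2) l(1) by blast

lemma S_range: "s \<in> {1 - l * K..1 + l * K} \<Longrightarrow> 1 / 2 \<le> s \<and> s \<le> 3 / 2"
  using l lK by auto

lemma continuous_f: "continuous_on {1 - l * K..1 + l * K} f"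
  by (rule continuous_on_subset[OF OM1_continuous[OF f]]) (use S_range in force)

lemma f_range: "s \<in> {1 - l * K..1 + l * K} \<Longrightarrow> f (1 / 2) \<le> f s \<and> f s \<le> f (3 / 2)"
  using S_range[of s] OM1_mono[OF f, of "1 / 2" s] OM1_mono[OF f, of s "3 / 2"] by auto

lemma f_half: "0 < f (1 / 2)"
  by (rule OM1_pos[OF f]) simp

lemma fS_interval: "i \<in> {1..n} \<Longrightarrow> fun_op f (S l i) \<in> op_interval (f (1 / 2)) (f (3 / 2))"
  by (rule fun_op_interval[OF S_interval continuous_f f_range])

text \<open>The bound \<open>l * K \<le> 1 / 2\<close> keeps the form bounds of \<open>S l i\<close>
  in [1/2, 3/2], so monotonicity of f gives bounds that do not depend on l.\<close>

lemma operator_tuple_fS: "operator_tuple n (\<lambda>i. fun_op f (S l i)) (f (1 / 2)) (f (3 / 2))"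
  using n f_half OM1_mono[OF f, of "1 / 2" "3 / 2"] fS_interval by unfold_locales auto

lemma spectrum_S: "i \<in> {1..n} \<Longrightarrow> spectrum (S l i) \<subseteq> complex_of_real ` {0<..}"
  using spectrum_op_interval[OF S_interval, of i] S_range by force

lemma fS_le:
  assumes i: "i \<in> {1..n}"
  shows "rinner x (fun_op f (S l i) x) \<le> (norm x)\<^sup>2 + l * d * rinner x (T i x)"
proof -
  have "fun_op f (S l i) \<preceq> fun_op (\<lambda>s. (1 - d) + d * s) (S l i)"
  proof (rule fun_op_mono[OF S_interval[OF i] continuous_f])
    fix s assume "s \<in> {1 - l * K..1 + l * K}"
    then have "0 < s" using S_range by force
    from tangent[OF this] show "f s \<le> 1 - d + d * s" by (simp add: algebra_simps)
  qed (intro continuous_intros)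
  from op_leD[OF this, of x] show ?thesis
    unfolding fun_op_affine[OF S_interval[OF i]]
    by (simp add: S_def blinfun.bilinear_simps rinner_add_right rinner_scaleR_right rinner_self algebra_simps)
qed

lemma inv_fS_le:
  assumes i: "i \<in> {1..n}"
    and e: "\<And>s. \<bar>s - 1\<bar> \<le> l * K \<Longrightarrow> inverse (f s) \<le> 1 - d * (s - 1) + c"
  shows "rinner x (inv_op (fun_op f (S l i)) x) \<le> (1 + c) * (norm x)\<^sup>2 - l * d * rinner x (T i x)"
proof -
  have cinv: "continuous_on {f (1 / 2)..f (3 / 2)} inverse"
    by (intro continuous_intros) (use f_half in auto)
  have "inv_op (fun_op f (S l i)) = fun_op inverse (fun_op f (S l i))"
    by (rule inv_op_eq_fun_op(2)[OF fS_interval[OF i] f_half])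
  also have "\<dots> = fun_op (\<lambda>s. inverse (f s)) (S l i)"
    by (rule fun_op_comp[OF S_interval[OF i] continuous_f _ cinv]) (use f_range in auto)
  also have "\<dots> \<preceq> fun_op (\<lambda>s. (1 + d + c) + (- d) * s) (S l i)"
  proof (rule fun_op_mono[OF S_interval[OF i]])
    have "f s \<noteq> 0" if "s \<in> {1 - l * K..1 + l * K}" for s
      using f_range[OF that] f_half by auto
    then show "continuous_on {1 - l * K..1 + l * K} (\<lambda>s. inverse (f s))"
      by (intro continuous_on_inverse continuous_f) auto
    fix s assume "s \<in> {1 - l * K..1 + l * K}"
    then have "inverse (f s) \<le> 1 - d * (s - 1) + c" by (intro e) auto
    then show "inverse (f s) \<le> 1 + d + c + (- d) * s" by (simp add: algebra_simps)
  qed (intro continuous_intros)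
  finally have "inv_op (fun_op f (S l i)) \<preceq> (1 + d + c) *\<^sub>R id_blinfun + (- d) *\<^sub>R S l i"
    by (simp only: fun_op_affine[OF S_interval[OF i]])
  from op_leD[OF this, of x] show ?thesis
    by (simp add: S_def blinfun.bilinear_simps rinner_add_right rinner_scaleR_right rinner_self
        rinner.diff_right rinner.minus_right algebra_simps)
qed

lemma log_mean_upper:
  "rinner x (log_mean n (\<lambda>i. fun_op f (S l i)) x) \<le> (norm x)\<^sup>2 + l * d * rinner x (mean x)"
proof -
  interpret operator_tuple n "\<lambda>i. fun_op f (S l i)" "f (1 / 2)" "f (3 / 2)" by (rule operator_tuple_fS)
  have "rinner x (log_mean n (\<lambda>i. fun_op f (S l i)) x) \<le> (\<Sum>i=1..n. rinner x (fun_op f (S l i) x)) / real n"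
    by (rule log_mean_le_arith)
  also have "\<dots> \<le> (\<Sum>i=1..n. (norm x)\<^sup>2 + l * d * rinner x (T i x)) / real n"
    by (intro divide_right_mono sum_mono fS_le) auto
  also have "\<dots> = (norm x)\<^sup>2 + l * d * rinner x (mean x)"
    using n by (simp add: sum.distrib add_divide_distrib rinner_mean[symmetric] flip: sum_distrib_left)
  finally show ?thesis .
qed

lemma log_mean_lower:
  assumes e: "\<And>s. \<bar>s - 1\<bar> \<le> l * K \<Longrightarrow> inverse (f s) \<le> 1 - d * (s - 1) + c"
  shows "(1 - c) * (norm x)\<^sup>2 + l * d * rinner x (mean x) \<le> rinner x (log_mean n (\<lambda>i. fun_op f (S l i)) x)"
proof -
  interpret operator_tuple n "\<lambda>i. fun_op f (S l i)" "f (1 / 2)" "f (3 / 2)" by (rule operator_tuple_fS)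
  have "(\<Sum>i=1..n. rinner x (inv_op (fun_op f (S l i)) x)) / real n
      \<le> (\<Sum>i=1..n. (1 + c) * (norm x)\<^sup>2 - l * d * rinner x (T i x)) / real n"
    by (intro divide_right_mono sum_mono inv_fS_le e) auto
  also have "\<dots> = (1 + c) * (norm x)\<^sup>2 - l * d * rinner x (mean x)"
    using n by (simp add: sum_subtractf diff_divide_distrib rinner_mean[symmetric] flip: sum_distrib_left)
  finally show ?thesis using log_mean_ge_harm[of x] by (simp add: algebra_simps)
qed

end

lemma mean_self_adjoint: "mean \<in> self_adjoint_ops"
  unfolding mean_def by (intro self_adjoint_sum self_adjoint_scaleR T)

text \<open>Forward, the upper bound is exact, so every l up to 1/(2K) works. Backward, the lower
  bound has an error e l K |x|^2 proportional to l; division by l leaves e K |x|^2, and then e tends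
  to 0. One small l for each e suffices.\<close>

lemma mean_nonpos_iff:
  assumes deriv: "(f has_real_derivative d) (at 1)"
  shows "mean \<preceq> 0 \<longleftrightarrow> (\<exists>l0>0. \<forall>l\<in>{0..l0}.
     (\<forall>i\<in>{1..n}. spectrum (S l i) \<subseteq> complex_of_real ` {0<..}) \<and>
     log_mean n (\<lambda>i. fun_op f (S l i)) \<preceq> id_blinfun)" (is "_ \<longleftrightarrow> ?R")
proof
  assume neg: "mean \<preceq> 0"
  have "\<forall>l\<in>{0..1 / (2 * K)}. (\<forall>i\<in>{1..n}. spectrum (S l i) \<subseteq> complex_of_real ` {0<..}) \<and>
     log_mean n (\<lambda>i. fun_op f (S l i)) \<preceq> id_blinfun"
  proof
    fix l assume "l \<in> {0..1 / (2 * K)}"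
    then have l: "0 \<le> l" "l * K \<le> 1 / 2" using K by (auto simp: field_simps)
    interpret operator_tuple n "\<lambda>i. fun_op f (S l i)" "f (1 / 2)" "f (3 / 2)" by (rule operator_tuple_fS[OF l])
    have "log_mean n (\<lambda>i. fun_op f (S l i)) \<preceq> id_blinfun"
    proof (rule op_leI[OF log_mean_self_adjoint self_adjoint_id])
      fix x
      have "rinner x (mean x) \<le> 0" using op_leD[OF neg, of x] by (simp add: rinner.zero_right)
      then have "l * d * rinner x (mean x) \<le> 0" using l d by (simp add: mult_nonneg_nonpos)
      then show "rinner x (log_mean n (\<lambda>i. fun_op f (S l i)) x) \<le> rinner x (id_blinfun x)"
        using log_mean_upper[OF l, of x] by (simp add: rinner_self)
    qed
    then show "(\<forall>i\<in>{1..n}. spectrum (S l i) \<subseteq> complex_of_real ` {0<..}) \<and>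
        log_mean n (\<lambda>i. fun_op f (S l i)) \<preceq> id_blinfun" using spectrum_S[OF l] by blast
  qed
  then show ?R using K by (intro exI[of _ "1 / (2 * K)"]) auto
next
  assume ?R
  then obtain l0 where l0: "0 < l0" "\<And>l. l \<in> {0..l0} \<Longrightarrow> log_mean n (\<lambda>i. fun_op f (S l i)) \<preceq> id_blinfun"
    by blast
  show "mean \<preceq> 0"
  proof (rule op_leI[OF mean_self_adjoint self_adjoint_zero])
    fix x
    have *: "d * rinner x (mean x) \<le> e * (K * (norm x)\<^sup>2)" if "0 < e" for e
    proof -
      obtain \<delta> where \<delta>: "0 < \<delta>" "\<And>s. \<bar>s - 1\<bar> < \<delta> \<Longrightarrow> inverse (f s) \<le> 1 - d * (s - 1) + e * \<bar>s - 1\<bar>"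
        using inverse_le_tangent_eps[OF OM1_one[OF f] deriv \<open>0 < e\<close>] by blast
      \<comment> \<open>Three demands: l is admissible for the hypothesis, the form bounds stay in
        [1/2, 3/2], and |s - 1| <= l K stays strictly below \<delta>.\<close>
      define l where "l = min l0 (min (1 / (2 * K)) (\<delta> / (2 * K)))"
      have l: "0 < l" "l \<le> l0" "l \<le> 1 / (2 * K)" "l \<le> \<delta> / (2 * K)" using l0 K \<delta> by (auto simp: l_def)
      have lK: "l * K \<le> 1 / 2" "l * K \<le> \<delta> / 2" using l K by (auto simp: field_simps)
      have "inverse (f s) \<le> 1 - d * (s - 1) + e * (l * K)" if s: "\<bar>s - 1\<bar> \<le> l * K" for s
      proof -
        have "inverse (f s) \<le> 1 - d * (s - 1) + e * \<bar>s - 1\<bar>" using s lK \<delta> by (intro \<delta>(2)) linarith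
        also have "\<dots> \<le> 1 - d * (s - 1) + e * (l * K)" using s \<open>0 < e\<close> by (simp add: mult_left_mono)
        finally show ?thesis .
      qed
      from log_mean_lower[OF _ lK(1) this, of x]
      have "(1 - e * (l * K)) * (norm x)\<^sup>2 + l * d * rinner x (mean x)
          \<le> rinner x (log_mean n (\<lambda>i. fun_op f (S l i)) x)" using l by simp
      also have "\<dots> \<le> (norm x)\<^sup>2" using op_leD[OF l0(2)[of l], of x] l by (simp add: rinner_self)
      finally have "l * (d * rinner x (mean x)) \<le> l * (e * (K * (norm x)\<^sup>2))" by (simp add: algebra_simps)
      then show ?thesis using l(1) by simp
    qed
    have "d * rinner x (mean x) \<le> 0"
    proof (rule field_le_epsilon)
      fix c :: real assume "0 < c"
      define N where "N = K * (norm x)\<^sup>2 + 1"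
      have N: "0 < N" "K * (norm x)\<^sup>2 \<le> N" using K by (auto simp: N_def intro: add_nonneg_pos)
      have "d * rinner x (mean x) \<le> c / N * (K * (norm x)\<^sup>2)" using N \<open>0 < c\<close> by (intro *) auto
      also have "\<dots> \<le> c / N * N" using N \<open>0 < c\<close> by (intro mult_left_mono) auto
      finally show "d * rinner x (mean x) \<le> 0 + c" using N by simp
    qed
    then show "rinner x (mean x) \<le> rinner x (blinfun_apply 0 x)"
      using d by (simp add: mult_le_0_iff rinner.zero_right)
  qed
qed

end

theorem corollary11:
  fixes f :: "real \<Rightarrow> real" and n :: nat
    and T :: "nat \<Rightarrow> 'h::chilbert_space \<Rightarrow>\<^sub>L 'h"
  assumes "\<exists>x::'h. x \<noteq> 0"
    and "n \<ge> 2"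
    and "f \<in> OM1"
    and "\<not> (\<exists>c. \<forall>s>0. f s = c)"
    and "\<forall>i\<in>{1..n}. T i \<in> self_adjoint_ops"
  shows "(\<Sum>i=1..n. (1 / real n) *\<^sub>R T i) \<preceq> 0 \<longleftrightarrow>
    (\<exists>l0>0. \<forall>l\<in>{0..l0}.
       (\<forall>i\<in>{1..n}. spectrum (l *\<^sub>R T i + id_blinfun) \<subseteq> complex_of_real ` {0<..}) \<and>
       log_mean n (\<lambda>i. fun_op f (l *\<^sub>R T i + id_blinfun)) \<preceq> id_blinfun)"
proof -
  obtain d where d: "0 < d" and deriv: "(f has_real_derivative d) (at 1)"
    and tangent: "\<And>x. 0 < x \<Longrightarrow> f x \<le> 1 + d * (x - 1)"
    using OM1_derivative[OF assms(3,4)] by blast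
  \<comment> \<open>The summand 1 keeps K positive when all T i vanish, so that 1/(2K) is a positive
    bound for l.\<close>
  define K where "K = 1 + (\<Sum>i=1..n. norm (T i))"
  have "norm (T i) \<le> K" if "i \<in> {1..n}" for i
    unfolding K_def using member_le_sum[OF that, of "\<lambda>i. norm (T i)"] by simp
  moreover have "0 < K" unfolding K_def by (intro add_pos_nonneg sum_nonneg) auto
  ultimately interpret om1_perturbation f d n T K
    using assms d tangent by unfold_locales auto
  show ?thesis using mean_nonpos_iff[OF deriv] by (simp only: mean_def S_def)
qed

end
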